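(* Let $(G,\cdot,\rhd,\Phi)$ be a twisted post-Lie group with Lie algebra $(\mathfrak g,[\cdot,\cdot])$. Then $(\mathfrak g,[\cdot,\cdot],\triangleright,\phi)$ is a twisted post-Lie algebra, where $\phi=\Phi_{*1}$ and $$x\triangleright y=\left.\frac{\mathrm d}{\mathrm dt}\right|_{t=0}(L^{\rhd}_{\exp(tx)})_{*1}(y)=\left.\frac{\mathrm d}{\mathrm dt}\right|_{t=0}\left.\frac{\mathrm d}{\mathrm ds}\right|_{s=0}L^{\rhd}_{\exp(tx)}(\exp(sy)),\quad x,y\in\mathfrak g.$$ Moreover, let $F:(G,\cdot_G,\rhd_G,\Phi_G)\to(H,\cdot_H,\rhd_H,\Phi_H)$ be a twisted post-Lie group homomorphism. Then $f=F_{*1_G}:(\mathfrak g,[\cdot,\cdot]_{\mathfrak g},\triangleright_{\mathfrak g},\phi_{\mathfrak g})\to(\mathfrak h,[\cdot,\cdot]_{\mathfrak h},\triangleright_{\mathfrak h},\phi_{\mathfrak h})$ is a twisted post-Lie algebra homomorphism.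
   Context: Base field $\mathbb R$. A (left) twisted post-group $(G,\cdot,\rhd,\Phi)$ is a group $(G,\cdot)$ with identity $1$ and maps $\rhd:G\times G\to G$, $\Phi:G\to G$ such that, setting $a\circ b=\Phi(a)\cdot(a\rhd b)$, for all $a,b,c\in G$: $L_a^{\rhd}:b\mapsto a\rhd b$ is an automorphism of $(G,\cdot)$; $(a\circ b)\rhd c=a\rhd(b\rhd c)$; $\Phi(a\circ b)=a\circ\Phi(b)$. A homomorphism of twisted post-groups is a map $F$ preserving $\cdot$ and $\rhd$ with $F\Phi_G=\Phi_H F$. For a map $F$ on a Lie group, $F_{*1}(x)=\frac{\mathrm d}{\mathrm dt}|_{t=0}F(\exp(tx))$ is the tangent map at $1$. A twisted post-Lie group is a twisted post-group $(G,\cdot,\rhd,\Phi)$ such that: (1) $(G,\cdot)$ is a Lie group and $\rhd,\Phi$ are smooth; (2) $\Phi^2=\Phi$ (this forces $\Phi(1)=1$); (3) with $\phi=\Phi_{*1}$ and $H_\Phi:\mathfrak g\times\mathfrak g\to\mathfrak g$ the symmetric bilinear Hessian at $0$ of $\Phi$ read in exponential coordinates, i.e. $\log\Phi(\exp X)=\phi(X)+\frac12H_\Phi(X,X)+\cdots$ near $X=0$, one has $H_\Phi(\phi(x),y)=H_\Phi(x,\phi(y))$ for all $x,y\in\mathfrak g$. A twisted post-Lie group homomorphism is a smooth map that is a twisted post-group homomorphism. In the second part, $\mathfrak g,\mathfrak h$ are the Lie algebras of $G,H$, with $\triangleright$ and $\phi$ constructed from each group as in the claim. A twisted post-Lie algebra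 $(\mathfrak g,[\cdot,\cdot],\triangleright,\phi)$ is a Lie algebra with linear maps $\triangleright:\mathfrak g\otimes\mathfrak g\to\mathfrak g$, $\phi:\mathfrak g\to\mathfrak g$ such that for all $x,y,z$: $x\triangleright[y,z]=[x\triangleright y,z]+[y,x\triangleright z]$; $([\phi(x),\phi(y)]+x\triangleright\phi(y)-y\triangleright\phi(x))\triangleright z=x\triangleright(y\triangleright z)-y\triangleright(x\triangleright z)$; $\phi(\frac12[\phi(x),y]+\frac12[x,\phi(y)]+x\triangleright y-y\triangleright x)=[\phi(x),\phi(y)]+x\triangleright\phi(y)-y\triangleright\phi(x)$; $\phi(x)\triangleright y=x\triangleright y$; $\phi^2(x)=\phi(x)$. A homomorphism of twisted post-Lie algebras is a linear map $f$ preserving $[\cdot,\cdot]$ and $\triangleright$ with $f\phi_{\mathfrak g}=\phi_{\mathfrak h}f$. *)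

theory Defs
  imports "HOL-Analysis.Analysis" "HOL-Algebra.Group"
begin

section \<open>Smooth manifolds\<close>

text \<open>Differentiability classes on an open set \<open>S\<close> of a finite-dimensional normed space, by
  recursion on directional derivatives (in finite dimension this is the usual notion of a
  \<open>C\<^sup>k\<close> map).\<close>

fun Ck_on :: "nat \<Rightarrow> 'a::real_normed_vector set \<Rightarrow> ('a \<Rightarrow> 'b::real_normed_vector) \<Rightarrow> bool" where
  "Ck_on 0 S f \<longleftrightarrow> continuous_on S f"
| "Ck_on (Suc k) S f \<longleftrightarrow>
     (\<forall>x\<in>S. f differentiable (at x)) \<and> (\<forall>v. Ck_on k S (\<lambda>x. frechet_derivative f (at x) v))"

definition smooth_on :: "'a::real_normed_vector set \<Rightarrow> ('a \<Rightarrow> 'b::real_normed_vector) \<Rightarrow> bool" where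
  "smooth_on S f \<longleftrightarrow> (\<forall>k. Ck_on k S f)"

text \<open>A chart is a pair of its domain and its coordinate map into the model space \<open>'e\<close>.\<close>

type_synonym ('a, 'e) chart = "'a set \<times> ('a \<Rightarrow> 'e)"

record ('a, 'e) manifold =
  mtop :: "'a topology"
  atlas :: "('a, 'e) chart set"

abbreviation chart_inv :: "('a, 'e) chart \<Rightarrow> 'e \<Rightarrow> 'a" where
  "chart_inv c \<equiv> inv_into (fst c) (snd c)"

definition charts_at :: "('a, 'e) manifold \<Rightarrow> 'a \<Rightarrow> ('a, 'e) chart set" where
  "charts_at M p = {c \<in> atlas M. p \<in> fst c}"

text \<open>The model space is an arbitrary finite-dimensional real normed space. The sort
  \<open>heine_borel\<close> is no restriction (every finite-dimensional normed space is proper); unlike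
  \<open>euclidean_space\<close>, which excludes the zero space, it does not rule out manifolds of
  dimension 0. The atlas need not be maximal.\<close>

locale smooth_manifold =
  fixes M :: "('a, 'e::{real_normed_vector, heine_borel}) manifold"
  assumes finite_dimensional: "\<exists>B::'e set. finite B \<and> span B = UNIV"
    and Hausdorff: "Hausdorff_space (mtop M)"
    and second_countable: "second_countable (mtop M)"
    and atlas_covers: "topspace (mtop M) = (\<Union>c\<in>atlas M. fst c)"
    and atlas_charts: "\<And>c. c \<in> atlas M \<Longrightarrow>
      openin (mtop M) (fst c) \<and> open (snd c ` fst c) \<and>
      homeomorphic_map (subtopology (mtop M) (fst c)) (top_of_set (snd c ` fst c)) (snd c)"
    and atlas_compatible: "\<And>c d. c \<in> atlas M \<Longrightarrow> d \<in> atlas M \<Longrightarrow>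
      smooth_on (snd c ` (fst c \<inter> fst d)) (snd d \<circ> chart_inv c)"

definition prod_manifold ::
  "('a, 'e) manifold \<Rightarrow> ('b, 'f) manifold \<Rightarrow> ('a \<times> 'b, 'e \<times> 'f) manifold" where
  "prod_manifold M N =
     \<lparr>mtop = prod_topology (mtop M) (mtop N),
      atlas = {(fst c \<times> fst d, map_prod (snd c) (snd d)) | c d. c \<in> atlas M \<and> d \<in> atlas N}\<rparr>"

definition real_manifold :: "(real, real) manifold" where
  "real_manifold = \<lparr>mtop = euclideanreal, atlas = {(UNIV, id)}\<rparr>"

definition smooth_map ::
  "('a, 'e::real_normed_vector) manifold \<Rightarrow> ('b, 'f::real_normed_vector) manifold
     \<Rightarrow> ('a \<Rightarrow> 'b) \<Rightarrow> bool" where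
  "smooth_map M N f \<longleftrightarrow>
     continuous_map (mtop M) (mtop N) f \<and>
     (\<forall>c\<in>atlas M. \<forall>d\<in>atlas N.
        smooth_on (snd c ` (fst c \<inter> f -` fst d)) (snd d \<circ> f \<circ> chart_inv c))"


section \<open>Lie groups and their Lie algebras\<close>

locale lie_group = group G + smooth_manifold M
  for G :: "('a, 'm) monoid_scheme" (structure)
    and M :: "('a, 'e::{real_normed_vector, heine_borel}) manifold" +
  assumes carrier_eq: "carrier G = topspace (mtop M)"
    and smooth_mult: "smooth_map (prod_manifold M M) M (\<lambda>(a, b). a \<otimes> b)"
    and smooth_inv: "smooth_map M M (\<lambda>a. inv a)"

text \<open>The tangent space at the identity, which underlies the Lie algebra, is identified with the
  model space \<open>'e\<close> through a chart \<open>c\<close> around the identity: the vector \<open>x\<close> stands for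
  the velocity of any curve whose expression in \<open>c\<close> has derivative \<open>x\<close>. All notions below are
  therefore taken relative to such a chart; another chart gives the same objects transported along
  the derivative of the change of coordinates.

  The bracket is the commutator of left-invariant vector fields, computed in the chart: the field
  extending \<open>x\<close> takes at the point \<open>g\<close> with coordinates \<open>u\<close> the value of the tangent map at the
  identity of left translation by \<open>g\<close> on \<open>x\<close>, and vector fields \<open>V\<close>, \<open>W\<close> on an open subset of
  \<open>'e\<close> have the commutator \<open>VW - WV = DW(V) - DV(W)\<close> (as derivations).\<close>

definition left_inv_field ::
  "('a, 'm) monoid_scheme \<Rightarrow> ('a, 'e::real_normed_vector) chart \<Rightarrow> 'e \<Rightarrow> 'e \<Rightarrow> 'e" where
  "left_inv_field G c x u =
     frechet_derivative (\<lambda>v. snd c (chart_inv c u \<otimes>\<^bsub>G\<^esub> chart_inv c v)) (at (snd c \<one>\<^bsub>G\<^esub>)) x"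

definition field_commutator ::
  "('e::real_normed_vector \<Rightarrow> 'e) \<Rightarrow> ('e \<Rightarrow> 'e) \<Rightarrow> 'e \<Rightarrow> 'e" where
  "field_commutator V W u =
     frechet_derivative W (at u) (V u) - frechet_derivative V (at u) (W u)"

definition lie_bracket ::
  "('a, 'm) monoid_scheme \<Rightarrow> ('a, 'e::real_normed_vector) chart \<Rightarrow> 'e \<Rightarrow> 'e \<Rightarrow> 'e" where
  "lie_bracket G c x y =
     field_commutator (left_inv_field G c x) (left_inv_field G c y) (snd c \<one>\<^bsub>G\<^esub>)"

definition one_parameter_subgroup ::
  "('a, 'm) monoid_scheme \<Rightarrow> ('a, 'e::real_normed_vector) manifold \<Rightarrow> ('a, 'e) chart
     \<Rightarrow> 'e \<Rightarrow> (real \<Rightarrow> 'a) \<Rightarrow> bool" where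
  "one_parameter_subgroup G M c x \<gamma> \<longleftrightarrow>
     smooth_map real_manifold M \<gamma> \<and>
     (\<forall>t. \<gamma> t \<in> carrier G) \<and>
     (\<forall>s t. \<gamma> (s + t) = \<gamma> s \<otimes>\<^bsub>G\<^esub> \<gamma> t) \<and>
     ((\<lambda>t. snd c (\<gamma> t)) has_vector_derivative x) (at 0)"

definition lie_exp ::
  "('a, 'm) monoid_scheme \<Rightarrow> ('a, 'e::real_normed_vector) manifold \<Rightarrow> ('a, 'e) chart
     \<Rightarrow> 'e \<Rightarrow> 'a" where
  "lie_exp G M c x = (THE \<gamma>. one_parameter_subgroup G M c x \<gamma>) 1"

text \<open>\<open>tangent_map G M c d F\<close> is the tangent map at the identity of a map \<open>F\<close> that sends the
  identity of \<open>G\<close> into the domain of \<open>d\<close>, in the charts \<open>c\<close> and \<open>d\<close>.\<close>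

definition tangent_map ::
  "('a, 'm) monoid_scheme \<Rightarrow> ('a, 'e::real_normed_vector) manifold \<Rightarrow> ('a, 'e) chart
     \<Rightarrow> ('b, 'f::real_normed_vector) chart \<Rightarrow> ('a \<Rightarrow> 'b) \<Rightarrow> 'e \<Rightarrow> 'f" where
  "tangent_map G M c d F x =
     vector_derivative (\<lambda>t. snd d (F (lie_exp G M c (t *\<^sub>R x)))) (at 0)"

text \<open>A neighbourhood of 0 on which the exponential map is a homeomorphism onto an open set. The
  logarithm near the identity is the inverse of the exponential map on such a neighbourhood.\<close>

definition exp_nbhd ::
  "('a, 'm) monoid_scheme \<Rightarrow> ('a, 'e::real_normed_vector) manifold \<Rightarrow> ('a, 'e) chart
     \<Rightarrow> 'e set \<Rightarrow> bool" where
  "exp_nbhd G M c N \<longleftrightarrow>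
     open N \<and> 0 \<in> N \<and> openin (mtop M) (lie_exp G M c ` N) \<and>
     homeomorphic_map (top_of_set N) (subtopology (mtop M) (lie_exp G M c ` N)) (lie_exp G M c)"

definition lie_log ::
  "('a, 'm) monoid_scheme \<Rightarrow> ('a, 'e::real_normed_vector) manifold \<Rightarrow> ('a, 'e) chart
     \<Rightarrow> 'e set \<Rightarrow> 'a \<Rightarrow> 'e" where
  "lie_log G M c N = inv_into N (lie_exp G M c)"

text \<open>\<open>H\<close> is the Hessian at 0 of \<open>\<Phi>\<close> read in exponential coordinates:
  \<open>log (\<Phi> (exp x)) = \<phi> x + 1/2 H x x + o(|x|^2)\<close> as \<open>x\<close> tends to 0. Such an \<open>H\<close> exists
  and is unique for smooth \<open>\<Phi>\<close> fixing the identity, and does not depend on \<open>N\<close>.\<close>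

definition is_exp_hessian ::
  "('a, 'm) monoid_scheme \<Rightarrow> ('a, 'e::real_normed_vector) manifold \<Rightarrow> ('a, 'e) chart
     \<Rightarrow> 'e set \<Rightarrow> ('a \<Rightarrow> 'a) \<Rightarrow> ('e \<Rightarrow> 'e \<Rightarrow> 'e) \<Rightarrow> bool" where
  "is_exp_hessian G M c N \<Phi> H \<longleftrightarrow>
     bilinear H \<and> (\<forall>x y. H x y = H y x) \<and>
     ((\<lambda>x. (lie_log G M c N (\<Phi> (lie_exp G M c x))
             - tangent_map G M c c \<Phi> x - (1/2) *\<^sub>R H x x) /\<^sub>R (norm x)\<^sup>2) \<longlongrightarrow> 0) (at 0)"


section \<open>Twisted post-groups and twisted post-Lie groups\<close>

definition twisted_circ ::
  "('a, 'm) monoid_scheme \<Rightarrow> ('a \<Rightarrow> 'a \<Rightarrow> 'a) \<Rightarrow> ('a \<Rightarrow> 'a) \<Rightarrow> 'a \<Rightarrow> 'a \<Rightarrow> 'a" where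
  "twisted_circ G rhd \<Phi> a b = \<Phi> a \<otimes>\<^bsub>G\<^esub> rhd a b"

locale twisted_post_group = group G
  for G :: "('a, 'm) monoid_scheme" (structure) +
  fixes rhd :: "'a \<Rightarrow> 'a \<Rightarrow> 'a" and \<Phi> :: "'a \<Rightarrow> 'a"
  assumes Phi_closed: "\<Phi> \<in> carrier G \<rightarrow> carrier G"
    and rhd_automorphism: "\<And>a. a \<in> carrier G \<Longrightarrow> rhd a \<in> iso G G"
    and circ_rhd: "\<And>a b c. a \<in> carrier G \<Longrightarrow> b \<in> carrier G \<Longrightarrow> c \<in> carrier G \<Longrightarrow>
      rhd (twisted_circ G rhd \<Phi> a b) c = rhd a (rhd b c)"
    and Phi_circ: "\<And>a b. a \<in> carrier G \<Longrightarrow> b \<in> carrier G \<Longrightarrow>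
      \<Phi> (twisted_circ G rhd \<Phi> a b) = twisted_circ G rhd \<Phi> a (\<Phi> b)"

definition twisted_post_group_hom ::
  "('a, 'm) monoid_scheme \<Rightarrow> ('a \<Rightarrow> 'a \<Rightarrow> 'a) \<Rightarrow> ('a \<Rightarrow> 'a) \<Rightarrow>
   ('b, 'n) monoid_scheme \<Rightarrow> ('b \<Rightarrow> 'b \<Rightarrow> 'b) \<Rightarrow> ('b \<Rightarrow> 'b) \<Rightarrow> ('a \<Rightarrow> 'b) \<Rightarrow> bool" where
  "twisted_post_group_hom G rhdG \<Phi>G H rhdH \<Phi>H F \<longleftrightarrow>
     F \<in> hom G H \<and>
     (\<forall>a\<in>carrier G. \<forall>b\<in>carrier G. F (rhdG a b) = rhdH (F a) (F b)) \<and>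
     (\<forall>a\<in>carrier G. F (\<Phi>G a) = \<Phi>H (F a))"

text \<open>In \<open>hessian_condition\<close> the existence of \<open>N\<close> and \<open>H\<close> is automatic (the exponential map is a
  local diffeomorphism at 0 and \<open>\<Phi>\<close> is smooth with \<open>\<Phi> \<one> = \<one>\<close>), and \<open>H\<close> is unique; the
  content of the condition is the last conjunct.\<close>

locale twisted_post_lie_group = twisted_post_group G rhd \<Phi> + lie_group G M
  for G :: "('a, 'm) monoid_scheme" (structure)
    and M :: "('a, 'e::{real_normed_vector, heine_borel}) manifold"
    and rhd :: "'a \<Rightarrow> 'a \<Rightarrow> 'a" and \<Phi> :: "'a \<Rightarrow> 'a" +
  assumes smooth_rhd: "smooth_map (prod_manifold M M) M (\<lambda>(a, b). rhd a b)"
    and smooth_Phi: "smooth_map M M \<Phi>"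
    and Phi_idem: "\<And>a. a \<in> carrier G \<Longrightarrow> \<Phi> (\<Phi> a) = \<Phi> a"
    and hessian_condition: "\<And>c. c \<in> charts_at M \<one> \<Longrightarrow>
      \<exists>N H. exp_nbhd G M c N \<and> is_exp_hessian G M c N \<Phi> H \<and>
        (\<forall>x y. H (tangent_map G M c c \<Phi> x) y = H x (tangent_map G M c c \<Phi> y))"

definition twisted_post_lie_group_hom ::
  "('a, 'm) monoid_scheme \<Rightarrow> ('a, 'e::real_normed_vector) manifold \<Rightarrow>
     ('a \<Rightarrow> 'a \<Rightarrow> 'a) \<Rightarrow> ('a \<Rightarrow> 'a) \<Rightarrow>
   ('b, 'n) monoid_scheme \<Rightarrow> ('b, 'f::real_normed_vector) manifold \<Rightarrow>
     ('b \<Rightarrow> 'b \<Rightarrow> 'b) \<Rightarrow> ('b \<Rightarrow> 'b) \<Rightarrow> ('a \<Rightarrow> 'b) \<Rightarrow> bool" where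
  "twisted_post_lie_group_hom G M rhdG \<Phi>G H N rhdH \<Phi>H F \<longleftrightarrow>
     smooth_map M N F \<and> twisted_post_group_hom G rhdG \<Phi>G H rhdH \<Phi>H F"

definition lie_rhd ::
  "('a, 'm) monoid_scheme \<Rightarrow> ('a, 'e::real_normed_vector) manifold \<Rightarrow> ('a, 'e) chart \<Rightarrow>
     ('a \<Rightarrow> 'a \<Rightarrow> 'a) \<Rightarrow> 'e \<Rightarrow> 'e \<Rightarrow> 'e" where
  "lie_rhd G M c rhd x y =
     vector_derivative (\<lambda>t. tangent_map G M c c (rhd (lie_exp G M c (t *\<^sub>R x))) y) (at 0)"


section \<open>Twisted post-Lie algebras\<close>

locale lie_algebra =
  fixes br :: "'v::real_vector \<Rightarrow> 'v \<Rightarrow> 'v"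
  assumes br_bilinear: "bilinear br"
    and br_alternating: "\<And>x. br x x = 0"
    and br_jacobi: "\<And>x y z. br x (br y z) + br y (br z x) + br z (br x y) = 0"

locale twisted_post_lie_algebra = lie_algebra br
  for br :: "'v::real_vector \<Rightarrow> 'v \<Rightarrow> 'v" +
  fixes tr :: "'v \<Rightarrow> 'v \<Rightarrow> 'v" and \<phi> :: "'v \<Rightarrow> 'v"
  assumes tr_bilinear: "bilinear tr"
    and phi_linear: "linear \<phi>"
    and tr_derivation: "\<And>x y z. tr x (br y z) = br (tr x y) z + br y (tr x z)"
    and tr_commutator: "\<And>x y z.
      tr (br (\<phi> x) (\<phi> y) + tr x (\<phi> y) - tr y (\<phi> x)) z = tr x (tr y z) - tr y (tr x z)"
    and phi_bracket: "\<And>x y.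
      \<phi> ((1/2) *\<^sub>R br (\<phi> x) y + (1/2) *\<^sub>R br x (\<phi> y) + tr x y - tr y x)
        = br (\<phi> x) (\<phi> y) + tr x (\<phi> y) - tr y (\<phi> x)"
    and phi_tr: "\<And>x y. tr (\<phi> x) y = tr x y"
    and phi_idem: "\<And>x. \<phi> (\<phi> x) = \<phi> x"

locale twisted_post_lie_algebra_hom =
  source: twisted_post_lie_algebra br1 tr1 \<phi>1 + target: twisted_post_lie_algebra br2 tr2 \<phi>2
  for br1 tr1 :: "'v::real_vector \<Rightarrow> 'v \<Rightarrow> 'v" and \<phi>1 :: "'v \<Rightarrow> 'v"
    and br2 tr2 :: "'w::real_vector \<Rightarrow> 'w \<Rightarrow> 'w" and \<phi>2 :: "'w \<Rightarrow> 'w" +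
  fixes f :: "'v \<Rightarrow> 'w"
  assumes hom_linear: "linear f"
    and hom_br: "\<And>x y. f (br1 x y) = br2 (f x) (f y)"
    and hom_tr: "\<And>x y. f (tr1 x y) = tr2 (f x) (f y)"
    and hom_phi: "\<And>x. f (\<phi>1 x) = \<phi>2 (f x)"

end

theory Submission
  imports Defs
begin

text \<open>The axioms of a twisted post-Lie algebra come from the parts of order at most two of identities of the
group, read in the given chart translated so that the identity sits at the origin. There

  \<^item> the multiplication is \<open>u + v + B u v + o(2)\<close>, and \<open>[x, y] = B x y - B y x\<close> (\<open>lie_bracket_eq\<close>);
  \<^item> the action is \<open>v + T u v + o(2)\<close>, and \<open>T\<close> is the operation of the theorem (\<open>lie_rhd_eq\<close>);
  \<^item> the twist is \<open>\<phi> u + Q u u + o(2)\<close>, with \<open>\<phi>\<close> its tangent map;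
  \<^item> hence \<open>a \<circ> b = \<phi> a + b + Q a a + T a b + B (\<phi> a) b + o(2)\<close> (\<open>jet_circ\<close>);
  \<^item> the exponential map is \<open>x + (1/2) B x x + o(2)\<close> (\<open>exp_jet\<close>).

Such expansions (\<open>jet2\<close>) compose and are unique, so two expressions that agree near the origin
have the same linear part and the same quadratic form. Comparing the terms that are bilinear in
\<open>(a, b)\<close>, the identity \<open>\<Phi> (a \<circ> b) = a \<circ> \<Phi> b\<close> gives

  \<open>\<phi> (T a b + B (\<phi> a) b) + 2 Q (\<phi> a) b = T a (\<phi> b) + B (\<phi> a) (\<phi> b)\<close>  (\<open>phi_circ_relation\<close>).

After antisymmetrising in \<open>a\<close> and \<open>b\<close> this is the bracket formula for \<open>\<phi>\<close> up to the terms
\<open>2 Q (\<phi> a) b - 2 Q (\<phi> b) a\<close> and values of \<open>\<phi>\<close> on the symmetric part of \<open>B\<close>. That these cancel is the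
condition on the Hessian: exponential and chart coordinates differ to second order by the symmetric
part of \<open>B\<close>, which relates the Hessian to \<open>Q\<close> (\<open>hessian_chart\<close>, \<open>Q_\<phi>_swap\<close>).

Similarly \<open>L (a \<circ> b) = L a L b\<close> for the tangent maps \<open>L a\<close> of the
automorphisms, compared to second order, gives the commutator formula (\<open>action_relation\<close>), and to
first order \<open>T (\<phi> a) = T a\<close>. A smooth homomorphism preserves the bracket for the same reason
(\<open>jet_hom_commutator\<close>). Applied to a smooth family of automorphisms and differentiated in the parameter,
this yields the derivation property; for the family of conjugations it is the Jacobi identity.

The exponential map is a definite description, so one-parameter subgroups must exist and be unique.
Uniqueness is a computation with the quotient of two of them. Existence comes without solving a
differential equation: the description would take one and the same value at all non-zero
multiples of a vector without a one-parameter subgroup, whereas the condition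
on the Hessian includes that the exponential map is injective near 0 (\<open>ops_exists\<close>).\<close>

section \<open>Coordinates on a finite-dimensional normed space\<close>

text \<open>Equivalence of norms in finite dimension, by induction on the independent set: the span of \<open>B\<close> is
closed, because the coordinates of a convergent sequence in it are Cauchy by the induction
hypothesis, and so a further vector has positive distance from it.\<close>

lemma coordinates_bounded_independent:
  fixes B :: "'e::real_normed_vector set"
  assumes "finite B" "independent B"
  shows "\<exists>K. \<forall>a. \<forall>b\<in>B. \<bar>a b\<bar> \<le> K * norm (\<Sum>b\<in>B. a b *\<^sub>R b)"
  using assms
proof (induction B rule: finite_induct)
  case empty
  then show ?case by simp
next
  case (insert v B)
  have ind: "independent B" "v \<notin> span B"
    using insert.prems insert.hyps by (auto simp: independent_insert)
  obtain K where K: "\<And>a b. b \<in> B \<Longrightarrow> \<bar>a b\<bar> \<le> K * norm (\<Sum>b\<in>B. a b *\<^sub>R b)"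
    using insert.IH[OF ind(1)] by blast
  have dist: "\<exists>d>0. \<forall>s\<in>span B. d \<le> norm (v - s)"
  proof (rule ccontr)
    assume "\<not> ?thesis"
    then have "\<exists>s\<in>span B. norm (v - s) < 1 / real (Suc n)" for n
      by (meson divide_pos_pos not_le of_nat_0_less_iff zero_less_Suc zero_less_one)
    then have "\<forall>n. \<exists>s. s \<in> span B \<and> norm (v - s) < 1 / real (Suc n)" by blast
    from choice[OF this] obtain s where "\<forall>n. s n \<in> span B \<and> norm (v - s n) < 1 / real (Suc n)" ..
    then have s: "\<And>n. s n \<in> span B" "\<And>n. norm (v - s n) < 1 / real (Suc n)" by auto
    have "(\<lambda>n. v - s n) \<longlonglongrightarrow> 0"
    proof (rule Lim_null_comparison)
      show "\<forall>\<^sub>F n in sequentially. norm (v - s n) \<le> 1 / real (Suc n)"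
        using s(2) by (simp add: less_imp_le)
      show "(\<lambda>n. 1 / real (Suc n)) \<longlonglongrightarrow> 0"
        using LIMSEQ_Suc[OF lim_1_over_n[where 'a=real]] by simp
    qed
    then have lim: "s \<longlonglongrightarrow> v"
      using tendsto_diff[OF tendsto_const[of v], of "\<lambda>n. v - s n" 0] by simp
    have "\<exists>a. s n = (\<Sum>b\<in>B. a b *\<^sub>R b)" for n
      using s(1)[of n] unfolding span_finite[OF insert.hyps(1)] by auto
    then obtain a where a: "\<And>n. s n = (\<Sum>b\<in>B. a n b *\<^sub>R b)"
      using choice[of "\<lambda>n a. s n = (\<Sum>b\<in>B. a b *\<^sub>R b)"] by blast
    have "\<exists>l. (\<lambda>n. a n b) \<longlonglongrightarrow> l" if b: "b \<in> B" for b
    proof -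
      have le: "\<bar>a m b - a n b\<bar> \<le> \<bar>K\<bar> * norm (s m - s n)" for m n
      proof -
        have "\<bar>a m b - a n b\<bar> \<le> K * norm (\<Sum>b\<in>B. (a m b - a n b) *\<^sub>R b)"
          using K[OF b, of "\<lambda>b. a m b - a n b"] by simp
        also have "(\<Sum>b\<in>B. (a m b - a n b) *\<^sub>R b) = s m - s n"
          by (simp add: a scaleR_diff_left sum_subtractf)
        also have "K * norm (s m - s n) \<le> \<bar>K\<bar> * norm (s m - s n)"
          by (intro mult_right_mono) auto
        finally show ?thesis .
      qed
      have "Cauchy s" using lim LIMSEQ_imp_Cauchy by blast
      have "Cauchy (\<lambda>n. a n b)"
      proof (rule metric_CauchyI)
        fix e :: real assume "e > 0"
        then have "e / (\<bar>K\<bar> + 1) > 0" by simp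
        then obtain M where M: "\<And>m n. m \<ge> M \<Longrightarrow> n \<ge> M \<Longrightarrow> dist (s m) (s n) < e / (\<bar>K\<bar> + 1)"
          using \<open>Cauchy s\<close> unfolding Cauchy_def by blast
        have "dist (a m b) (a n b) < e" if "m \<ge> M" "n \<ge> M" for m n
        proof -
          have "\<bar>a m b - a n b\<bar> \<le> (\<bar>K\<bar> + 1) * norm (s m - s n)"
            using le[of m n] by (simp add: distrib_right add_increasing2)
          also have "\<dots> < e"
            using M[OF that] by (simp add: dist_norm field_simps)
          finally show ?thesis by (simp add: dist_norm)
        qed
        then show "\<exists>M. \<forall>m\<ge>M. \<forall>n\<ge>M. dist (a m b) (a n b) < e" by blast
      qed
      then show ?thesis using Cauchy_convergent convergent_def by blast
    qed
    then obtain l where l: "\<And>b. b \<in> B \<Longrightarrow> (\<lambda>n. a n b) \<longlonglongrightarrow> l b" by metis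
    have "s \<longlonglongrightarrow> (\<Sum>b\<in>B. l b *\<^sub>R b)"
      unfolding a using l by (auto intro!: tendsto_sum tendsto_scaleR)
    then have "v = (\<Sum>b\<in>B. l b *\<^sub>R b)" using lim LIMSEQ_unique by blast
    then show False using ind(2) by (metis (no_types, lifting) span_base span_scale span_sum)
  qed
  then obtain d where d: "d > 0" "\<And>s. s \<in> span B \<Longrightarrow> d \<le> norm (v - s)" by blast
  have v: "d * \<bar>r\<bar> \<le> norm (r *\<^sub>R v + s)" if "s \<in> span B" for r s
  proof (cases "r = 0")
    case False
    have "d \<le> norm (v - (- (1/r)) *\<^sub>R s)"
      by (intro d(2) span_scale that)
    also have "v - (- (1/r)) *\<^sub>R s = (1/r) *\<^sub>R (r *\<^sub>R v + s)"
      using False by (simp add: scaleR_add_right)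
    finally have "d \<le> norm (r *\<^sub>R v + s) / \<bar>r\<bar>" by simp
    then show ?thesis using False by (simp add: pos_le_divide_eq)
  qed simp
  \<comment> \<open>\<open>1 / d\<close> bounds the coordinate along \<open>v\<close>; the component in \<open>span B\<close> is then bounded by the triangle inequality\<close>
  define K' where "K' = 1/d + \<bar>K\<bar> * (1 + norm v / d)"
  show ?case
  proof (intro exI allI ballI)
    fix a :: "'e \<Rightarrow> real" and b assume b: "b \<in> insert v B"
    define s where "s = (\<Sum>b\<in>B. a b *\<^sub>R b)"
    define x where "x = (\<Sum>b\<in>insert v B. a b *\<^sub>R b)"
    have x: "x = a v *\<^sub>R v + s" using insert.hyps by (simp add: x_def s_def)
    have "s \<in> span B" unfolding s_def by (intro span_sum span_scale span_base)
    then have av: "\<bar>a v\<bar> \<le> norm x / d" using v[of s "a v"] d(1) x by (simp add: pos_le_divide_eq mult.commute)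
    have "norm s \<le> norm x + \<bar>a v\<bar> * norm v"
      using norm_triangle_ineq4[of x "a v *\<^sub>R v"] x by simp
    also have "\<dots> \<le> norm x + norm x / d * norm v"
      using av by (intro add_mono mult_right_mono) auto
    finally have s: "norm s \<le> (1 + norm v / d) * norm x" by (simp add: field_simps)
    show "\<bar>a b\<bar> \<le> K' * norm x"
    proof (cases "b = v")
      case True
      have "norm x / d \<le> K' * norm x" using d(1) by (simp add: K'_def distrib_right)
      then show ?thesis unfolding True by (rule order_trans[OF av])
    next
      case False
      then have "\<bar>a b\<bar> \<le> K * norm s" using K[of b a] b by (simp add: s_def)
      also have "\<dots> \<le> \<bar>K\<bar> * norm s" by (intro mult_right_mono) auto
      also have "\<dots> \<le> \<bar>K\<bar> * ((1 + norm v / d) * norm x)"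
        using s by (intro mult_left_mono) auto
      also have "\<dots> \<le> K' * norm x"
        using d(1) by (simp add: K'_def distrib_right mult.assoc)
      finally show ?thesis .
    qed
  qed
qed

text \<open>A predicate rather than a type class: it passes to products (\<open>finite_dim_prod\<close>), and unlike
\<open>euclidean_space\<close> it admits the zero space.\<close>

definition finite_dim :: "'e::real_normed_vector itself \<Rightarrow> bool" where
  "finite_dim _ \<longleftrightarrow> (\<exists>B::'e set. finite B \<and> span B = UNIV)"

lemma finite_dim_coordinates:
  assumes "finite_dim TYPE('e::real_normed_vector)"
  obtains B :: "'e::real_normed_vector set"
    and c :: "'e::real_normed_vector \<Rightarrow> 'e::real_normed_vector \<Rightarrow> real"
  where "finite B" "\<And>b. b \<in> B \<Longrightarrow> bounded_linear (c b)" "\<And>x. x = (\<Sum>b\<in>B. c b x *\<^sub>R b)"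
proof -
  obtain A :: "'e set" where A: "finite A" "span A = UNIV"
    using assms finite_dim_def by blast
  obtain B where B: "B \<subseteq> A" "independent B" "A \<subseteq> span B"
    using maximal_independent_subset by metis
  have fin: "finite B" using A B finite_subset by blast
  have sp: "span B = UNIV" using A B by (metis span_minimal subspace_span top.extremum_uniqueI)
  define c where "c = (\<lambda>b x. representation B x b)"
  have sum: "(\<Sum>b\<in>B. c b x *\<^sub>R b) = x" for x
    unfolding c_def by (rule sum_representation_eq) (use B sp fin in auto)
  obtain K where K: "\<And>a b. b \<in> B \<Longrightarrow> \<bar>a b\<bar> \<le> K * norm (\<Sum>b\<in>B. a b *\<^sub>R b)"
    using coordinates_bounded_independent[OF fin B(2)] by blast
  have bl: "bounded_linear (c b)" if "b \<in> B" for b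
  proof (rule bounded_linear_intro)
    show "c b (x + y) = c b x + c b y" for x y
      unfolding c_def using B sp by (simp add: representation_add)
    show "c b (r *\<^sub>R x) = r *\<^sub>R c b x" for r x
      unfolding c_def using B sp by (simp add: representation_scale)
    show "norm (c b x) \<le> norm x * K" for x
      using K[OF that, of "\<lambda>b. c b x"] sum[of x] by (simp add: mult.commute)
  qed
  show ?thesis by (rule that[OF fin bl sum[symmetric]])
qed

lemma finite_dim_prod:
  assumes "finite_dim TYPE('e::real_normed_vector)" "finite_dim TYPE('f::real_normed_vector)"
  shows "finite_dim TYPE('e \<times> 'f)"
proof -
  obtain B :: "'e set" where B: "finite B" "span B = UNIV" using assms finite_dim_def by blast
  obtain C :: "'f set" where C: "finite C" "span C = UNIV" using assms finite_dim_def by blast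
  let ?S = "(\<lambda>b. (b, 0)) ` B \<union> (\<lambda>c. (0, c)) ` C"
  have l: "linear (\<lambda>b::'e. (b, 0::'f))" "linear (\<lambda>c::'f. (0::'e, c))"
    by (auto intro!: linearI)
  have "(x, y) \<in> span ?S" for x y
  proof -
    have "(x, 0) \<in> span ((\<lambda>b. (b, 0::'f)) ` B)" "(0, y) \<in> span ((\<lambda>c. (0::'e, c)) ` C)"
      using B C by (auto simp: linear_span_image[OF l(1)] linear_span_image[OF l(2)])
    then have "(x, 0) + (0, y) \<in> span ?S"
      by (metis (no_types, lifting) Un_upper1 Un_upper2 span_add span_mono subsetD)
    then show ?thesis by simp
  qed
  then have "p \<in> span ?S" for p by (cases p) simp
  then have "finite ?S \<and> span ?S = UNIV" using B(1) C(1) by blast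
  then show ?thesis unfolding finite_dim_def by (rule exI)
qed

lemma eventually_nhds_shift:
  fixes p :: "'e::real_normed_vector"
  shows "eventually P (nhds p) \<longleftrightarrow> (\<forall>\<^sub>F h in nhds 0. P (p + h))"
proof -
  have "nhds p = filtermap (\<lambda>h. h - (- p)) (nhds 0)" by (subst filtermap_nhds_shift) simp
  then show ?thesis by (simp add: eventually_filtermap add.commute)
qed

section \<open>Second-order increments\<close>

definition smooth_near :: "'e::real_normed_vector \<Rightarrow> ('e \<Rightarrow> 'f::real_normed_vector) \<Rightarrow> bool" where
  "smooth_near p f \<longleftrightarrow> (\<exists>S. open S \<and> p \<in> S \<and> smooth_on S f)"

abbreviation fd :: "('e::real_normed_vector \<Rightarrow> 'f::real_normed_vector) \<Rightarrow> 'e \<Rightarrow> 'e \<Rightarrow> 'f" where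
  "fd f p \<equiv> frechet_derivative f (at p)"

definition second_deriv :: "('e::real_normed_vector \<Rightarrow> 'f::real_normed_vector) \<Rightarrow> 'e \<Rightarrow> 'e \<Rightarrow> 'e \<Rightarrow> 'f" where
  "second_deriv f p h k = fd (\<lambda>u. fd f u k) p h"

lemma smooth_on_differentiable: "smooth_on S f \<Longrightarrow> x \<in> S \<Longrightarrow> f differentiable (at x)"
  unfolding smooth_on_def using Ck_on.simps(2) by blast

lemma smooth_on_deriv: "smooth_on S f \<Longrightarrow> smooth_on S (\<lambda>x. fd f x v)"
  unfolding smooth_on_def using Ck_on.simps(2) by blast

lemma smooth_near_differentiable: "smooth_near p f \<Longrightarrow> f differentiable (at p)"
  unfolding smooth_near_def using smooth_on_differentiable by blast

lemma smooth_near_deriv: "smooth_near p f \<Longrightarrow> smooth_near p (\<lambda>x. fd f x v)"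
  unfolding smooth_near_def using smooth_on_deriv by blast

lemma smooth_near_eventually: "smooth_near p f \<Longrightarrow> \<forall>\<^sub>F x in nhds p. smooth_near x f"
  unfolding smooth_near_def eventually_nhds by blast

lemma has_derivative_shift_iff:
  "((\<lambda>h. f (p + h) - a) has_derivative D) (at x) \<longleftrightarrow> (f has_derivative D) (at (p + x))"
proof
  assume *: "((\<lambda>h. f (p + h) - a) has_derivative D) (at x)"
  have "((\<lambda>y. y - p) has_derivative (\<lambda>h. h)) (at (p + x))"
    by (auto intro!: derivative_eq_intros)
  from has_derivative_compose[OF this, of "\<lambda>h. f (p + h) - a" D] *
  have "((\<lambda>y. f y - a) has_derivative D) (at (p + x))" by simp
  from has_derivative_add[OF this has_derivative_const[of a]]
  show "(f has_derivative D) (at (p + x))" by simp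
next
  assume *: "(f has_derivative D) (at (p + x))"
  have "((\<lambda>h. p + h) has_derivative (\<lambda>h. h)) (at x)"
    by (auto intro!: derivative_eq_intros)
  from has_derivative_diff[OF has_derivative_compose[OF this *] has_derivative_const[of a]]
  show "((\<lambda>h. f (p + h) - a) has_derivative D) (at x)" by simp
qed

lemma frechet_derivative_shift: "fd (\<lambda>h. f (p + h) - a) x = fd f (p + x)"
  unfolding frechet_derivative_def has_derivative_shift_iff ..

lemma Ck_on_shift:
  assumes "Ck_on k S f"
  shows "Ck_on k ((\<lambda>x. x - p) ` S) (\<lambda>h. f (p + h) - a)"
  using assms
proof (induction k arbitrary: f a)
  case 0
  then have "continuous_on S f" by simp
  then have "continuous_on ((\<lambda>x. x - p) ` S) (\<lambda>h. f (p + h))"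
    by (rule continuous_on_compose2[where t=S]) (auto intro: continuous_on_add)
  then show ?case by (simp add: continuous_on_diff)
next
  case (Suc k)
  have "(\<lambda>h. f (p + h) - a) differentiable (at (x - p))" if "x \<in> S" for x
  proof -
    have "f differentiable (at x)" using Suc.prems that by auto
    then show ?thesis
      using has_derivative_shift_iff[of f p a _ "x - p"] unfolding differentiable_def by simp
  qed
  moreover have "Ck_on k ((\<lambda>x. x - p) ` S) (\<lambda>x. fd (\<lambda>h. f (p + h) - a) x v)" for v
    using Suc.IH[of "\<lambda>x. fd f x v" 0] Suc.prems by (simp add: frechet_derivative_shift)
  ultimately show ?case by auto
qed

lemma smooth_near_shift:
  assumes "smooth_near p f"
  shows "smooth_near 0 (\<lambda>h. f (p + h) - a)"
proof -
  obtain S where S: "open S" "p \<in> S" "smooth_on S f" using assms smooth_near_def by blast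
  have "open ((\<lambda>x. x - p) ` S)" using S(1) open_translation_subtract by blast
  moreover have "0 \<in> (\<lambda>x. x - p) ` S" using S(2) by force
  moreover have "smooth_on ((\<lambda>x. x - p) ` S) (\<lambda>h. f (p + h) - a)"
    using S(3) Ck_on_shift[of _ S f p a] unfolding smooth_on_def by simp
  ultimately show ?thesis unfolding smooth_near_def by auto
qed

text \<open>\<open>o(|h|\<^sup>2)\<close> at the origin. The origin belongs to \<open>nhds 0\<close>, so \<open>r 0 = 0\<close> is included; this keeps the
notion stable under composition with maps that take the value 0 elsewhere.\<close>

definition quad_small :: "('e::real_normed_vector \<Rightarrow> 'f::real_normed_vector) \<Rightarrow> bool" where
  "quad_small r \<longleftrightarrow> (\<forall>e>0. \<forall>\<^sub>F h in nhds 0. norm (r h) \<le> e * (norm h)\<^sup>2)"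

lemma bounded_bilinear_add:
  assumes "bounded_bilinear f" "bounded_bilinear g"
  shows "bounded_bilinear (\<lambda>h k. f h k + g h k)"
proof -
  interpret f: bounded_bilinear f by fact
  interpret g: bounded_bilinear g by fact
  obtain K L where KL: "\<And>a b. norm (f a b) \<le> norm a * norm b * K"
    "\<And>a b. norm (g a b) \<le> norm a * norm b * L"
    using f.bounded g.bounded by blast
  show ?thesis
  proof
    show "\<exists>K. \<forall>a b. norm (f a b + g a b) \<le> norm a * norm b * K"
    proof (intro exI allI)
      fix a b
      show "norm (f a b + g a b) \<le> norm a * norm b * (K + L)"
        using norm_triangle_mono[OF KL] by (simp add: distrib_left)
    qed
  qed (simp_all add: f.add_left f.add_right g.add_left g.add_right f.scaleR_left g.scaleR_left
      f.scaleR_right g.scaleR_right scaleR_add_right)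
qed

lemma bounded_bilinear_zero: "bounded_bilinear (\<lambda>h k. 0)"
  by unfold_locales (auto intro: exI[of _ 0])

lemma bounded_bilinear_sum:
  assumes "\<And>i. i \<in> I \<Longrightarrow> bounded_bilinear (f i)"
  shows "bounded_bilinear (\<lambda>h k. \<Sum>i\<in>I. f i h k)"
  using assms
proof (induction I rule: infinite_finite_induct)
  case (insert i I)
  have "bounded_bilinear (f i)" "bounded_bilinear (\<lambda>h k. \<Sum>i\<in>I. f i h k)"
    using insert by blast+
  from bounded_bilinear_add[OF this] show ?case using insert.hyps by simp
qed (simp_all add: bounded_bilinear_zero)

text \<open>Smoothness is given one direction \<open>k\<close> at a time. Expanding \<open>k\<close> in a basis leaves finitely many
directions, and makes the differentiability of \<open>x \<mapsto> f' x k\<close> at \<open>p\<close> uniform in \<open>k\<close>. The expansions of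
second order rest on this uniformity.\<close>

lemma second_deriv_properties:
  fixes f :: "'e::real_normed_vector \<Rightarrow> 'f::real_normed_vector"
  assumes fin: "finite_dim TYPE('e)" and f: "smooth_near p f"
  shows bounded_bilinear_second_deriv: "bounded_bilinear (second_deriv f p)"
    and fd_increment: "e > 0 \<Longrightarrow> \<forall>\<^sub>F h in nhds 0. \<forall>k.
      norm (fd f (p + h) k - fd f p k - second_deriv f p h k) \<le> e * norm h * norm k"
proof -
  obtain B :: "'e set" and c where B: "finite B" "\<And>b. b \<in> B \<Longrightarrow> bounded_linear (c b)"
      and sum: "\<And>x. x = (\<Sum>b\<in>B. c b x *\<^sub>R b)"
    by (rule finite_dim_coordinates[OF fin]) blast
  obtain S where S: "open S" "p \<in> S" "smooth_on S f" using f smooth_near_def by blast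
  have d1: "(f has_derivative fd f x) (at x)" if "x \<in> S" for x
    using smooth_on_differentiable[OF S(3) that] frechet_derivative_works by blast
  have lin: "linear (fd f x)" if "x \<in> S" for x
    using d1[OF that] has_derivative_linear by blast
  have d2: "((\<lambda>u. fd f u k) has_derivative (\<lambda>h. second_deriv f p h k)) (at p)" for k
    using frechet_derivative_works[THEN iffD1, OF smooth_on_differentiable[OF smooth_on_deriv[OF S(3)] S(2)]]
    unfolding second_deriv_def .
  have exp1: "fd f x k = (\<Sum>b\<in>B. c b k *\<^sub>R fd f x b)" if "x \<in> S" for x k
  proof -
    have "fd f x k = fd f x (\<Sum>b\<in>B. c b k *\<^sub>R b)" by (rule arg_cong[OF sum])
    then show ?thesis by (simp add: linear_sum[OF lin[OF that]] linear_scale[OF lin[OF that]])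
  qed
  have exp2: "second_deriv f p h k = (\<Sum>b\<in>B. c b k *\<^sub>R second_deriv f p h b)" for h k
  proof -
    have "((\<lambda>u. \<Sum>b\<in>B. c b k *\<^sub>R fd f u b) has_derivative
        (\<lambda>h. \<Sum>b\<in>B. c b k *\<^sub>R second_deriv f p h b)) (at p)"
      by (intro has_derivative_sum has_derivative_scaleR_right d2)
    then have "((\<lambda>u. fd f u k) has_derivative
        (\<lambda>h. \<Sum>b\<in>B. c b k *\<^sub>R second_deriv f p h b)) (at p)"
      by (rule has_derivative_transform_within_open[OF _ S(1,2)]) (rule exp1[symmetric])
    from has_derivative_unique[OF d2[of k] this] show ?thesis by (rule fun_cong)
  qed
  have bl: "bounded_linear (\<lambda>h. second_deriv f p h k)" for k
    using d2 has_derivative_bounded_linear by blast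
  have "bounded_bilinear (\<lambda>h k. \<Sum>b\<in>B. c b k *\<^sub>R second_deriv f p h b)"
  proof -
    have "bounded_bilinear (\<lambda>h k. c b k *\<^sub>R second_deriv f p h b)" if "b \<in> B" for b
      using bounded_bilinear.comp[OF bounded_bilinear.flip[OF bounded_bilinear_scaleR] bl[of b] B(2)[OF that]] .
    then show ?thesis by (rule bounded_bilinear_sum)
  qed
  moreover have eq: "second_deriv f p = (\<lambda>h k. \<Sum>b\<in>B. c b k *\<^sub>R second_deriv f p h b)"
    by (intro ext exp2)
  ultimately show "bounded_bilinear (second_deriv f p)" by (rule ssubst[rotated])
  assume e: "e > 0"
  have "\<forall>b\<in>B. \<exists>K>0. \<forall>x. norm (c b x) \<le> norm x * K"
    using B(2) bounded_linear.pos_bounded by blast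
  then obtain K where K: "\<And>b. b \<in> B \<Longrightarrow> K b > 0" "\<And>b x. b \<in> B \<Longrightarrow> \<bar>c b x\<bar> \<le> norm x * K b"
    by (metis real_norm_def)
  define C where "C = (\<Sum>b\<in>B. K b) + 1"
  have C: "C > 0" unfolding C_def using K(1) by (smt (verit) sum_nonneg)
  have ev: "\<forall>\<^sub>F h in nhds 0. norm (fd f (p + h) b - fd f p b - second_deriv f p h b) \<le> e / C * norm h" for b
  proof -
    have "e / C > 0" using e C by simp
    then obtain d where d: "d > 0" "\<And>y. norm (y - p) < d \<Longrightarrow>
        norm (fd f y b - fd f p b - second_deriv f p (y - p) b) \<le> e / C * norm (y - p)"
      using d2[of b] unfolding has_derivative_at_alt by blast
    then have "\<forall>\<^sub>F y in nhds p. norm (fd f y b - fd f p b - second_deriv f p (y - p) b) \<le> e / C * norm (y - p)"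
      unfolding eventually_nhds_metric dist_norm by blast
    from this[unfolded eventually_nhds_shift[where p=p]] show ?thesis unfolding add_diff_cancel_left' .
  qed
  have evS: "\<forall>\<^sub>F h in nhds 0. p + h \<in> S"
    using eventually_nhds_in_open[OF S(1,2)] unfolding eventually_nhds_shift[where p=p] .
  have "\<forall>\<^sub>F h in nhds 0. \<forall>b\<in>B. norm (fd f (p + h) b - fd f p b - second_deriv f p h b) \<le> e / C * norm h"
    using ev B(1) by (simp add: eventually_ball_finite)
  then show "\<forall>\<^sub>F h in nhds 0. \<forall>k.
      norm (fd f (p + h) k - fd f p k - second_deriv f p h k) \<le> e * norm h * norm k"
    using evS
  proof eventually_elim
    case (elim h)
    show ?case
    proof
      fix k
      have "fd f (p + h) k - fd f p k - second_deriv f p h k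
          = (\<Sum>b\<in>B. c b k *\<^sub>R (fd f (p + h) b - fd f p b - second_deriv f p h b))"
        unfolding exp1[OF elim(2), of k] exp1[OF S(2), of k] exp2[of h k]
        by (simp add: scaleR_diff_right sum_subtractf)
      also have "norm \<dots> \<le> (\<Sum>b\<in>B. (norm k * K b) * (e / C * norm h))"
      proof (rule sum_norm_le)
        fix b assume b: "b \<in> B"
        have "norm (c b k *\<^sub>R (fd f (p + h) b - fd f p b - second_deriv f p h b))
            = \<bar>c b k\<bar> * norm (fd f (p + h) b - fd f p b - second_deriv f p h b)"
          by (rule norm_scaleR)
        also have "\<dots> \<le> (norm k * K b) * (e / C * norm h)"
          using K[OF b] elim(1) b by (intro mult_mono) auto
        finally show "norm (c b k *\<^sub>R (fd f (p + h) b - fd f p b - second_deriv f p h b))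
            \<le> (norm k * K b) * (e / C * norm h)" .
      qed
      also have "\<dots> = norm k * (\<Sum>b\<in>B. K b) * (e / C * norm h)"
        by (simp only: sum_distrib_left sum_distrib_right)
      also have "\<dots> \<le> norm k * C * (e / C * norm h)"
        using e C by (intro mult_right_mono mult_left_mono) (simp_all add: C_def)
      also have "\<dots> = (C * (e / C)) * norm h * norm k" by (simp only: mult_ac)
      also have "C * (e / C) = e" using C by simp
      finally show "norm (fd f (p + h) k - fd f p k - second_deriv f p h k) \<le> e * norm h * norm k" .
    qed
  qed
qed

lemma vector_derivative_bound:
  fixes g :: "real \<Rightarrow> 'f::real_normed_vector"
  assumes "0 \<le> T" and d: "\<And>s. s \<in> {0..T} \<Longrightarrow> (g has_vector_derivative g' s) (at s)"
    and b: "\<And>s. s \<in> {0..T} \<Longrightarrow> norm (g' s) \<le> B"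
  shows "norm (g T - g 0) \<le> B * T"
proof -
  have "norm (g T - g 0) \<le> B * norm (T - 0)"
  proof (rule differentiable_bound[of "{0..T}" g "\<lambda>s h. h *\<^sub>R g' s"])
    show "(g has_derivative (\<lambda>h. h *\<^sub>R g' s)) (at s within {0..T})" if "s \<in> {0..T}" for s
      using d[OF that] has_derivative_at_withinI unfolding has_vector_derivative_def by blast
    show "onorm (\<lambda>h. h *\<^sub>R g' s) \<le> B" if "s \<in> {0..T}" for s
    proof (rule onorm_le)
      show "norm (h *\<^sub>R g' s) \<le> B * norm h" for h :: real
        using mult_left_mono[OF b[OF that], of "\<bar>h\<bar>"] by (simp add: mult.commute)
    qed
  qed (use assms(1) in auto)
  then show ?thesis using assms(1) by simp
qed

lemma norm_Pair_ge: "norm x \<le> norm (x, y)" "norm y \<le> norm (x, y)"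
  by (rule norm_fst_le, rule norm_snd_le)

text \<open>The mean value inequality for \<open>s \<mapsto> f (p + h + s k)\<close>. For \<open>h = 0\<close> this is Taylor's formula; for \<open>h\<close> and
\<open>k\<close> on complementary axes it isolates the mixed derivative; and the comparison of the two orders in
which \<open>h\<close> and \<open>k\<close> can be added shows the second derivative to be symmetric.\<close>

lemma second_order_increment:
  fixes f :: "'e::real_normed_vector \<Rightarrow> 'f::real_normed_vector"
  assumes fin: "finite_dim TYPE('e)" and f: "smooth_near p f"
  shows "quad_small (\<lambda>z. f (p + fst z + snd z) - f (p + fst z) - fd f p (snd z)
    - second_deriv f p (fst z) (snd z) - (1/2) *\<^sub>R second_deriv f p (snd z) (snd z))"
  unfolding quad_small_def
proof (intro allI impI)
  fix e :: real assume "e > 0"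
  let ?Q = "second_deriv f p"
  interpret Q: bounded_bilinear ?Q by (rule bounded_bilinear_second_deriv[OF fin f])
  have "\<forall>\<^sub>F h in nhds 0. \<forall>k. norm (fd f (p + h) k - fd f p k - ?Q h k) \<le> e / 2 * norm h * norm k"
    using fd_increment[OF fin f, of "e / 2"] \<open>e > 0\<close> by simp
  moreover have "\<forall>\<^sub>F h in nhds 0. smooth_near (p + h) f"
    using smooth_near_eventually[OF f] unfolding eventually_nhds_shift[where p=p] .
  ultimately have "\<forall>\<^sub>F h in nhds 0. (\<forall>k. norm (fd f (p + h) k - fd f p k - ?Q h k) \<le> e / 2 * norm h * norm k)
      \<and> smooth_near (p + h) f" by (rule eventually_conj)
  then obtain d where d: "d > 0" and
    inc: "\<And>h k. norm h < d \<Longrightarrow> norm (fd f (p + h) k - fd f p k - ?Q h k) \<le> e / 2 * norm h * norm k"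
    and sm: "\<And>h. norm h < d \<Longrightarrow> smooth_near (p + h) f"
    unfolding eventually_nhds_metric dist_norm by auto
  have "norm (f (p + h + k) - f (p + h) - fd f p k - ?Q h k - (1/2) *\<^sub>R ?Q k k) \<le> e * (norm (h, k))\<^sup>2"
    if z: "norm (h, k) < d / 2" for h k
  proof -
    define g where "g s = f (p + (h + s *\<^sub>R k)) - s *\<^sub>R fd f p k - s *\<^sub>R ?Q h k - (s\<^sup>2/2) *\<^sub>R ?Q k k" for s
    have small: "norm (h + s *\<^sub>R k) \<le> 2 * norm (h, k)" if "s \<in> {0..1}" for s
    proof -
      have "norm (h + s *\<^sub>R k) \<le> norm h + \<bar>s\<bar> * norm k" using norm_triangle_ineq[of h "s *\<^sub>R k"] by simp
      also have "\<bar>s\<bar> * norm k \<le> 1 * norm k" using that by (intro mult_right_mono) auto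
      finally show ?thesis using norm_Pair_ge(1)[of h k] norm_Pair_ge(2)[of k h] by linarith
    qed
    have der: "(g has_vector_derivative fd f (p + (h + s *\<^sub>R k)) k - fd f p k - ?Q (h + s *\<^sub>R k) k) (at s)"
      if s: "s \<in> {0..1}" for s
    proof -
      have "norm (h + s *\<^sub>R k) < d" using small[OF s] z by simp
      from smooth_near_differentiable[OF sm[OF this]]
      have f': "(f has_derivative fd f (p + (h + s *\<^sub>R k))) (at (p + (h + s *\<^sub>R k)))"
        using frechet_derivative_works by blast
      have "((\<lambda>s. p + (h + s *\<^sub>R k)) has_derivative (\<lambda>t. t *\<^sub>R k)) (at s)"
        by (auto intro!: derivative_eq_intros)
      from has_derivative_compose[OF this f']
      have 1: "((\<lambda>s. f (p + (h + s *\<^sub>R k))) has_vector_derivative fd f (p + (h + s *\<^sub>R k)) k) (at s)"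
        unfolding has_vector_derivative_def linear_scale[OF has_derivative_linear[OF f']] .
      have 2: "((\<lambda>s. s *\<^sub>R v) has_vector_derivative v) (at s)" for v :: 'f
        by (auto intro!: derivative_eq_intros simp: has_vector_derivative_def)
      have 3: "((\<lambda>s. (s\<^sup>2/2) *\<^sub>R ?Q k k) has_vector_derivative s *\<^sub>R ?Q k k) (at s)"
        by (auto intro!: derivative_eq_intros simp: has_vector_derivative_def)
      have "(g has_vector_derivative fd f (p + (h + s *\<^sub>R k)) k - fd f p k - ?Q h k - s *\<^sub>R ?Q k k) (at s)"
        unfolding g_def by (intro has_vector_derivative_diff 1 2 3)
      then show ?thesis by (simp add: Q.add_left Q.scaleR_left algebra_simps)
    qed
    have bd: "norm (fd f (p + (h + s *\<^sub>R k)) k - fd f p k - ?Q (h + s *\<^sub>R k) k) \<le> e * (norm (h, k))\<^sup>2"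
      if s: "s \<in> {0..1}" for s
    proof -
      have "norm (h + s *\<^sub>R k) < d" using small[OF s] z by simp
      from inc[OF this, of k] have "norm (fd f (p + (h + s *\<^sub>R k)) k - fd f p k - ?Q (h + s *\<^sub>R k) k)
          \<le> e / 2 * norm (h + s *\<^sub>R k) * norm k" .
      also have "\<dots> \<le> e / 2 * (2 * norm (h, k)) * norm (h, k)"
        using small[OF s] norm_Pair_ge(2)[of k h] \<open>e > 0\<close>
        by (intro mult_mono mult_left_mono) auto
      finally show ?thesis by (simp add: power2_eq_square)
    qed
    have "norm (g 1 - g 0) \<le> e * (norm (h, k))\<^sup>2 * 1"
      by (rule vector_derivative_bound[of 1 g, OF _ der bd]) auto
    also have "g 1 - g 0 = f (p + h + k) - f (p + h) - fd f p k - ?Q h k - (1/2) *\<^sub>R ?Q k k"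
      by (simp add: g_def algebra_simps)
    finally show ?thesis by simp
  qed
  then have "\<forall>z. dist z 0 < d / 2 \<longrightarrow> norm (f (p + fst z + snd z) - f (p + fst z) - fd f p (snd z)
      - ?Q (fst z) (snd z) - (1/2) *\<^sub>R ?Q (snd z) (snd z)) \<le> e * (norm z)\<^sup>2"
    by (simp add: dist_norm split_paired_all)
  then show "\<forall>\<^sub>F z in nhds 0. norm (f (p + fst z + snd z) - f (p + fst z) - fd f p (snd z)
      - ?Q (fst z) (snd z) - (1/2) *\<^sub>R ?Q (snd z) (snd z)) \<le> e * (norm z)\<^sup>2"
    unfolding eventually_nhds_metric using \<open>d > 0\<close> by (intro exI[of _ "d/2"]) auto
qed

section \<open>Second-order jets\<close>

lemma bounded_linear_bilinear_compose:
  assumes "bounded_linear A" "bounded_bilinear Q" shows "bounded_bilinear (\<lambda>h k. A (Q h k))"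
proof -
  interpret A: bounded_linear A by fact
  interpret Q: bounded_bilinear Q by fact
  obtain K where K: "K > 0" "\<And>x. norm (A x) \<le> norm x * K" using A.pos_bounded by blast
  obtain M where M: "M > 0" "\<And>a b. norm (Q a b) \<le> norm a * norm b * M" using Q.pos_bounded by blast
  show ?thesis
  proof
    show "\<exists>K. \<forall>a b. norm (A (Q a b)) \<le> norm a * norm b * K"
    proof (intro exI allI)
      fix a b
      have "norm (A (Q a b)) \<le> norm (Q a b) * K" by (rule K(2))
      also have "\<dots> \<le> norm a * norm b * M * K" using K(1) by (intro mult_right_mono M(2)) simp
      finally show "norm (A (Q a b)) \<le> norm a * norm b * (M * K)" by (simp only: mult_ac)
    qed
  qed (simp_all add: Q.add_left Q.add_right Q.scaleR_left Q.scaleR_right A.add A.scaleR)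
qed

text \<open>\<open>O(|h|)\<close> and, below, \<open>o(|h|)\<close> at the origin, both including the value 0 at 0.\<close>

definition lin_bound :: "('e::real_normed_vector \<Rightarrow> 'f::real_normed_vector) \<Rightarrow> bool" where
  "lin_bound f \<longleftrightarrow> (\<exists>C>0. \<forall>\<^sub>F h in nhds 0. norm (f h) \<le> C * norm h)"

definition lin_small :: "('e::real_normed_vector \<Rightarrow> 'f::real_normed_vector) \<Rightarrow> bool" where
  "lin_small f \<longleftrightarrow> (\<forall>e>0. \<forall>\<^sub>F h in nhds 0. norm (f h) \<le> e * norm h)"

lemma lin_small_imp_bound: "lin_small f \<Longrightarrow> lin_bound f"
  unfolding lin_small_def lin_bound_def using zero_less_one by blast

lemma lin_bound_linear:
  assumes "bounded_linear f" shows "lin_bound f"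
proof -
  obtain K where "K > 0" "\<And>x. norm (f x) \<le> norm x * K"
    using bounded_linear.pos_bounded[OF assms] by blast
  then show ?thesis unfolding lin_bound_def
    by (intro exI[of _ K]) (auto simp: mult.commute intro!: always_eventually)
qed

lemma lin_bound_add:
  assumes "lin_bound f" "lin_bound g" shows "lin_bound (\<lambda>h. f h + g h)"
proof -
  obtain C D where "C > 0" "D > 0" "\<forall>\<^sub>F h in nhds 0. norm (f h) \<le> C * norm h"
    "\<forall>\<^sub>F h in nhds 0. norm (g h) \<le> D * norm h"
    using assms unfolding lin_bound_def by blast
  from this(3,4) have "\<forall>\<^sub>F h in nhds 0. norm (f h + g h) \<le> (C + D) * norm h"
    by eventually_elim (simp add: distrib_right norm_triangle_mono)
  then show ?thesis using \<open>C > 0\<close> \<open>D > 0\<close> unfolding lin_bound_def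
    by (intro exI[of _ "C + D"]) auto
qed

lemma lin_small_add:
  assumes "lin_small f" "lin_small g" shows "lin_small (\<lambda>h. f h + g h)"
  unfolding lin_small_def
proof (intro allI impI)
  fix e :: real assume "e > 0"
  then have "\<forall>\<^sub>F h in nhds 0. norm (f h) \<le> e / 2 * norm h"
    "\<forall>\<^sub>F h in nhds 0. norm (g h) \<le> e / 2 * norm h"
    using assms half_gt_zero unfolding lin_small_def by blast+
  then show "\<forall>\<^sub>F h in nhds 0. norm (f h + g h) \<le> e * norm h"
  proof eventually_elim
    case (elim h)
    then show ?case using norm_triangle_ineq[of "f h" "g h"] by simp
  qed
qed

lemma lin_bound_tendsto:
  assumes "lin_bound f" shows "filterlim f (nhds 0) (nhds 0)"
proof -
  obtain C where C: "\<forall>\<^sub>F h in nhds 0. norm (f h) \<le> C * norm h"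
    using assms unfolding lin_bound_def by blast
  have "((\<lambda>h::'a. C * norm h) \<longlongrightarrow> C * norm (0::'a)) (nhds 0)"
    by (intro tendsto_intros filterlim_ident)
  then show ?thesis using C by (intro Lim_null_comparison[OF C]) simp
qed

lemma quad_small_add:
  assumes "quad_small f" "quad_small g" shows "quad_small (\<lambda>h. f h + g h)"
  unfolding quad_small_def
proof (intro allI impI)
  fix e :: real assume "e > 0"
  then have "\<forall>\<^sub>F h in nhds 0. norm (f h) \<le> e / 2 * (norm h)\<^sup>2"
    "\<forall>\<^sub>F h in nhds 0. norm (g h) \<le> e / 2 * (norm h)\<^sup>2"
    using assms half_gt_zero unfolding quad_small_def by blast+
  then show "\<forall>\<^sub>F h in nhds 0. norm (f h + g h) \<le> e * (norm h)\<^sup>2"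
  proof eventually_elim
    case (elim h)
    then show ?case using norm_triangle_ineq[of "f h" "g h"] by simp
  qed
qed

lemma quad_small_cong:
  assumes "quad_small f" "\<forall>\<^sub>F h in nhds 0. f h = g h" shows "quad_small g"
  unfolding quad_small_def
proof (intro allI impI)
  fix e :: real assume "e > 0"
  then have "\<forall>\<^sub>F h in nhds 0. norm (f h) \<le> e * (norm h)\<^sup>2"
    using assms(1) unfolding quad_small_def by blast
  then show "\<forall>\<^sub>F h in nhds 0. norm (g h) \<le> e * (norm h)\<^sup>2"
    using assms(2) by eventually_elim simp
qed

lemma quad_small_compose:
  assumes "quad_small r" "lin_bound f" shows "quad_small (\<lambda>h. r (f h))"
  unfolding quad_small_def
proof (intro allI impI)
  fix e :: real assume "e > 0"
  obtain C where C: "C > 0" "\<forall>\<^sub>F h in nhds 0. norm (f h) \<le> C * norm h"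
    using assms(2) unfolding lin_bound_def by blast
  have "e / C\<^sup>2 > 0" using \<open>e > 0\<close> C by simp
  then have "\<forall>\<^sub>F y in nhds 0. norm (r y) \<le> e / C\<^sup>2 * (norm y)\<^sup>2"
    using assms(1) unfolding quad_small_def by blast
  then have "\<forall>\<^sub>F h in nhds 0. norm (r (f h)) \<le> e / C\<^sup>2 * (norm (f h))\<^sup>2"
    using lin_bound_tendsto[OF assms(2)] by (rule eventually_compose_filterlim)
  then show "\<forall>\<^sub>F h in nhds 0. norm (r (f h)) \<le> e * (norm h)\<^sup>2"
    using C(2)
  proof eventually_elim
    case (elim h)
    have "(norm (f h))\<^sup>2 \<le> (C * norm h)\<^sup>2" by (rule power_mono[OF elim(2)]) simp
    then have "e / C\<^sup>2 * (norm (f h))\<^sup>2 \<le> e / C\<^sup>2 * (C * norm h)\<^sup>2"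
      using \<open>e / C\<^sup>2 > 0\<close> by (intro mult_left_mono) auto
    also have "\<dots> = e * (norm h)\<^sup>2" using C(1) by (simp add: power_mult_distrib)
    finally show ?case using elim(1) by linarith
  qed
qed

lemma quad_small_bilinear:
  assumes "bounded_bilinear Q" "lin_bound f" "lin_small g"
  shows "quad_small (\<lambda>h. Q (f h) (g h))"
  unfolding quad_small_def
proof (intro allI impI)
  fix e :: real assume "e > 0"
  obtain C where C: "C > 0" "\<forall>\<^sub>F h in nhds 0. norm (f h) \<le> C * norm h"
    using assms(2) unfolding lin_bound_def by blast
  obtain K where K: "K > 0" "\<And>a b. norm (Q a b) \<le> norm a * norm b * K"
    using bounded_bilinear.pos_bounded[OF assms(1)] by blast
  have "e / (C * K) > 0" using \<open>e > 0\<close> C K by simp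
  then have "\<forall>\<^sub>F h in nhds 0. norm (g h) \<le> e / (C * K) * norm h"
    using assms(3) unfolding lin_small_def by blast
  then show "\<forall>\<^sub>F h in nhds 0. norm (Q (f h) (g h)) \<le> e * (norm h)\<^sup>2"
    using C(2)
  proof eventually_elim
    case (elim h)
    have "norm (Q (f h) (g h)) \<le> norm (f h) * norm (g h) * K" by (rule K(2))
    also have "\<dots> \<le> (C * norm h) * (e / (C * K) * norm h) * K"
      using elim C(1) K(1) by (intro mult_right_mono mult_mono) auto
    also have "\<dots> = (C * (e / (C * K)) * K) * (norm h)\<^sup>2" by (simp only: power2_eq_square mult_ac)
    also have "C * (e / (C * K)) * K = e" using C(1) K(1) by simp
    finally show ?case .
  qed
qed

lemma quad_small_linear:
  assumes "bounded_linear A" "quad_small r" shows "quad_small (\<lambda>h. A (r h))"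
  unfolding quad_small_def
proof (intro allI impI)
  fix e :: real assume "e > 0"
  obtain K where K: "K > 0" "\<And>x. norm (A x) \<le> norm x * K"
    using bounded_linear.pos_bounded[OF assms(1)] by blast
  have "e / K > 0" using \<open>e > 0\<close> K by simp
  then have "\<forall>\<^sub>F h in nhds 0. norm (r h) \<le> e / K * (norm h)\<^sup>2"
    using assms(2) unfolding quad_small_def by blast
  then show "\<forall>\<^sub>F h in nhds 0. norm (A (r h)) \<le> e * (norm h)\<^sup>2"
  proof eventually_elim
    case (elim h)
    have "norm (A (r h)) \<le> norm (r h) * K" by (rule K(2))
    also have "\<dots> \<le> (e / K * (norm h)\<^sup>2) * K" using elim K(1) by (intro mult_right_mono) auto
    also have "\<dots> = e * (norm h)\<^sup>2" using K(1) by simp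
    finally show ?case .
  qed
qed

lemma quad_small_imp_lin_small:
  assumes "quad_small r" shows "lin_small r"
  unfolding lin_small_def
proof (intro allI impI)
  fix e :: real assume "e > 0"
  have "\<forall>\<^sub>F h in nhds 0. norm (r h) \<le> 1 * (norm h)\<^sup>2"
    using assms unfolding quad_small_def using zero_less_one by blast
  moreover have "\<forall>\<^sub>F h in nhds (0::'a). norm h < e"
    using \<open>e > 0\<close> unfolding eventually_nhds_metric by auto
  ultimately show "\<forall>\<^sub>F h in nhds 0. norm (r h) \<le> e * norm h"
  proof eventually_elim
    case (elim h)
    have "norm h * norm h \<le> e * norm h" using elim(2) by (intro mult_right_mono) auto
    then show ?case using elim(1) by (simp add: power2_eq_square)
  qed
qed

lemma lin_small_bilinear:
  assumes "bounded_bilinear Q" shows "lin_small (\<lambda>h. Q h h)"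
  unfolding lin_small_def
proof (intro allI impI)
  fix e :: real assume "e > 0"
  obtain K where K: "K > 0" "\<And>a b. norm (Q a b) \<le> norm a * norm b * K"
    using bounded_bilinear.pos_bounded[OF assms(1)] by blast
  have "e / K > 0" using \<open>e > 0\<close> K by simp
  then have "\<forall>\<^sub>F h in nhds (0::'a). norm h < e / K"
    unfolding eventually_nhds_metric by auto
  then show "\<forall>\<^sub>F h in nhds 0. norm (Q h h) \<le> e * norm h"
  proof eventually_elim
    case (elim h)
    have "norm (Q h h) \<le> norm h * norm h * K" by (rule K(2))
    also have "\<dots> \<le> norm h * (e / K) * K"
      using elim K(1) by (intro mult_right_mono mult_left_mono) auto
    also have "\<dots> = e * norm h" using K(1) by simp
    finally show ?case .
  qed
qed

text \<open>The bilinear map \<open>Q\<close> enters only through its quadratic form. Symmetry is not imposed, so that the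
jet of a binary map can carry \<open>B (fst p) (snd q)\<close>, whose quadratic form on pairs is \<open>B\<close> itself.\<close>

definition jet2 ::
  "('e::real_normed_vector \<Rightarrow> 'f::real_normed_vector) \<Rightarrow> ('e \<Rightarrow> 'f) \<Rightarrow> ('e \<Rightarrow> 'e \<Rightarrow> 'f) \<Rightarrow> bool" where
  "jet2 f L Q \<longleftrightarrow> bounded_linear L \<and> bounded_bilinear Q \<and> quad_small (\<lambda>h. f h - L h - Q h h)"

lemma jet2D:
  assumes "jet2 f L Q"
  shows "bounded_linear L" "bounded_bilinear Q" "quad_small (\<lambda>h. f h - L h - Q h h)"
  using assms unfolding jet2_def by auto

lemma jet2_remainder_lin_small:
  assumes "jet2 f L Q" shows "lin_small (\<lambda>h. f h - L h)"
  using lin_small_add[OF quad_small_imp_lin_small[OF jet2D(3)[OF assms]]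
      lin_small_bilinear[OF jet2D(2)[OF assms]]] by simp

lemma jet2_lin_bound:
  assumes "jet2 f L Q" shows "lin_bound f"
  using lin_bound_add[OF lin_small_imp_bound[OF jet2_remainder_lin_small[OF assms]]
      lin_bound_linear[OF jet2D(1)[OF assms]]] by simp

lemma jet2_zero: assumes "jet2 f L Q" shows "f 0 = 0"
proof -
  obtain C where "\<forall>\<^sub>F h in nhds 0. norm (f h) \<le> C * norm h"
    using jet2_lin_bound[OF assms] unfolding lin_bound_def by blast
  from eventually_nhds_x_imp_x[OF this] show ?thesis by simp
qed

lemma jet2_has_derivative:
  assumes "jet2 f L Q" shows "(f has_derivative L) (at 0)"
  unfolding has_derivative_within_alt2
proof (intro conjI allI impI)
  show "bounded_linear L" by (rule jet2D(1)[OF assms])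
  fix e :: real assume "e > 0"
  then have "\<forall>\<^sub>F h in nhds 0. norm (f h - L h) \<le> e * norm h"
    using jet2_remainder_lin_small[OF assms] unfolding lin_small_def by blast
  then show "\<forall>\<^sub>F y in at 0. norm (f y - f 0 - L (y - 0)) \<le> e * norm (y - 0)"
    unfolding eventually_at_filter by eventually_elim (simp add: jet2_zero[OF assms])
qed

lemma jet2_cong:
  assumes "jet2 f L Q" "\<forall>\<^sub>F h in nhds 0. f h = g h" shows "jet2 g L Q"
  unfolding jet2_def
proof (intro conjI)
  have "\<forall>\<^sub>F h in nhds 0. f h - L h - Q h h = g h - L h - Q h h"
    using assms(2) by eventually_elim simp
  then show "quad_small (\<lambda>h. g h - L h - Q h h)"
    by (rule quad_small_cong[OF jet2D(3)[OF assms(1)]])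
qed (use jet2D[OF assms(1)] in auto)

lemma eventually_nhds_0_ray:
  fixes x :: "'a::real_normed_vector"
  assumes "\<forall>\<^sub>F h in nhds 0. P h"
  obtains t where "t > 0" "P (t *\<^sub>R x)"
proof -
  obtain d where d: "d > 0" "\<And>h. norm h < d \<Longrightarrow> P h"
    using assms unfolding eventually_nhds_metric dist_norm by auto
  define t where "t = d / (norm x + 1)"
  have n: "norm x + 1 > 0" by (simp add: add_nonneg_pos)
  then have "t > 0" using d(1) by (simp add: t_def)
  moreover have "norm (t *\<^sub>R x) < d"
  proof -
    have "norm (t *\<^sub>R x) = t * norm x" using \<open>t > 0\<close> by simp
    also have "\<dots> < t * (norm x + 1)" using \<open>t > 0\<close> by simp
    also have "\<dots> = d" using n by (simp add: t_def)
    finally show ?thesis .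
  qed
  ultimately show ?thesis using that d(2) by blast
qed

text \<open>Linear parts agree as derivatives; the difference of the quadratic forms is homogeneous of degree
two and \<open>o(|h|\<^sup>2)\<close>, hence zero along every ray.\<close>

lemma jet2_unique:
  assumes "jet2 f L Q" "jet2 f L' Q'"
  shows "L = L'" "Q x x = Q' x x"
proof -
  show L: "L = L'"
    by (rule has_derivative_unique[OF jet2_has_derivative[OF assms(1)] jet2_has_derivative[OF assms(2)]])
  interpret Q: bounded_bilinear Q by (rule jet2D(2)[OF assms(1)])
  interpret Q': bounded_bilinear Q' by (rule jet2D(2)[OF assms(2)])
  have "quad_small (\<lambda>h. - (f h - L h - Q h h))"
    by (rule quad_small_linear[OF bounded_linear_minus[OF bounded_linear_ident] jet2D(3)[OF assms(1)]])
  from quad_small_add[OF this jet2D(3)[OF assms(2)]]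
  have q: "quad_small (\<lambda>h. Q h h - Q' h h)" unfolding L by simp
  have le: "norm (Q x x - Q' x x) \<le> e * (norm x)\<^sup>2" if "e > 0" for e
  proof -
    have "\<forall>\<^sub>F h in nhds 0. norm (Q h h - Q' h h) \<le> e * (norm h)\<^sup>2"
      using q that unfolding quad_small_def by blast
    then obtain t where t: "t > 0"
      "norm (Q (t *\<^sub>R x) (t *\<^sub>R x) - Q' (t *\<^sub>R x) (t *\<^sub>R x)) \<le> e * (norm (t *\<^sub>R x))\<^sup>2"
      by (rule eventually_nhds_0_ray)
    have "Q (t *\<^sub>R x) (t *\<^sub>R x) - Q' (t *\<^sub>R x) (t *\<^sub>R x) = t\<^sup>2 *\<^sub>R (Q x x - Q' x x)"
      by (simp add: Q.scaleR_left Q.scaleR_right Q'.scaleR_left Q'.scaleR_right power2_eq_square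
          scaleR_diff_right)
    then have "t\<^sup>2 * norm (Q x x - Q' x x) \<le> t\<^sup>2 * (e * (norm x)\<^sup>2)"
      using t by (simp add: power_mult_distrib mult_ac)
    then show ?thesis using t(1) by simp
  qed
  have "norm (Q x x - Q' x x) \<le> 0"
  proof (rule field_le_epsilon)
    fix e :: real assume "e > 0"
    have n: "(norm x)\<^sup>2 + 1 > 0" by (simp add: add_nonneg_pos)
    have "norm (Q x x - Q' x x) \<le> e / ((norm x)\<^sup>2 + 1) * (norm x)\<^sup>2"
      by (rule le) (use \<open>e > 0\<close> n in simp)
    also have "\<dots> \<le> e / ((norm x)\<^sup>2 + 1) * ((norm x)\<^sup>2 + 1)"
      using \<open>e > 0\<close> n by (intro mult_left_mono) auto
    also have "\<dots> = 0 + e" using n by simp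
    finally show "norm (Q x x - Q' x x) \<le> 0 + e" .
  qed
  then show "Q x x = Q' x x" by simp
qed

text \<open>The error splits as \<open>r\<^sub>g (f h) + L' (r\<^sub>f h) + Q' (f h - L h) (f h) + Q' (L h) (f h - L h)\<close>.\<close>

lemma jet2_compose:
  assumes f: "jet2 f L Q" and g: "jet2 g L' Q'"
  shows "jet2 (\<lambda>h. g (f h)) (\<lambda>h. L' (L h)) (\<lambda>h k. L' (Q h k) + Q' (L h) (L k))"
  unfolding jet2_def
proof (intro conjI)
  interpret L: bounded_linear L by (rule jet2D(1)[OF f])
  interpret L': bounded_linear L' by (rule jet2D(1)[OF g])
  interpret Q': bounded_bilinear Q' by (rule jet2D(2)[OF g])
  show "bounded_linear (\<lambda>h. L' (L h))"
    by (rule bounded_linear_compose[OF jet2D(1)[OF g] jet2D(1)[OF f]])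
  show "bounded_bilinear (\<lambda>h k. L' (Q h k) + Q' (L h) (L k))"
    by (intro bounded_bilinear_add bounded_linear_bilinear_compose[OF jet2D(1)[OF g] jet2D(2)[OF f]]
        bounded_bilinear.comp[OF jet2D(2)[OF g] jet2D(1)[OF f] jet2D(1)[OF f]])
  have 1: "quad_small (\<lambda>h. g (f h) - L' (f h) - Q' (f h) (f h))"
    by (rule quad_small_compose[OF jet2D(3)[OF g] jet2_lin_bound[OF f]])
  have 2: "quad_small (\<lambda>h. L' (f h - L h - Q h h))"
    by (rule quad_small_linear[OF jet2D(1)[OF g] jet2D(3)[OF f]])
  have 3: "quad_small (\<lambda>h. Q' (f h - L h) (f h))"
    by (rule quad_small_bilinear[OF bounded_bilinear.flip[OF jet2D(2)[OF g]]
          jet2_lin_bound[OF f] jet2_remainder_lin_small[OF f]])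
  have 4: "quad_small (\<lambda>h. Q' (L h) (f h - L h))"
    by (rule quad_small_bilinear[OF jet2D(2)[OF g]
          lin_bound_linear[OF jet2D(1)[OF f]] jet2_remainder_lin_small[OF f]])
  show "quad_small (\<lambda>h. g (f h) - L' (L h) - (L' (Q h h) + Q' (L h) (L h)))"
    using quad_small_add[OF quad_small_add[OF quad_small_add[OF 1 2] 3] 4]
    by (simp add: L'.diff L'.add Q'.diff_left Q'.diff_right algebra_simps)
qed

lemma quad_small_Pair:
  assumes "quad_small f" "quad_small g" shows "quad_small (\<lambda>h. (f h, g h))"
proof -
  have "bounded_linear (\<lambda>x::'b. (x, 0::'c))" "bounded_linear (\<lambda>x::'c. (0::'b, x))"
    by (intro bounded_linear_Pair bounded_linear_ident bounded_linear_zero)+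
  from quad_small_add[OF quad_small_linear[OF this(1) assms(1)] quad_small_linear[OF this(2) assms(2)]]
  show ?thesis by simp
qed

lemma jet2_Pair:
  assumes f: "jet2 f L Q" and g: "jet2 g L' Q'"
  shows "jet2 (\<lambda>h. (f h, g h)) (\<lambda>h. (L h, L' h)) (\<lambda>h k. (Q h k, Q' h k))"
  unfolding jet2_def
proof (intro conjI)
  show "bounded_linear (\<lambda>h. (L h, L' h))"
    by (rule bounded_linear_Pair[OF jet2D(1)[OF f] jet2D(1)[OF g]])
  have "bounded_linear (\<lambda>x::'b. (x, 0::'c))" "bounded_linear (\<lambda>x::'c. (0::'b, x))"
    by (intro bounded_linear_Pair bounded_linear_ident bounded_linear_zero)+
  from bounded_bilinear_add[OF bounded_linear_bilinear_compose[OF this(1) jet2D(2)[OF f]]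
    bounded_linear_bilinear_compose[OF this(2) jet2D(2)[OF g]]]
  show "bounded_bilinear (\<lambda>h k. (Q h k, Q' h k))" by simp
  show "quad_small (\<lambda>h. (f h, g h) - (L h, L' h) - (Q h h, Q' h h))"
    using quad_small_Pair[OF jet2D(3)[OF f] jet2D(3)[OF g]] by simp
qed

lemma quad_small_zero: "quad_small (\<lambda>h. 0)"
  unfolding quad_small_def by (auto intro!: always_eventually)

lemma jet2_linear: "bounded_linear L \<Longrightarrow> jet2 L L (\<lambda>h k. 0)"
  unfolding jet2_def by (simp add: bounded_bilinear_zero quad_small_zero)

lemma jet2_add:
  assumes f: "jet2 f L Q" and g: "jet2 g L' Q'"
  shows "jet2 (\<lambda>h. f h + g h) (\<lambda>h. L h + L' h) (\<lambda>h k. Q h k + Q' h k)"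
  unfolding jet2_def
proof (intro conjI)
  show "quad_small (\<lambda>h. f h + g h - (L h + L' h) - (Q h h + Q' h h))"
    using quad_small_add[OF jet2D(3)[OF f] jet2D(3)[OF g]] by (simp add: algebra_simps)
qed (intro bounded_linear_add bounded_bilinear_add jet2D[OF f] jet2D[OF g])+

abbreviation jet2_binary where
  "jet2_binary m A C B \<equiv> jet2 (\<lambda>p. m (fst p) (snd p)) (\<lambda>p. A (fst p) + C (snd p))
    (\<lambda>p q. B (fst p) (snd q))"

lemma jet2_binary_compose:
  assumes m: "jet2_binary m A C B" and f: "jet2 f L Q" and g: "jet2 g L' Q'"
  shows "jet2 (\<lambda>h. m (f h) (g h)) (\<lambda>h. A (L h) + C (L' h))
    (\<lambda>h k. A (Q h k) + C (Q' h k) + B (L h) (L' k))"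
  using jet2_compose[OF jet2_Pair[OF f g] m] by simp

lemma quad_small_bilinear_eq_0:
  assumes "bounded_bilinear Q" "quad_small (\<lambda>h. Q h h)" shows "Q x x = 0"
proof -
  have "quad_small (\<lambda>h. - Q h h)"
    by (rule quad_small_linear[OF bounded_linear_minus[OF bounded_linear_ident] assms(2)])
  then have "jet2 (\<lambda>h. 0) (\<lambda>h. 0) Q" unfolding jet2_def using assms(1) by simp
  from jet2_unique(2)[OF this jet2_linear[OF bounded_linear_zero]] show ?thesis .
qed

lemma bounded_linear_Pair_swap: "bounded_linear (\<lambda>z::'a::real_normed_vector \<times> 'b::real_normed_vector. (snd z, fst z))"
  by (intro bounded_linear_Pair bounded_linear_fst bounded_linear_snd)

text \<open>The increment from \<open>p\<close> to \<open>p + h + k\<close> can be computed through \<open>p + h\<close> or through \<open>p + k\<close>; the difference of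
the two second-order approximations is a bilinear form that is \<open>o(2)\<close>, hence zero.\<close>

lemma second_deriv_sym:
  fixes f :: "'e::real_normed_vector \<Rightarrow> 'f::real_normed_vector"
  assumes fin: "finite_dim TYPE('e)" and f: "smooth_near p f"
  shows "second_deriv f p x y = second_deriv f p y x"
proof -
  let ?Q = "second_deriv f p"
  interpret Q: bounded_bilinear ?Q by (rule bounded_bilinear_second_deriv[OF fin f])
  have lin: "linear (fd f p)"
    using smooth_near_differentiable[OF f] linear_frechet_derivative by blast
  define r where "r z = f (p + fst z + snd z) - f (p + fst z) - fd f p (snd z)
    - ?Q (fst z) (snd z) - (1/2) *\<^sub>R ?Q (snd z) (snd z)" for z
  have r: "quad_small r" unfolding r_def by (rule second_order_increment[OF fin f])
  have 1: "quad_small (\<lambda>z::'e \<times> 'e. r (0, fst z))" "quad_small (\<lambda>z::'e \<times> 'e. r (0, snd z))"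
    by (intro quad_small_compose[OF r] lin_bound_linear bounded_linear_Pair bounded_linear_zero
        bounded_linear_fst bounded_linear_snd)+
  have 2: "quad_small (\<lambda>z. r (snd z, fst z))"
    by (intro quad_small_compose[OF r] lin_bound_linear bounded_linear_Pair_swap)
  note min = quad_small_linear[OF bounded_linear_minus[OF bounded_linear_ident]]
  have "quad_small (\<lambda>z. (r (snd z, fst z) + r (0, snd z)) + - (r z + r (0, fst z)))"
    by (intro quad_small_add min r 1 2)
  moreover have "(r (snd z, fst z) + r (0, snd z)) + - (r z + r (0, fst z))
      = ?Q (fst z) (snd z) - ?Q (snd z) (fst z)" for z
    unfolding r_def by (simp add: Q.zero_left add.commute add.left_commute algebra_simps)
  ultimately have q: "quad_small (\<lambda>z. ?Q (fst z) (snd z) - ?Q (snd z) (fst z))" by simp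
  have "bounded_bilinear (\<lambda>z w. ?Q (fst z) (snd w) + - ?Q (snd z) (fst w))"
    by (intro bounded_bilinear_add bounded_linear_bilinear_compose[of uminus]
        bounded_linear_minus[OF bounded_linear_ident]
        bounded_bilinear.comp[OF Q.bounded_bilinear_axioms] bounded_linear_fst bounded_linear_snd)
  from quad_small_bilinear_eq_0[OF this, of "(x, y)"] q show ?thesis by simp
qed

lemma jet2_taylor:
  fixes f :: "'e::real_normed_vector \<Rightarrow> 'f::real_normed_vector"
  assumes fin: "finite_dim TYPE('e)" and f: "smooth_near p f"
  shows "jet2 (\<lambda>h. f (p + h) - f p) (fd f p) (\<lambda>h k. (1/2) *\<^sub>R second_deriv f p h k)"
  unfolding jet2_def
proof (intro conjI)
  let ?Q = "second_deriv f p"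
  interpret Q: bounded_bilinear ?Q by (rule bounded_bilinear_second_deriv[OF fin f])
  show "bounded_linear (fd f p)"
    using smooth_near_differentiable[OF f] frechet_derivative_works has_derivative_bounded_linear by blast
  show "bounded_bilinear (\<lambda>h k. (1/2) *\<^sub>R ?Q h k)"
    by (rule bounded_linear_bilinear_compose[OF bounded_linear_scaleR_right Q.bounded_bilinear_axioms])
  have "lin_bound (\<lambda>h::'e. (0::'e, h))"
    by (intro lin_bound_linear bounded_linear_Pair bounded_linear_zero bounded_linear_ident)
  from quad_small_compose[OF second_order_increment[OF fin f] this]
  show "quad_small (\<lambda>h. f (p + h) - f p - fd f p h - (1/2) *\<^sub>R ?Q h h)"
    by (simp add: Q.zero_left)
qed

definition smooth2_near_0 ::
  "('e::real_normed_vector \<Rightarrow> 'f::real_normed_vector \<Rightarrow> 'g::real_normed_vector) \<Rightarrow> bool" where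
  "smooth2_near_0 f \<longleftrightarrow> smooth_near (0, 0) (\<lambda>p. f (fst p) (snd p))"

text \<open>This order of differentiation is the one in which left-invariant fields and the infinitesimal
action arise: first a tangent map in the second variable, then a derivative in the first.\<close>

definition mixed_deriv ::
  "('e::real_normed_vector \<Rightarrow> 'f::real_normed_vector \<Rightarrow> 'g::real_normed_vector) \<Rightarrow> 'e \<Rightarrow> 'f \<Rightarrow> 'g" where
  "mixed_deriv f x y = fd (\<lambda>u. fd (f u) 0 y) 0 x"

lemma eventually_nhds_slice:
  assumes "\<forall>\<^sub>F z in nhds (0, 0). P z"
  shows "\<forall>\<^sub>F u in nhds 0. P (u, 0)" "\<forall>\<^sub>F v in nhds 0. P (0, v)"
proof -
  have "((\<lambda>u. (u, 0)) \<longlongrightarrow> (0, 0)) (nhds 0)" "((\<lambda>v. (0, v)) \<longlongrightarrow> (0, 0)) (nhds 0)"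
    by (intro tendsto_Pair filterlim_ident tendsto_const)+
  then show "\<forall>\<^sub>F u in nhds 0. P (u, 0)" "\<forall>\<^sub>F v in nhds 0. P (0, v)"
    using assms eventually_compose_filterlim by blast+
qed

lemma has_derivative_eventually_cong:
  assumes "(f has_derivative D) (at x)" "\<forall>\<^sub>F y in nhds x. f y = g y"
  shows "(g has_derivative D) (at x)"
proof -
  obtain S where "open S" "x \<in> S" "\<And>y. y \<in> S \<Longrightarrow> f y = g y"
    using assms(2) unfolding eventually_nhds by blast
  then show ?thesis using has_derivative_transform_within_open[OF assms(1)] by blast
qed

context
  fixes f :: "'e::real_normed_vector \<Rightarrow> 'f::real_normed_vector \<Rightarrow> 'g::real_normed_vector"
  assumes finE: "finite_dim TYPE('e)" and finF: "finite_dim TYPE('f)"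
    and sm: "smooth2_near_0 f"
begin

private abbreviation F where "F \<equiv> \<lambda>p. f (fst p) (snd p)"
private abbreviation Q where "Q \<equiv> second_deriv F (0, 0)"

private lemma smF: "smooth_near (0, 0) F"
  using sm unfolding smooth2_near_0_def .

private lemma fin: "finite_dim TYPE('e \<times> 'f)"
  by (rule finite_dim_prod[OF finE finF])

private lemma Q_bilinear: "bounded_bilinear Q"
  by (rule bounded_bilinear_second_deriv[OF fin smF])

private lemma Fd: "smooth_near p F \<Longrightarrow> (F has_derivative fd F p) (at p)"
  using smooth_near_differentiable frechet_derivative_works by blast

private lemma partial_deriv_right:
  assumes "smooth_near (u, v) F"
  shows "(f u has_derivative (\<lambda>y. fd F (u, v) (0, y))) (at v)"
proof -
  have "((\<lambda>v. (u, v)) has_derivative (\<lambda>y. (0, y))) (at v)"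
    by (intro has_derivative_Pair has_derivative_const has_derivative_ident)
  from has_derivative_compose[OF this Fd[OF assms]] show ?thesis by simp
qed

private lemma partial_deriv_left:
  assumes "smooth_near (u, v) F"
  shows "((\<lambda>u. f u v) has_derivative (\<lambda>x. fd F (u, v) (x, 0))) (at u)"
proof -
  have "((\<lambda>u. (u, v)) has_derivative (\<lambda>x. (x, 0))) (at u)"
    by (intro has_derivative_Pair has_derivative_const has_derivative_ident)
  from has_derivative_compose[OF this Fd[OF assms]] show ?thesis by simp
qed

lemma partial_differentiable_right: "\<forall>\<^sub>F u in nhds 0. (f u has_derivative fd (f u) 0) (at 0)"
  using eventually_nhds_slice(1)[OF smooth_near_eventually[OF smF]]
proof eventually_elim
  case (elim u)
  from partial_deriv_right[OF elim] show ?case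
    using frechet_derivative_at by metis
qed

lemma partial_differentiable_left:
  "\<forall>\<^sub>F v in nhds 0. ((\<lambda>u. f u v) has_derivative fd (\<lambda>u. f u v) 0) (at 0)"
  using eventually_nhds_slice(2)[OF smooth_near_eventually[OF smF]]
proof eventually_elim
  case (elim v)
  from partial_deriv_left[OF elim] show ?case
    using frechet_derivative_at by metis
qed

private lemma fd_right: "\<forall>\<^sub>F u in nhds 0. fd (f u) 0 = (\<lambda>y. fd F (u, 0) (0, y))"
  using eventually_nhds_slice(1)[OF smooth_near_eventually[OF smF]]
proof eventually_elim
  case (elim u)
  show ?case by (rule frechet_derivative_at[symmetric, OF partial_deriv_right[OF elim]])
qed

private lemma fd_left: "\<forall>\<^sub>F v in nhds 0. fd (\<lambda>u. f u v) 0 = (\<lambda>x. fd F (0, v) (x, 0))"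
  using eventually_nhds_slice(2)[OF smooth_near_eventually[OF smF]]
proof eventually_elim
  case (elim v)
  show ?case by (rule frechet_derivative_at[symmetric, OF partial_deriv_left[OF elim]])
qed

private lemma has_derivative_fd_right:
  "((\<lambda>u. fd (f u) 0 y) has_derivative (\<lambda>x. Q (x, 0) (0, y))) (at 0)"
proof (rule has_derivative_eventually_cong)
  have 1: "((\<lambda>p. fd F p (0, y)) has_derivative (\<lambda>h. Q h (0, y))) (at (0, 0))"
    using frechet_derivative_works[THEN iffD1, OF smooth_near_differentiable[OF smooth_near_deriv[OF smF]]]
    unfolding second_deriv_def .
  have "((\<lambda>u. (u, 0)) has_derivative (\<lambda>x. (x, 0))) (at 0)"
    by (intro has_derivative_Pair has_derivative_const has_derivative_ident)
  from has_derivative_compose[OF this 1]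
  show "((\<lambda>u. fd F (u, 0) (0, y)) has_derivative (\<lambda>x. Q (x, 0) (0, y))) (at 0)" .
  show "\<forall>\<^sub>F u in nhds 0. fd F (u, 0) (0, y) = fd (f u) 0 y"
    using fd_right by eventually_elim simp
qed

private lemma mixed_eq: "mixed_deriv f x y = Q (x, 0) (0, y)"
  unfolding mixed_deriv_def frechet_derivative_at[symmetric, OF has_derivative_fd_right] ..

lemma mixed_deriv_has_derivative:
  "((\<lambda>u. fd (f u) 0 y) has_derivative (\<lambda>x. mixed_deriv f x y)) (at 0)"
  using has_derivative_fd_right unfolding mixed_eq .

lemma bounded_bilinear_mixed_deriv: "bounded_bilinear (mixed_deriv f)"
  unfolding mixed_eq[abs_def]
  by (intro bounded_bilinear.comp[OF Q_bilinear] bounded_linear_Pair bounded_linear_zero bounded_linear_ident)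

lemma mixed_deriv_increment_right:
  assumes "e > 0"
  shows "\<forall>\<^sub>F u in nhds 0. \<forall>y. norm (fd (f u) 0 y - fd (f 0) 0 y - mixed_deriv f u y) \<le> e * norm u * norm y"
proof -
  have inc: "\<forall>\<^sub>F h in nhds (0, 0). \<forall>k. norm (fd F h k - fd F (0, 0) k - Q h k) \<le> e * norm h * norm k"
    using fd_increment[OF fin smF assms] unfolding zero_prod_def[symmetric] add_0_left .
  have 0: "fd (f 0) 0 = (\<lambda>y. fd F (0, 0) (0, y))" by (rule eventually_nhds_x_imp_x[OF fd_right])
  from eventually_nhds_slice(1)[OF inc] fd_right show ?thesis
  proof eventually_elim
    case (elim u)
    show ?case
    proof
      fix y
      show "norm (fd (f u) 0 y - fd (f 0) 0 y - mixed_deriv f u y) \<le> e * norm u * norm y"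
        using elim(1)[rule_format, of "(0, y)"] unfolding elim(2) 0 mixed_eq by (simp add: norm_Pair)
    qed
  qed
qed

lemma mixed_deriv_increment_left:
  assumes "e > 0"
  shows "\<forall>\<^sub>F v in nhds 0. \<forall>x. norm (fd (\<lambda>u. f u v) 0 x - fd (\<lambda>u. f u 0) 0 x - mixed_deriv f x v) \<le> e * norm v * norm x"
proof -
  have inc: "\<forall>\<^sub>F h in nhds (0, 0). \<forall>k. norm (fd F h k - fd F (0, 0) k - Q h k) \<le> e * norm h * norm k"
    using fd_increment[OF fin smF assms] unfolding zero_prod_def[symmetric] add_0_left .
  have 0: "fd (\<lambda>u. f u 0) 0 = (\<lambda>x. fd F (0, 0) (x, 0))" by (rule eventually_nhds_x_imp_x[OF fd_left])
  from eventually_nhds_slice(2)[OF inc] fd_left show ?thesis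
  proof eventually_elim
    case (elim v)
    show ?case
    proof
      fix x
      show "norm (fd (\<lambda>u. f u v) 0 x - fd (\<lambda>u. f u 0) 0 x - mixed_deriv f x v) \<le> e * norm v * norm x"
        using elim(1)[rule_format, of "(x, 0)"]
        unfolding elim(2) 0 mixed_eq second_deriv_sym[OF fin smF, of "(x, 0)"] by (simp add: norm_Pair)
    qed
  qed
qed

lemma mixed_deriv_quad_small:
  "quad_small (\<lambda>z. f (fst z) (snd z) - f (fst z) 0 - f 0 (snd z) + f 0 0 - mixed_deriv f (fst z) (snd z))"
proof -
  interpret Q: bounded_bilinear Q by (rule Q_bilinear)
  define r where "r z = F ((0, 0) + fst z + snd z) - F ((0, 0) + fst z) - fd F (0, 0) (snd z)
    - Q (fst z) (snd z) - (1/2) *\<^sub>R Q (snd z) (snd z)" for z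
  have r: "quad_small r" unfolding r_def by (rule second_order_increment[OF fin smF])
  have bl: "bounded_linear (\<lambda>z::'e \<times> 'f. ((fst z, 0::'f), (0::'e, snd z)))"
    "bounded_linear (\<lambda>z::'e \<times> 'f. ((0::'e, 0::'f), (0::'e, snd z)))"
    by (intro bounded_linear_Pair bounded_linear_fst bounded_linear_snd bounded_linear_zero)+
  have "quad_small (\<lambda>z. r ((fst z, 0), (0, snd z)) + - r ((0, 0), (0, snd z)))"
    by (intro quad_small_add quad_small_linear[OF bounded_linear_minus[OF bounded_linear_ident]]
        quad_small_compose[OF r] lin_bound_linear bl)
  moreover have "r ((fst z, 0), (0, snd z)) + - r ((0, 0), (0, snd z))
     = f (fst z) (snd z) - f (fst z) 0 - f 0 (snd z) + f 0 0 - mixed_deriv f (fst z) (snd z)" for z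
    unfolding r_def mixed_eq by (simp add: Q.zero_left[unfolded zero_prod_def] algebra_simps)
  ultimately show ?thesis by simp
qed

text \<open>The values of \<open>f\<close> on the two axes and the mixed derivative determine the jet.\<close>

lemma jet2_binary_mixed_deriv:
  assumes A: "bounded_linear A" "\<forall>\<^sub>F u in nhds 0. f u 0 = A u"
    and C: "bounded_linear C" "\<forall>\<^sub>F v in nhds 0. f 0 v = C v"
  shows "jet2_binary f A C (mixed_deriv f)"
  unfolding jet2_def
proof (intro conjI)
  show "bounded_linear (\<lambda>p. A (fst p) + C (snd p))"
    by (intro bounded_linear_add bounded_linear_compose[OF A(1)] bounded_linear_compose[OF C(1)]
        bounded_linear_fst bounded_linear_snd)
  show "bounded_bilinear (\<lambda>p q. mixed_deriv f (fst p) (snd q))"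
    by (intro bounded_bilinear.comp[OF bounded_bilinear_mixed_deriv] bounded_linear_fst bounded_linear_snd)
  have 0: "f 0 0 = 0"
    using eventually_nhds_x_imp_x[OF A(2)] linear_0[OF bounded_linear.linear[OF A(1)]] by simp
  have l: "filterlim fst (nhds 0) (nhds (0::'e \<times> 'f))" "filterlim snd (nhds 0) (nhds (0::'e \<times> 'f))"
    using lin_bound_tendsto lin_bound_linear bounded_linear_fst bounded_linear_snd by blast+
  have "\<forall>\<^sub>F z::'e \<times> 'f in nhds 0. f (fst z) 0 = A (fst z)"
    "\<forall>\<^sub>F z::'e \<times> 'f in nhds 0. f 0 (snd z) = C (snd z)"
    by (rule eventually_compose_filterlim[OF A(2) l(1)] eventually_compose_filterlim[OF C(2) l(2)])+
  then have "\<forall>\<^sub>F z in nhds 0. f (fst z) (snd z) - f (fst z) 0 - f 0 (snd z) + f 0 0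
      - mixed_deriv f (fst z) (snd z)
    = f (fst z) (snd z) - (A (fst z) + C (snd z)) - mixed_deriv f (fst z) (snd z)"
    by eventually_elim (simp add: 0)
  then show "quad_small (\<lambda>z. f (fst z) (snd z) - (A (fst z) + C (snd z)) - mixed_deriv f (fst z) (snd z))"
    by (rule quad_small_cong[OF mixed_deriv_quad_small])
qed

text \<open>The quadratic part is only claimed to exist: its contributions cancel on antisymmetrising.\<close>

lemma jet2_partial_deriv:
  obtains S where "jet2 (\<lambda>u. fd (f u) 0 z - fd (f 0) 0 z) (\<lambda>u. mixed_deriv f u z) S"
proof -
  let ?D = "\<lambda>p. fd F p (0, z)"
  have t: "jet2 (\<lambda>h. ?D ((0, 0) + h) - ?D (0, 0)) (fd ?D (0, 0)) (\<lambda>h k. (1/2) *\<^sub>R second_deriv ?D (0, 0) h k)"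
    by (rule jet2_taylor[OF fin smooth_near_deriv[OF smF]])
  have "bounded_linear (\<lambda>u::'e. (u, 0::'f))"
    by (intro bounded_linear_Pair bounded_linear_ident bounded_linear_zero)
  from jet2_compose[OF jet2_linear[OF this] t]
  have j: "jet2 (\<lambda>u. ?D ((0, 0) + (u, 0)) - ?D (0, 0)) (\<lambda>u. fd ?D (0, 0) (u, 0))
    (\<lambda>h k. fd ?D (0, 0) 0 + (1/2) *\<^sub>R second_deriv ?D (0, 0) (h, 0) (k, 0))" .
  have 0: "fd (f 0) 0 z = ?D (0, 0)" using eventually_nhds_x_imp_x[OF fd_right] by simp
  have "\<forall>\<^sub>F u in nhds 0. ?D ((0, 0) + (u, 0)) - ?D (0, 0) = fd (f u) 0 z - fd (f 0) 0 z"
    using fd_right by eventually_elim (simp add: 0)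
  from jet2_cong[OF j this]
  show ?thesis using that unfolding mixed_eq second_deriv_def by blast
qed

end

section \<open>Charts\<close>

lemma Ck_on_cong_subset:
  assumes "Ck_on k S f" "T \<subseteq> S" "open T" "\<And>x. x \<in> T \<Longrightarrow> f x = g x"
  shows "Ck_on k T g"
  using assms(1,4)
proof (induction k arbitrary: f g)
  case 0
  then have "continuous_on S f" by simp
  from continuous_on_subset[OF this assms(2)] have "continuous_on T g"
    by (rule continuous_on_eq) (rule 0)
  then show ?case by simp
next
  case (Suc k)
  have d: "f differentiable (at x)" if "x \<in> T" for x
  proof -
    have "\<forall>x\<in>S. f differentiable (at x)" by (rule Suc.prems(1)[unfolded Ck_on.simps, THEN conjunct1])
    then show ?thesis using that assms(2) by blast
  qed
  have "g differentiable (at x)" if x: "x \<in> T" for x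
  proof -
    obtain D where D: "(f has_derivative D) (at x)" using d[OF x] unfolding differentiable_def ..
    have "(g has_derivative D) (at x)"
      by (rule has_derivative_transform_within_open[OF D assms(3) x]) (rule Suc.prems(2))
    then show ?thesis by (rule differentiableI)
  qed
  moreover have "Ck_on k T (\<lambda>x. fd g x v)" for v
  proof (rule Suc.IH)
    show "Ck_on k S (\<lambda>x. fd f x v)" by (rule Suc.prems(1)[unfolded Ck_on.simps, THEN conjunct2, rule_format])
    show "fd f x v = fd g x v" if "x \<in> T" for x
      by (rule fun_cong[OF frechet_derivative_transform_within_open[OF d[OF that] assms(3) that]])
        (rule Suc.prems(2))
  qed
  ultimately show ?case by simp
qed

lemma smooth_nearI: "open S \<Longrightarrow> p \<in> S \<Longrightarrow> smooth_on S f \<Longrightarrow> smooth_near p f"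
  unfolding smooth_near_def by (rule exI[of _ S]) simp

lemma smooth_near_cong:
  assumes "smooth_near p f" "\<forall>\<^sub>F x in nhds p. f x = g x"
  shows "smooth_near p g"
proof -
  obtain S where S: "open S" "p \<in> S" "smooth_on S f" using assms(1) unfolding smooth_near_def by blast
  obtain T where T: "open T" "p \<in> T" "\<And>x. x \<in> T \<Longrightarrow> f x = g x"
    using assms(2) unfolding eventually_nhds by blast
  have "smooth_on (S \<inter> T) g" unfolding smooth_on_def
  proof
    fix k
    show "Ck_on k (S \<inter> T) g"
    proof (rule Ck_on_cong_subset)
      show "Ck_on k S f" using S(3) unfolding smooth_on_def by simp
      show "open (S \<inter> T)" using S T by blast
    qed (use T in auto)
  qed
  then show ?thesis by (rule smooth_nearI[OF open_Int[OF S(1) T(1)] IntI[OF S(2) T(2)]])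
qed

definition chart_on :: "'a topology \<Rightarrow> ('a, 'e::real_normed_vector) chart \<Rightarrow> bool" where
  "chart_on X c \<longleftrightarrow> openin X (fst c) \<and> open (snd c ` fst c) \<and>
     homeomorphic_map (subtopology X (fst c)) (top_of_set (snd c ` fst c)) (snd c)"

lemma chart_on_inj:
  assumes "chart_on X c" shows "inj_on (snd c) (fst c)"
proof -
  have "fst c \<subseteq> topspace X" using assms openin_subset unfolding chart_on_def by blast
  then have "topspace (subtopology X (fst c)) = fst c" by auto
  then show ?thesis
    using homeomorphic_imp_injective_map[of "subtopology X (fst c)"] assms unfolding chart_on_def by metis
qed

lemma chart_inv_left: "chart_on X c \<Longrightarrow> p \<in> fst c \<Longrightarrow> chart_inv c (snd c p) = p"
  by (rule inv_into_f_f[OF chart_on_inj])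

lemma open_chart_image:
  assumes c: "chart_on X c" and U: "openin X U" "U \<subseteq> fst c"
  shows "open (snd c ` U)"
proof -
  have "openin (subtopology X (fst c)) U" using U by (auto simp: openin_subtopology)
  then have "openin (top_of_set (snd c ` fst c)) (snd c ` U)"
    using c homeomorphic_imp_open_map unfolding chart_on_def open_map_def by blast
  then show ?thesis using openin_open_trans c unfolding chart_on_def by blast
qed

lemma chart_on_prod:
  assumes c: "chart_on X c" and d: "chart_on Y d"
  shows "chart_on (prod_topology X Y) (fst c \<times> fst d, map_prod (snd c) (snd d))"
proof -
  obtain c' where c': "homeomorphic_maps (subtopology X (fst c)) (top_of_set (snd c ` fst c)) (snd c) c'"
    using c unfolding chart_on_def homeomorphic_map_maps by blast
  obtain d' where d': "homeomorphic_maps (subtopology Y (fst d)) (top_of_set (snd d ` fst d)) (snd d) d'"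
    using d unfolding chart_on_def homeomorphic_map_maps by blast
  have im: "map_prod (snd c) (snd d) ` (fst c \<times> fst d) = (snd c ` fst c) \<times> (snd d ` fst d)"
    by (rule map_prod_image) 
  have "homeomorphic_maps (prod_topology (subtopology X (fst c)) (subtopology Y (fst d)))
     (prod_topology (top_of_set (snd c ` fst c)) (top_of_set (snd d ` fst d)))
     (\<lambda>(x, y). (snd c x, snd d y)) (\<lambda>(x, y). (c' x, d' y))"
    unfolding homeomorphic_maps_prod using c' d' by blast
  then have "homeomorphic_maps (subtopology (prod_topology X Y) (fst c \<times> fst d))
     (top_of_set ((snd c ` fst c) \<times> (snd d ` fst d))) (map_prod (snd c) (snd d)) (\<lambda>(x, y). (c' x, d' y))"
    unfolding subtopology_Times prod_topology_subtopology_eu map_prod_def .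
  then have "homeomorphic_map (subtopology (prod_topology X Y) (fst c \<times> fst d))
     (top_of_set ((snd c ` fst c) \<times> (snd d ` fst d))) (map_prod (snd c) (snd d))"
    unfolding homeomorphic_maps_map by blast
  moreover have "openin (prod_topology X Y) (fst c \<times> fst d)"
    using c d unfolding chart_on_def openin_prod_Times_iff by blast
  moreover have "open ((snd c ` fst c) \<times> (snd d ` fst d))"
    using c d unfolding chart_on_def by (intro open_Times) blast+
  ultimately show ?thesis unfolding chart_on_def fst_conv snd_conv im by blast
qed

lemma chart_inv_prod:
  assumes "chart_on X c" "chart_on Y d" "x \<in> snd c ` fst c" "y \<in> snd d ` fst d"
  shows "chart_inv (fst c \<times> fst d, map_prod (snd c) (snd d)) (x, y) = (chart_inv c x, chart_inv d y)"
proof -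
  obtain p q where p: "p \<in> fst c" "x = snd c p" and q: "q \<in> fst d" "y = snd d q" using assms by blast
  have "chart_inv (fst c \<times> fst d, map_prod (snd c) (snd d)) (map_prod (snd c) (snd d) (p, q)) = (p, q)"
    using chart_inv_left[OF chart_on_prod[OF assms(1,2)], of "(p, q)"] p q by simp
  then show ?thesis
    unfolding p(2) q(2) map_prod_simp chart_inv_left[OF assms(1) p(1)] chart_inv_left[OF assms(2) q(1)] .
qed

lemma (in smooth_manifold) chart_on_atlas: "c \<in> atlas M \<Longrightarrow> chart_on (mtop M) c"
  unfolding chart_on_def by (rule atlas_charts)

lemma smooth_map_local:
  assumes f: "smooth_map M N f" and c: "c \<in> atlas M" "chart_on (mtop M) c" "p \<in> fst c"
    and d: "d \<in> atlas N" "openin (mtop N) (fst d)" "f p \<in> fst d"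
  shows "smooth_near (snd c p) (\<lambda>x. snd d (f (chart_inv c x)))"
    and "\<forall>\<^sub>F x in nhds (snd c p). x \<in> snd c ` fst c \<and> f (chart_inv c x) \<in> fst d"
proof -
  let ?U = "fst c \<inter> f -` fst d"
  have "openin (mtop M) {x \<in> topspace (mtop M). f x \<in> fst d}"
    by (rule openin_continuous_map_preimage[OF f[unfolded smooth_map_def, THEN conjunct1] d(2)])
  moreover have o: "openin (mtop M) (fst c)" using c(2) unfolding chart_on_def by blast
  ultimately have "openin (mtop M) (fst c \<inter> {x \<in> topspace (mtop M). f x \<in> fst d})" by blast
  also have "fst c \<inter> {x \<in> topspace (mtop M). f x \<in> fst d} = ?U"
    using openin_subset[OF o] by auto
  finally have op: "open (snd c ` ?U)" by (intro open_chart_image[OF c(2)]) auto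
  have p: "snd c p \<in> snd c ` ?U" using c(3) d(3) by auto
  have "smooth_on (snd c ` ?U) (\<lambda>x. snd d (f (chart_inv c x)))"
    using f[unfolded smooth_map_def comp_def, THEN conjunct2] c(1) d(1) by blast
  then show "smooth_near (snd c p) (\<lambda>x. snd d (f (chart_inv c x)))"
    by (rule smooth_nearI[OF op p])
  have "x \<in> snd c ` fst c \<and> f (chart_inv c x) \<in> fst d" if "x \<in> snd c ` ?U" for x
    using that chart_inv_left[OF c(2)] by auto
  then show "\<forall>\<^sub>F x in nhds (snd c p). x \<in> snd c ` fst c \<and> f (chart_inv c x) \<in> fst d"
    unfolding eventually_nhds using op p by blast
qed

lemma atlas_prod: "atlas (prod_manifold M N) =
    {(fst c \<times> fst d, map_prod (snd c) (snd d)) | c d. c \<in> atlas M \<and> d \<in> atlas N}"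
  unfolding prod_manifold_def by (rule manifold.select_convs(2))

text \<open>The charts of a product manifold are products of charts, and \<open>inv_into\<close> of a product map is the
product of the inverses only on its image; hence the passage through \<open>smooth_near_cong\<close>.\<close>

lemma smooth_map_local2:
  assumes f: "smooth_map (prod_manifold M M') N (\<lambda>(a, b). f a b)"
    and c: "c \<in> atlas M" "chart_on (mtop M) c" "p \<in> fst c"
    and c': "c' \<in> atlas M'" "chart_on (mtop M') c'" "p' \<in> fst c'"
    and d: "d \<in> atlas N" "openin (mtop N) (fst d)" "f p p' \<in> fst d"
  shows "smooth_near (snd c p, snd c' p') (\<lambda>z. snd d (f (chart_inv c (fst z)) (chart_inv c' (snd z))))"
    and "\<forall>\<^sub>F z in nhds (snd c p, snd c' p'). fst z \<in> snd c ` fst c \<and> snd z \<in> snd c' ` fst c' \<and>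
      f (chart_inv c (fst z)) (chart_inv c' (snd z)) \<in> fst d"
proof -
  let ?C = "(fst c \<times> fst c', map_prod (snd c) (snd c'))"
  have C: "?C \<in> atlas (prod_manifold M M')"
    unfolding atlas_prod
    by (rule CollectI, rule exI[of _ c], rule exI[of _ c'], rule conjI[OF refl conjI[OF c(1) c'(1)]])
  have C': "chart_on (mtop (prod_manifold M M')) ?C"
    using chart_on_prod[OF c(2) c'(2)] by (simp add: prod_manifold_def)
  have pp: "(p, p') \<in> fst ?C" using c(3) c'(3) by simp
  have dd: "(\<lambda>(a, b). f a b) (p, p') \<in> fst d" using d(3) by simp
  note loc = smooth_map_local[OF f C C' pp d(1,2) dd, unfolded snd_conv map_prod_simp fst_conv]
  have inv: "chart_inv ?C z = (chart_inv c (fst z), chart_inv c' (snd z))"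
    if "z \<in> map_prod (snd c) (snd c') ` (fst c \<times> fst c')" for z
  proof -
    have "fst z \<in> snd c ` fst c" "snd z \<in> snd c' ` fst c'" using that by auto
    from chart_inv_prod[OF c(2) c'(2) this] show ?thesis by simp
  qed
  have ev: "\<forall>\<^sub>F z in nhds (snd c p, snd c' p').
      (case chart_inv ?C z of (a, b) \<Rightarrow> f a b) = f (chart_inv c (fst z)) (chart_inv c' (snd z))"
    using loc(2)
  proof eventually_elim
    case (elim z)
    show ?case unfolding inv[OF conjunct1[OF elim]] by simp
  qed
  from loc(2) ev show "\<forall>\<^sub>F z in nhds (snd c p, snd c' p'). fst z \<in> snd c ` fst c \<and> snd z \<in> snd c' ` fst c' \<and>
      f (chart_inv c (fst z)) (chart_inv c' (snd z)) \<in> fst d"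
  proof eventually_elim
    case (elim z)
    then show ?case by auto
  qed
  show "smooth_near (snd c p, snd c' p') (\<lambda>z. snd d (f (chart_inv c (fst z)) (chart_inv c' (snd z))))"
  proof (rule smooth_near_cong)
    show "smooth_near (snd c p, snd c' p') (\<lambda>z. snd d (case chart_inv ?C z of (a, b) \<Rightarrow> f a b))"
      using loc(1) by simp
    show "\<forall>\<^sub>F z in nhds (snd c p, snd c' p'). snd d (case chart_inv ?C z of (a, b) \<Rightarrow> f a b)
        = snd d (f (chart_inv c (fst z)) (chart_inv c' (snd z)))"
      using ev by eventually_elim simp
  qed
qed

text \<open>Coordinates translated so that \<open>p\<close> is at the origin. Their inverse \<open>point\<close> is meaningful near 0 only,
so statements about it hold eventually in \<open>nhds 0\<close>.\<close>

definition coord :: "('a, 'e::real_normed_vector) chart \<Rightarrow> 'a \<Rightarrow> 'a \<Rightarrow> 'e" where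
  "coord c p g = snd c g - snd c p"

definition point :: "('a, 'e::real_normed_vector) chart \<Rightarrow> 'a \<Rightarrow> 'e \<Rightarrow> 'a" where
  "point c p u = chart_inv c (snd c p + u)"

lemma coord_self [simp]: "coord c p p = 0"
  by (simp add: coord_def)

lemma point_coord: "chart_on X c \<Longrightarrow> g \<in> fst c \<Longrightarrow> point c p (coord c p g) = g"
  by (simp add: point_def coord_def chart_inv_left)

lemma point_0: "chart_on X c \<Longrightarrow> p \<in> fst c \<Longrightarrow> point c p 0 = p"
  by (simp add: point_def chart_inv_left)

lemma eventually_point:
  assumes c: "chart_on X c" "p \<in> fst c"
  shows "\<forall>\<^sub>F u in nhds 0. point c p u \<in> fst c \<and> coord c p (point c p u) = u"
proof -
  have "\<forall>\<^sub>F x in nhds (snd c p). x \<in> snd c ` fst c"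
    using c unfolding chart_on_def by (intro eventually_nhds_in_open) auto
  then have "\<forall>\<^sub>F u in nhds 0. snd c p + u \<in> snd c ` fst c"
    unfolding eventually_nhds_shift[where p="snd c p"] .
  then show ?thesis
  proof eventually_elim
    case (elim u)
    then obtain g where "g \<in> fst c" "snd c p + u = snd c g" by blast
    then have "point c p u = g" by (simp add: point_def chart_inv_left[OF c(1)])
    moreover have "coord c p g = u"
      using \<open>snd c p + u = snd c g\<close>[symmetric] by (simp add: coord_def)
    ultimately show ?case using \<open>g \<in> fst c\<close> by simp
  qed
qed

lemma smooth_map_centred:
  assumes f: "smooth_map M N f" and c: "c \<in> atlas M" "chart_on (mtop M) c" "p \<in> fst c"
    and d: "d \<in> atlas N" "openin (mtop N) (fst d)" "f p \<in> fst d"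
  shows "smooth_near 0 (\<lambda>u. coord d (f p) (f (point c p u)))"
    and "\<forall>\<^sub>F u in nhds 0. f (point c p u) \<in> fst d"
proof -
  note loc = smooth_map_local[OF assms]
  show "smooth_near 0 (\<lambda>u. coord d (f p) (f (point c p u)))"
    using smooth_near_shift[OF loc(1)] unfolding coord_def point_def .
  have "\<forall>\<^sub>F u in nhds 0. snd c p + u \<in> snd c ` fst c \<and> f (chart_inv c (snd c p + u)) \<in> fst d"
    using loc(2) unfolding eventually_nhds_shift[where p="snd c p"] .
  then show "\<forall>\<^sub>F u in nhds 0. f (point c p u) \<in> fst d"
    unfolding point_def by eventually_elim simp
qed

lemma smooth_map_centred2:
  assumes f: "smooth_map (prod_manifold M M') N (\<lambda>(a, b). f a b)"
    and c: "c \<in> atlas M" "chart_on (mtop M) c" "p \<in> fst c"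
    and c': "c' \<in> atlas M'" "chart_on (mtop M') c'" "p' \<in> fst c'"
    and d: "d \<in> atlas N" "openin (mtop N) (fst d)" "f p p' \<in> fst d"
  shows "smooth2_near_0 (\<lambda>u v. coord d (f p p') (f (point c p u) (point c' p' v)))"
    and "\<forall>\<^sub>F z in nhds (0, 0). f (point c p (fst z)) (point c' p' (snd z)) \<in> fst d"
proof -
  note loc = smooth_map_local2[OF assms]
  show "smooth2_near_0 (\<lambda>u v. coord d (f p p') (f (point c p u) (point c' p' v)))"
    using smooth_near_shift[OF loc(1)] unfolding smooth2_near_0_def coord_def point_def zero_prod_def by simp
  have "\<forall>\<^sub>F h in nhds 0. f (chart_inv c (fst ((snd c p, snd c' p') + h))) (chart_inv c' (snd ((snd c p, snd c' p') + h))) \<in> fst d"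
    using loc(2) unfolding eventually_nhds_shift[where p="(snd c p, snd c' p')"]
    by eventually_elim simp
  then show "\<forall>\<^sub>F z in nhds (0, 0). f (point c p (fst z)) (point c' p' (snd z)) \<in> fst d"
    unfolding point_def zero_prod_def by eventually_elim simp
qed

lemma eventually_nhds_Pair:
  assumes "\<forall>\<^sub>F z in nhds (a, b). P z"
  shows "\<forall>\<^sub>F x in nhds a. \<forall>\<^sub>F y in nhds b. P (x, y)"
proof -
  obtain S where S: "open S" "(a, b) \<in> S" "\<And>z. z \<in> S \<Longrightarrow> P z" using assms unfolding eventually_nhds by blast
  obtain A B where AB: "open A" "open B" "a \<in> A" "b \<in> B" "A \<times> B \<subseteq> S"
    using S(1,2) by (auto elim: open_prod_elim)
  have "\<forall>\<^sub>F y in nhds b. P (x, y)" if "x \<in> A" for x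
    using AB S(3) that unfolding eventually_nhds by blast
  then show ?thesis unfolding eventually_nhds[of _ a] using AB by blast
qed

section \<open>Jets of slices, homomorphisms and actions\<close>

lemma jet2_slice_right:
  fixes f :: "'e::real_normed_vector \<Rightarrow> 'f::real_normed_vector \<Rightarrow> 'g::real_normed_vector"
  assumes "finite_dim TYPE('e)" "finite_dim TYPE('f)" "smooth_near (u, v) (\<lambda>p. f (fst p) (snd p))"
  shows "\<exists>L Q. jet2 (\<lambda>y. f u (v + y) - f u v) L Q"
proof -
  have "bounded_linear (\<lambda>y::'f. (0::'e, y))"
    by (intro bounded_linear_Pair bounded_linear_ident bounded_linear_zero)
  from jet2_compose[OF jet2_linear[OF this] jet2_taylor[OF finite_dim_prod[OF assms(1,2)] assms(3)]]
  have "\<exists>L Q. jet2 (\<lambda>y. f (fst ((u, v) + (0, y))) (snd ((u, v) + (0, y))) - f (fst (u, v)) (snd (u, v))) L Q"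
    by blast
  then show ?thesis by simp
qed

lemma jet2_slice_left:
  fixes f :: "'e::real_normed_vector \<Rightarrow> 'f::real_normed_vector \<Rightarrow> 'g::real_normed_vector"
  assumes "finite_dim TYPE('e)" "finite_dim TYPE('f)" "smooth_near (u, v) (\<lambda>p. f (fst p) (snd p))"
  shows "\<exists>L Q. jet2 (\<lambda>x. f (u + x) v - f u v) L Q"
proof -
  have "bounded_linear (\<lambda>x::'e. (x, 0::'f))"
    by (intro bounded_linear_Pair bounded_linear_ident bounded_linear_zero)
  from jet2_compose[OF jet2_linear[OF this] jet2_taylor[OF finite_dim_prod[OF assms(1,2)] assms(3)]]
  have "\<exists>L Q. jet2 (\<lambda>x. f (fst ((u, v) + (x, 0))) (snd ((u, v) + (x, 0))) - f (fst (u, v)) (snd (u, v))) L Q"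
    by blast
  then show ?thesis by simp
qed

text \<open>The quadratic parts of \<open>h (m x y) = m' (h x) (h y)\<close> are \<open>L (B x y) + Q (x + y) (x + y)\<close> and
\<open>Q x x + Q y y + B' (L x) (L y)\<close>; the terms with \<open>Q\<close> are symmetric in \<open>x\<close> and \<open>y\<close>, so they cancel in the
commutator.\<close>

lemma jet_hom_commutator:
  fixes L :: "'e::real_normed_vector \<Rightarrow> 'f::real_normed_vector"
  assumes m: "jet2_binary m (\<lambda>x. x) (\<lambda>x. x) B" and m': "jet2_binary m' (\<lambda>x. x) (\<lambda>x. x) B'"
    and h: "jet2 h L Q"
    and hom: "\<forall>\<^sub>F z in nhds 0. h (m (fst z) (snd z)) = m' (h (fst z)) (h (snd z))"
  shows "L (B x y - B y x) = B' (L x) (L y) - B' (L y) (L x)"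
proof -
  interpret L: bounded_linear L by (rule jet2D(1)[OF h])
  interpret Q: bounded_bilinear Q by (rule jet2D(2)[OF h])
  have 1: "jet2 (\<lambda>z. h (m (fst z) (snd z))) (\<lambda>z. L (fst z + snd z))
    (\<lambda>p q. L (B (fst p) (snd q)) + Q (fst p + snd p) (fst q + snd q))"
    by (rule jet2_compose[OF m h])
  have 2: "jet2 (\<lambda>z. m' (h (fst z)) (h (snd z))) (\<lambda>z. L (fst z) + L (snd z))
    (\<lambda>p q. (L 0 + Q (fst p) (fst q)) + (L 0 + Q (snd p) (snd q)) + B' (L (fst p)) (L (snd q)))"
    by (rule jet2_binary_compose[OF m' jet2_compose[OF jet2_linear[OF bounded_linear_fst] h]
          jet2_compose[OF jet2_linear[OF bounded_linear_snd] h]])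
  have q: "L (B x y) + Q (x + y) (x + y) = Q x x + Q y y + B' (L x) (L y)" for x y
    using jet2_unique(2)[OF jet2_cong[OF 1 hom] 2, of "(x, y)"] by (simp add: L.zero)
  have "L (B x y) - L (B y x) = (L (B x y) + Q (x + y) (x + y)) - (L (B y x) + Q (y + x) (y + x))"
    by (simp add: add.commute[of y x])
  also have "\<dots> = B' (L x) (L y) - B' (L y) (L x)" unfolding q by simp
  finally show ?thesis by (simp add: L.diff)
qed

text \<open>Differentiate \<open>A u [y, z] = [A u y, A u z]\<close> in \<open>u\<close>.\<close>

lemma bracket_derivation:
  assumes br: "bounded_bilinear br"
    and d: "\<And>z. ((\<lambda>u. A u z) has_derivative (\<lambda>x. D x z)) (at 0)"
    and 0: "\<And>z. A 0 z = z"
    and hom: "\<forall>\<^sub>F u in nhds 0. A u (br y z) = br (A u y) (A u z)"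
  shows "D x (br y z) = br (D x y) z + br y (D x z)"
proof -
  have "((\<lambda>u. br (A u y) (A u z)) has_derivative (\<lambda>x. br (A 0 y) (D x z) + br (D x y) (A 0 z))) (at 0)"
    by (rule bounded_bilinear.FDERIV[OF br d d])
  from has_derivative_unique[OF this has_derivative_eventually_cong[OF d hom]]
  show ?thesis unfolding 0 by (metis add.commute)
qed

lemma lin_smallI_quadratic:
  assumes "\<forall>\<^sub>F h in nhds 0. norm (f h) \<le> C * (norm h)\<^sup>2"
  shows "lin_small f"
  unfolding lin_small_def
proof (intro allI impI)
  fix e :: real assume "e > 0"
  then have "e / (\<bar>C\<bar> + 1) > 0" by simp
  then have "\<forall>\<^sub>F h in nhds (0::'a). norm h < e / (\<bar>C\<bar> + 1)"
    unfolding eventually_nhds_metric by auto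
  then show "\<forall>\<^sub>F h in nhds 0. norm (f h) \<le> e * norm h"
    using assms
  proof eventually_elim
    case (elim h)
    have "norm (f h) \<le> C * (norm h)\<^sup>2" by (rule elim(2))
    also have "\<dots> \<le> (\<bar>C\<bar> + 1) * (norm h)\<^sup>2" by (intro mult_right_mono) auto
    also have "\<dots> = (\<bar>C\<bar> + 1) * norm h * norm h" by (simp only: power2_eq_square mult.assoc)
    also have "\<dots> \<le> e * norm h"
      using elim(1) by (intro mult_right_mono) (simp_all add: pos_less_divide_eq mult.commute)
    finally show ?case .
  qed
qed

lemma lin_smallI_uniform:
  assumes "\<And>e. e > 0 \<Longrightarrow> \<forall>\<^sub>F u in nhds 0. \<forall>y. norm (f u y) \<le> e * norm u * norm y"
  shows "lin_small (\<lambda>u. f u y)"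
  unfolding lin_small_def
proof (intro allI impI)
  fix e :: real assume e: "e > 0"
  have n: "norm y + 1 > 0" by (simp add: add_nonneg_pos)
  then have "e / (norm y + 1) > 0" using e by simp
  from assms[OF this] show "\<forall>\<^sub>F u in nhds 0. norm (f u y) \<le> e * norm u"
  proof eventually_elim
    case (elim u)
    have "norm (f u y) \<le> e / (norm y + 1) * norm u * norm y" using elim by blast
    also have "\<dots> \<le> e / (norm y + 1) * norm u * (norm y + 1)" using e by (intro mult_left_mono) auto
    also have "\<dots> = e * norm u" using n by simp
    finally show ?case .
  qed
qed

lemma lin_small_diff:
  assumes "lin_small f" "lin_small g" shows "lin_small (\<lambda>h. f h - g h)"
proof -
  have "lin_small (\<lambda>h. - g h)" using assms(2) unfolding lin_small_def by simp
  from lin_small_add[OF assms(1) this] show ?thesis by simp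
qed

lemma has_derivative_iff_lin_small:
  "(f has_derivative D) (at 0) \<longleftrightarrow> bounded_linear D \<and> lin_small (\<lambda>h. f h - f 0 - D h)"
proof -
  have "(\<forall>\<^sub>F y in at 0. norm (f y - f 0 - D (y - 0)) \<le> e * norm (y - 0)) \<longleftrightarrow>
      (\<forall>\<^sub>F h in nhds 0. norm (f h - f 0 - D h) \<le> e * norm h)" if D: "bounded_linear D" for e
  proof -
    have "D 0 = 0" using linear_0[OF bounded_linear.linear[OF D]] .
    then have "(y \<noteq> 0 \<longrightarrow> norm (f y - f 0 - D (y - 0)) \<le> e * norm (y - 0)) \<longleftrightarrow>
        norm (f y - f 0 - D y) \<le> e * norm y" for y
      by (cases "y = 0") simp_all
    then show ?thesis unfolding eventually_at_filter by simp
  qed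
  then show ?thesis unfolding has_derivative_within_alt2 lin_small_def by blast
qed

section \<open>A Lie group in a chart around the identity\<close>

locale lie_group_chart = lie_group G M
  for G :: "('a, 'm) monoid_scheme" (structure)
    and M :: "('a, 'e::{real_normed_vector, heine_borel}) manifold" +
  fixes c :: "('a, 'e) chart"
  assumes c_at: "c \<in> charts_at M \<one>"
begin

text \<open>\<open>J\<close> reads group elements in coordinates with the identity at the origin, and \<open>K\<close> goes back.\<close>

abbreviation J :: "'a \<Rightarrow> 'e" where "J \<equiv> coord c \<one>"
abbreviation K :: "'e \<Rightarrow> 'a" where "K \<equiv> point c \<one>"

definition mul :: "'e \<Rightarrow> 'e \<Rightarrow> 'e" where "mul u v = J (K u \<otimes> K v)"

text \<open>The second-order part of the multiplication, \<open>mul u v = u + v + B u v + o(2)\<close>.\<close>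

definition B :: "'e \<Rightarrow> 'e \<Rightarrow> 'e" where "B = mixed_deriv mul"

lemma c_atlas: "c \<in> atlas M" and one_in_c: "\<one> \<in> fst c"
  using c_at unfolding charts_at_def by auto

lemma c_chart: "chart_on (mtop M) c"
  by (rule chart_on_atlas[OF c_atlas])

lemma c_open: "openin (mtop M) (fst c)"
  using c_chart unfolding chart_on_def by blast

lemma c_carrier: "g \<in> fst c \<Longrightarrow> g \<in> carrier G"
  using openin_subset[OF c_open] carrier_eq by blast

lemma fin: "finite_dim TYPE('e)"
  using finite_dimensional unfolding finite_dim_def .

lemma K_J: "g \<in> fst c \<Longrightarrow> K (J g) = g"
  by (rule point_coord[OF c_chart])

lemma K_0: "K 0 = \<one>"
  by (rule point_0[OF c_chart one_in_c])

lemma ev_K: "\<forall>\<^sub>F u in nhds 0. K u \<in> fst c \<and> J (K u) = u"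
  by (rule eventually_point[OF c_chart one_in_c])

lemma smooth2_op:
  assumes "smooth_map (prod_manifold M M) M (\<lambda>(a, b). f a b)" "f \<one> \<one> = \<one>"
  shows "smooth2_near_0 (\<lambda>u v. J (f (K u) (K v)))"
    and "\<forall>\<^sub>F z in nhds (0, 0). f (K (fst z)) (K (snd z)) \<in> fst c"
proof -
  have "f \<one> \<one> \<in> fst c" unfolding assms(2) by (rule one_in_c)
  note s = smooth_map_centred2[OF assms(1) c_atlas c_chart one_in_c c_atlas c_chart one_in_c
      c_atlas c_open this]
  show "smooth2_near_0 (\<lambda>u v. J (f (K u) (K v)))" using s(1) unfolding assms(2) .
  show "\<forall>\<^sub>F z in nhds (0, 0). f (K (fst z)) (K (snd z)) \<in> fst c" by (rule s(2))
qed

lemma mul_smooth: "smooth2_near_0 mul"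
  and ev_mul: "\<forall>\<^sub>F z in nhds (0, 0). K (fst z) \<otimes> K (snd z) \<in> fst c"
proof -
  have "\<one> \<otimes> \<one> = \<one>" by simp
  from smooth2_op[OF smooth_mult this]
  show "smooth2_near_0 mul" "\<forall>\<^sub>F z in nhds (0, 0). K (fst z) \<otimes> K (snd z) \<in> fst c"
    unfolding mul_def[abs_def] .
qed

lemma mul_0_right: "\<forall>\<^sub>F u in nhds 0. mul u 0 = u"
  using ev_K by eventually_elim (simp add: mul_def K_0 c_carrier)

lemma mul_0_left: "\<forall>\<^sub>F u in nhds 0. mul 0 u = u"
  using ev_K by eventually_elim (simp add: mul_def K_0 c_carrier)

lemma jet_mul: "jet2_binary mul (\<lambda>u. u) (\<lambda>v. v) B"
  unfolding B_def
  by (rule jet2_binary_mixed_deriv[OF fin fin mul_smooth bounded_linear_ident mul_0_right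
        bounded_linear_ident mul_0_left])

lemma B_bilinear: "bounded_bilinear B"
  unfolding B_def by (rule bounded_bilinear_mixed_deriv[OF fin fin mul_smooth])

lemma fd_mul_0: "fd (mul 0) 0 = (\<lambda>y. y)"
  by (rule frechet_derivative_at[symmetric], rule has_derivative_eventually_cong[OF has_derivative_ident])
    (use mul_0_left in eventually_elim, simp)

lemma fd_mul_0': "fd (\<lambda>u. mul u 0) 0 = (\<lambda>y. y)"
  by (rule frechet_derivative_at[symmetric], rule has_derivative_eventually_cong[OF has_derivative_ident])
    (use mul_0_right in eventually_elim, simp)

lemma left_inv_field_eq: "left_inv_field G c x (snd c \<one> + h) = fd (mul h) 0 x"
proof -
  have "fd (mul h) 0 = fd (\<lambda>v. snd c (chart_inv c (snd c \<one> + h) \<otimes> chart_inv c v)) (snd c \<one> + 0)"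
    unfolding mul_def[abs_def] coord_def point_def by (rule frechet_derivative_shift)
  then show ?thesis unfolding left_inv_field_def by simp
qed

text \<open>In the chart the left-invariant field of \<open>x\<close> is \<open>u \<mapsto> fd (mul u) 0 x\<close>, with value \<open>x\<close> and derivative
\<open>h \<mapsto> B h x\<close> at the origin.\<close>

lemma lie_bracket_eq: "lie_bracket G c x y = B x y - B y x"
proof -
  have d: "fd (left_inv_field G c y) (snd c \<one>) x = B x y" for x y
  proof -
    have "fd (\<lambda>h. left_inv_field G c y (snd c \<one> + h) - 0) 0 = fd (left_inv_field G c y) (snd c \<one> + 0)"
      by (rule frechet_derivative_shift)
    then show ?thesis by (simp add: left_inv_field_eq B_def mixed_deriv_def)
  qed
  have "left_inv_field G c x (snd c \<one>) = x" for x
    using left_inv_field_eq[of x 0] by (simp add: fd_mul_0)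
  then show ?thesis unfolding lie_bracket_def field_commutator_def d by simp
qed

lemma bracket_bilinear: "bounded_bilinear (lie_bracket G c)"
proof -
  have "bounded_bilinear (\<lambda>x y. B x y + - B y x)"
    by (intro bounded_bilinear_add B_bilinear bounded_linear_bilinear_compose[of uminus]
        bounded_linear_minus[OF bounded_linear_ident] bounded_bilinear.flip[OF B_bilinear])
  moreover have "lie_bracket G c = (\<lambda>x y. B x y + - B y x)" by (intro ext) (simp add: lie_bracket_eq)
  ultimately show ?thesis by simp
qed

end

text \<open>Smoothness enters only as a second-order expansion at the identity. This applies to a single
conjugation too, whose expansion is at hand only for elements close to the identity.\<close>

lemma hom_preserves_bracket:
  fixes G :: "('a, 'm) monoid_scheme"
    and M :: "('a, 'e::{real_normed_vector, heine_borel}) manifold"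
    and H :: "('b, 'n) monoid_scheme"
    and N :: "('b, 'f::{real_normed_vector, heine_borel}) manifold"
  assumes G: "lie_group_chart G M c" and H: "lie_group_chart H N d"
    and f: "f \<in> hom G H"
    and dom: "\<forall>\<^sub>F u in nhds 0. f (point c \<one>\<^bsub>G\<^esub> u) \<in> fst d"
    and jet: "jet2 (\<lambda>u. coord d \<one>\<^bsub>H\<^esub> (f (point c \<one>\<^bsub>G\<^esub> u))) L Q"
  shows "L (lie_bracket G c x y) = lie_bracket H d (L x) (L y)"
proof -
  interpret G: lie_group_chart G M c by (rule G)
  interpret H: lie_group_chart H N d by (rule H)
  have l: "filterlim fst (nhds 0) (nhds (0::'e \<times> 'e))" "filterlim snd (nhds 0) (nhds (0::'e \<times> 'e))"
    by (intro lin_bound_tendsto lin_bound_linear bounded_linear_fst bounded_linear_snd)+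
  note ev = eventually_compose_filterlim[OF eventually_conj[OF dom G.ev_K] l(1)]
    eventually_compose_filterlim[OF eventually_conj[OF dom G.ev_K] l(2)]
  have "\<forall>\<^sub>F z in nhds 0. coord d \<one>\<^bsub>H\<^esub> (f (point c \<one>\<^bsub>G\<^esub> (G.mul (fst z) (snd z))))
      = H.mul (coord d \<one>\<^bsub>H\<^esub> (f (point c \<one>\<^bsub>G\<^esub> (fst z)))) (coord d \<one>\<^bsub>H\<^esub> (f (point c \<one>\<^bsub>G\<^esub> (snd z))))"
    using ev G.ev_mul[folded zero_prod_def]
  proof eventually_elim
    case (elim z)
    have "f (G.K (fst z) \<otimes>\<^bsub>G\<^esub> G.K (snd z)) = f (G.K (fst z)) \<otimes>\<^bsub>H\<^esub> f (G.K (snd z))"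
      using elim by (intro hom_mult[OF f] G.c_carrier) blast+
    then show ?case
      using elim unfolding G.mul_def H.mul_def by (simp add: G.K_J H.K_J)
  qed
  from jet_hom_commutator[OF G.jet_mul H.jet_mul jet this]
  show ?thesis unfolding G.lie_bracket_eq H.lie_bracket_eq .
qed

context lie_group_chart
begin

text \<open>The tangent map of each \<open>f a\<close> preserves the bracket, and it is the identity at \<open>a = \<one>\<close>.\<close>

lemma automorphism_action_derivation:
  assumes smooth: "smooth_map (prod_manifold M M) M (\<lambda>(a, b). f a b)"
    and hom: "\<And>a. a \<in> carrier G \<Longrightarrow> f a \<in> hom G G"
    and one: "\<And>b. b \<in> carrier G \<Longrightarrow> f \<one> b = b"
  defines "D \<equiv> mixed_deriv (\<lambda>u v. J (f (K u) (K v)))"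
  shows "D x (lie_bracket G c y z) = lie_bracket G c (D x y) z + lie_bracket G c y (D x z)"
proof (rule bracket_derivation)
  let ?r = "\<lambda>u v. J (f (K u) (K v))"
  have f_one: "f a \<one> = \<one>" if "a \<in> carrier G" for a
    using hom_one[OF hom[OF that] is_group is_group] .
  have "f \<one> \<one> = \<one>" by (rule one) simp
  note sm = smooth2_op[OF smooth this]
  show "bounded_bilinear (lie_bracket G c)" by (rule bracket_bilinear)
  show "((\<lambda>u. fd (?r u) 0 z) has_derivative (\<lambda>x. D x z)) (at 0)" for z
    unfolding D_def by (rule mixed_deriv_has_derivative[OF fin fin sm(1)])
  have "\<forall>\<^sub>F v in nhds 0. v = ?r 0 v" using ev_K by eventually_elim (simp add: K_0 one c_carrier)
  from frechet_derivative_at[OF has_derivative_eventually_cong[OF has_derivative_ident this]]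
  show "fd (?r 0) 0 z = z" for z by metis
  have s1: "\<forall>\<^sub>F u in nhds 0. smooth_near (u, 0) (\<lambda>p. ?r (fst p) (snd p))"
    by (rule eventually_nhds_slice(1)[OF smooth_near_eventually[OF sm(1)[unfolded smooth2_near_0_def]]])
  have s2: "\<forall>\<^sub>F u in nhds 0. \<forall>\<^sub>F v in nhds 0. f (K u) (K v) \<in> fst c"
    using eventually_nhds_Pair[OF sm(2)] by simp
  show "\<forall>\<^sub>F u in nhds 0. fd (?r u) 0 (lie_bracket G c y z) = lie_bracket G c (fd (?r u) 0 y) (fd (?r u) 0 z)"
    using s1 s2 ev_K
  proof eventually_elim
    case (elim u)
    then have u: "K u \<in> carrier G" using c_carrier by blast
    have r0: "?r u 0 = 0" by (simp add: K_0 f_one[OF u])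
    obtain L Q where "jet2 (\<lambda>y. ?r u (0 + y) - ?r u 0) L Q"
      using jet2_slice_right[OF fin fin elim(1)] by blast
    then have j: "jet2 (?r u) L Q" unfolding r0 by simp
    have "fd (?r u) 0 = L" by (rule frechet_derivative_at[symmetric, OF jet2_has_derivative[OF j]])
    then show ?case
      using hom_preserves_bracket[OF lie_group_chart_axioms lie_group_chart_axioms hom[OF u] elim(2) j] by simp
  qed
qed

subsection \<open>The adjoint action and the Jacobi identity\<close>

definition conj_map :: "'e \<Rightarrow> 'e \<Rightarrow> 'e" where "conj_map u v = J (K u \<otimes> K v \<otimes> inv (K u))"

lemma inv_centred: "((\<lambda>u. J (inv (K u))) \<longlongrightarrow> 0) (nhds 0)"
  and ev_inv: "\<forall>\<^sub>F u in nhds 0. inv (K u) \<in> fst c"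
proof -
  have 1: "inv \<one> \<in> fst c" using one_in_c by simp
  note s = smooth_map_centred[OF smooth_inv c_atlas c_chart one_in_c c_atlas c_open 1]
  show "\<forall>\<^sub>F u in nhds 0. inv (K u) \<in> fst c" by (rule s(2))
  have "isCont (\<lambda>u. J (inv (K u))) 0"
    using differentiable_imp_continuous_within[OF smooth_near_differentiable[OF s(1)]] by simp
  then have "((\<lambda>u. J (inv (K u))) \<longlongrightarrow> J (inv (K 0))) (nhds 0)"
    unfolding isCont_def by (rule tendsto_at_iff_tendsto_nhds[of "\<lambda>u. J (inv (K u))" 0, THEN iffD1])
  moreover have "J (inv (K 0)) = 0" by (simp add: K_0)
  ultimately show "((\<lambda>u. J (inv (K u))) \<longlongrightarrow> 0) (nhds 0)" by simp
qed

text \<open>For \<open>u\<close> near the origin, conjugation is \<open>mul (mul u v) i\<close>, with \<open>i\<close> the coordinates of the inverse. The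
inner map has an expansion at \<open>(u, 0)\<close> and the outer one at \<open>(u, i)\<close>, both away from the origin but in
the region where \<open>mul\<close> is smooth. The last conjunct determines its tangent map without inverses.\<close>

lemma conj_map_local:
  "\<forall>\<^sub>F u in nhds 0. (\<exists>L Q. jet2 (conj_map u) L Q) \<and>
    (\<forall>\<^sub>F v in nhds 0. K u \<otimes> K v \<otimes> inv (K u) \<in> fst c) \<and>
    (\<forall>\<^sub>F v in nhds 0. mul (conj_map u v) u = mul u v)"
proof -
  let ?F = "\<lambda>p. mul (fst p) (snd p)"
  let ?good = "\<lambda>z. smooth_near z ?F \<and> K (fst z) \<otimes> K (snd z) \<in> fst c"
  have "\<forall>\<^sub>F z in nhds (0, 0). ?good z"
    using smooth_near_eventually[OF mul_smooth[unfolded smooth2_near_0_def]] ev_mul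
    by (rule eventually_conj)
  then have good: "\<forall>\<^sub>F z in nhds (0, 0). \<forall>\<^sub>F w in nhds z. ?good w"
    unfolding eventually_eventually .
  have "((\<lambda>u. (u, J (inv (K u)))) \<longlongrightarrow> (0, 0)) (nhds 0)"
    by (intro tendsto_Pair filterlim_ident inv_centred)
  from eventually_compose_filterlim[OF good this]
  have "\<forall>\<^sub>F u in nhds 0. \<forall>\<^sub>F w in nhds (u, J (inv (K u))). ?good w" .
  then show ?thesis using eventually_nhds_slice(1)[OF good] ev_K ev_inv
  proof eventually_elim
    case (elim u)
    let ?i = "J (inv (K u))"
    have u: "K u \<in> carrier G" "J (K u) = u" using elim(3) c_carrier by auto
    have sm: "smooth_near (u, 0) ?F" "smooth_near (u, ?i) ?F"
      using eventually_nhds_x_imp_x[OF elim(2)] eventually_nhds_x_imp_x[OF elim(1)] by auto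
    have u0: "mul u 0 = u" using u by (simp add: mul_def K_0)
    have ui: "mul u ?i = 0" using u by (simp add: mul_def K_J[OF elim(4)])
    obtain L1 Q1 where "jet2 (\<lambda>y. mul u (0 + y) - mul u 0) L1 Q1"
      using jet2_slice_right[OF fin fin sm(1)] by blast
    then have a: "jet2 (\<lambda>v. mul u v - u) L1 Q1" unfolding u0 by simp
    obtain L2 Q2 where "jet2 (\<lambda>x. mul (u + x) ?i - mul u ?i) L2 Q2"
      using jet2_slice_left[OF fin fin sm(2)] by blast
    then have b: "jet2 (\<lambda>x. mul (u + x) ?i) L2 Q2" unfolding ui by simp
    have "((\<lambda>v. (0 + v)) \<longlongrightarrow> (0::'e) + 0) (nhds 0)"
      by (intro tendsto_intros filterlim_ident)
    then have "((\<lambda>v. (u, v)) \<longlongrightarrow> (u, 0)) (nhds 0)"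
      by (intro tendsto_Pair tendsto_const filterlim_ident)
    from eventually_compose_filterlim[OF elim(2) this, unfolded fst_conv snd_conv]
    have e1: "\<forall>\<^sub>F v in nhds 0. K u \<otimes> K v \<in> fst c"
      by (rule eventually_mono) (auto dest: eventually_nhds_x_imp_x)
    have "((\<lambda>v. u + (mul u v - u)) \<longlongrightarrow> u + 0) (nhds 0)"
      by (intro tendsto_add tendsto_const lin_bound_tendsto jet2_lin_bound[OF a])
    then have "((\<lambda>v. (mul u v, ?i)) \<longlongrightarrow> (u, ?i)) (nhds 0)"
      by (intro tendsto_Pair tendsto_const) simp
    from eventually_compose_filterlim[OF elim(1) this, unfolded fst_conv snd_conv]
    have e2: "\<forall>\<^sub>F v in nhds 0. K (mul u v) \<otimes> K ?i \<in> fst c"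
      by (rule eventually_mono) (auto dest: eventually_nhds_x_imp_x)
    have e3: "\<forall>\<^sub>F v in nhds 0. K (mul u v) \<otimes> K ?i = K u \<otimes> K v \<otimes> inv (K u)"
      using e1 by eventually_elim (simp add: mul_def K_J elim(4))
    have dom: "\<forall>\<^sub>F v in nhds 0. K u \<otimes> K v \<otimes> inv (K u) \<in> fst c"
      using e2 e3 by eventually_elim simp
    have "\<forall>\<^sub>F v in nhds 0. mul (u + (mul u v - u)) ?i = conj_map u v"
      using e3 by eventually_elim (simp add: mul_def[of "mul u _"] conj_map_def)
    from jet2_cong[OF jet2_compose[OF a b] this]
    have jet: "\<exists>L Q. jet2 (conj_map u) L Q" by blast
    have "\<forall>\<^sub>F v in nhds 0. mul (conj_map u v) u = mul u v"
      using dom ev_K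
    proof eventually_elim
      case (elim v)
      then have v: "K v \<in> carrier G" using c_carrier by blast
      have "K u \<otimes> K v \<otimes> inv (K u) \<otimes> K u = K u \<otimes> K v"
        using u(1) v by (simp add: m_assoc)
      then show ?case unfolding mul_def conj_map_def by (simp add: K_J[OF elim(1)])
    qed
    then show ?case using jet dom by blast
  qed
qed

lemma conj_hom: "a \<in> carrier G \<Longrightarrow> (\<lambda>b. a \<otimes> b \<otimes> inv a) \<in> hom G G"
proof (rule homI)
  fix x y assume a: "a \<in> carrier G" and x: "x \<in> carrier G" and y: "y \<in> carrier G"
  have "inv a \<otimes> (a \<otimes> (y \<otimes> inv a)) = inv a \<otimes> a \<otimes> (y \<otimes> inv a)"
    using a y by (intro m_assoc[symmetric]) auto
  also have "\<dots> = y \<otimes> inv a" using a y by simp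
  finally have "inv a \<otimes> (a \<otimes> (y \<otimes> inv a)) = y \<otimes> inv a" .
  then show "a \<otimes> (x \<otimes> y) \<otimes> inv a = a \<otimes> x \<otimes> inv a \<otimes> (a \<otimes> y \<otimes> inv a)"
    using a x y by (simp only: m_assoc m_closed inv_closed)
qed simp

lemma Ad_preserves_bracket:
  "\<forall>\<^sub>F u in nhds 0. fd (conj_map u) 0 (lie_bracket G c y z)
     = lie_bracket G c (fd (conj_map u) 0 y) (fd (conj_map u) 0 z)"
  using conj_map_local ev_K
proof eventually_elim
  case (elim u)
  then obtain L Q where j: "jet2 (conj_map u) L Q" by blast
  have "fd (conj_map u) 0 = L" by (rule frechet_derivative_at[symmetric, OF jet2_has_derivative[OF j]])
  moreover have "K u \<in> carrier G" using elim(2) c_carrier by blast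
  moreover have "\<forall>\<^sub>F v in nhds 0. K u \<otimes> K v \<otimes> inv (K u) \<in> fst c" using elim(1) by blast
  ultimately show ?case
    using hom_preserves_bracket[OF lie_group_chart_axioms lie_group_chart_axioms conj_hom _ j[unfolded conj_map_def[abs_def]]]
    by simp
qed

text \<open>Let \<open>R u\<close> and \<open>V u\<close> be the tangent maps of right and left translation. Then \<open>R u (Ad u y) = V u y\<close>, where
\<open>R u = id + B (_) u + o(u)\<close> and \<open>V u = id + B u (_) + o(u)\<close>. So \<open>R u\<close> maps \<open>Ad u y - y - [u, y]\<close> to a term
that is \<open>o(u)\<close>, and near the origin \<open>R u\<close> shrinks no vector by more than a factor of two.\<close>

lemma Ad_has_derivative:
  "((\<lambda>u. fd (conj_map u) 0 y) has_derivative (\<lambda>x. lie_bracket G c x y)) (at 0)"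
proof -
  interpret B: bounded_bilinear B by (rule B_bilinear)
  interpret br: bounded_bilinear "lie_bracket G c" by (rule bracket_bilinear)
  let ?V = "\<lambda>u. fd (mul u) 0" and ?R = "\<lambda>u. fd (\<lambda>w. mul w u) 0" and ?A = "\<lambda>u. fd (conj_map u) 0"
  have V: "\<forall>\<^sub>F u in nhds 0. \<forall>y. norm (?V u y - y - B u y) \<le> e * norm u * norm y" if "e > 0" for e
    using mixed_deriv_increment_right[OF fin fin mul_smooth that] unfolding fd_mul_0 B_def .
  have R: "\<forall>\<^sub>F u in nhds 0. \<forall>y. norm (?R u y - y - B y u) \<le> e * norm u * norm y" if "e > 0" for e
    using mixed_deriv_increment_left[OF fin fin mul_smooth that] unfolding fd_mul_0' B_def .
  have Rd: "\<forall>\<^sub>F u in nhds 0. ((\<lambda>w. mul w u) has_derivative ?R u) (at 0)"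
    by (rule partial_differentiable_left[OF fin fin mul_smooth])
  have RA: "\<forall>\<^sub>F u in nhds 0. ?R u (?A u y) = ?V u y"
    using Rd conj_map_local ev_K
  proof eventually_elim
    case (elim u)
    then obtain L Q where j: "jet2 (conj_map u) L Q" by blast
    note L = jet2_has_derivative[OF j]
    have A: "?A u = L" by (rule frechet_derivative_at[symmetric, OF L])
    have "((\<lambda>w. mul w u) has_derivative ?R u) (at (conj_map u 0))"
      unfolding jet2_zero[OF j] by (rule elim(1))
    from has_derivative_compose[OF L this]
    have "((\<lambda>v. mul (conj_map u v) u) has_derivative (\<lambda>y. ?R u (L y))) (at 0)" .
    from has_derivative_eventually_cong[OF this] elim(2)
    have "(mul u has_derivative (\<lambda>y. ?R u (L y))) (at 0)" by blast
    from frechet_derivative_at[OF this] show ?case unfolding A by metis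
  qed
  obtain k where k: "k > 0" "\<And>a b. norm (B a b) \<le> norm a * norm b * k" using B.pos_bounded by blast
  have R1: "\<forall>\<^sub>F u in nhds 0. \<forall>y. norm (?R u y - y) \<le> (k + 1) * norm u * norm y"
    using R[of 1, OF zero_less_one]
  proof eventually_elim
    case (elim u)
    show ?case
    proof
      fix y
      have "norm (?R u y - y) \<le> norm (?R u y - y - B y u) + norm (B y u)"
        using norm_triangle_ineq[of "?R u y - y - B y u" "B y u"] by simp
      also have "\<dots> \<le> 1 * norm u * norm y + norm y * norm u * k"
        using elim k(2) by (intro add_mono) auto
      finally show "norm (?R u y - y) \<le> (k + 1) * norm u * norm y" by (simp add: algebra_simps)
    qed
  qed
  let ?d = "\<lambda>u. ?A u y - y - lie_bracket G c u y"
  have \<rho>2: "lin_small (\<lambda>u. ?V u y - y - B u y)" by (rule lin_smallI_uniform[OF V])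
  have \<rho>1: "lin_small (\<lambda>u. ?R u y - y - B y u)" by (rule lin_smallI_uniform[OF R])
  obtain l where l: "l > 0" "\<And>a b. norm (lie_bracket G c a b) \<le> norm a * norm b * l"
    using br.pos_bounded by blast
  have \<rho>3: "lin_small (\<lambda>u. ?R u (lie_bracket G c u y) - lie_bracket G c u y)"
  proof (rule lin_smallI_quadratic)
    show "\<forall>\<^sub>F u in nhds 0. norm (?R u (lie_bracket G c u y) - lie_bracket G c u y)
        \<le> ((k + 1) * norm y * l) * (norm u)\<^sup>2"
      using R1
    proof eventually_elim
      case (elim u)
      have "norm (?R u (lie_bracket G c u y) - lie_bracket G c u y)
          \<le> (k + 1) * norm u * norm (lie_bracket G c u y)" using elim by blast
      also have "\<dots> \<le> (k + 1) * norm u * (norm u * norm y * l)"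
        using k(1) by (intro mult_left_mono l(2)) auto
      also have "\<dots> = ((k + 1) * norm y * l) * (norm u)\<^sup>2" by (simp only: power2_eq_square mult_ac)
      finally show ?case .
    qed
  qed
  have small: "\<forall>\<^sub>F u in nhds (0::'e). norm u < 1 / (2 * (k + 1))"
    using k(1) unfolding eventually_nhds_metric by (intro exI[of _ "1 / (2 * (k + 1))"]) auto
  have bound: "\<forall>\<^sub>F u in nhds 0. norm (?d u) \<le> 2 * norm ((?V u y - y - B u y) - (?R u y - y - B y u)
      - (?R u (lie_bracket G c u y) - lie_bracket G c u y))"
    using small R1 RA Rd
  proof eventually_elim
    case (elim u)
    interpret Ru: bounded_linear "?R u" by (rule has_derivative_bounded_linear[OF elim(4)])
    have "?R u (?d u) = (?V u y - y - B u y) - (?R u y - y - B y u)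
      - (?R u (lie_bracket G c u y) - lie_bracket G c u y)"
      unfolding Ru.diff elim(3) lie_bracket_eq[of u y] by simp
    moreover have "norm (?R u (?d u) - ?d u) \<le> norm (?d u) / 2"
    proof -
      have "norm (?R u (?d u) - ?d u) \<le> (k + 1) * norm u * norm (?d u)" using elim(2) by blast
      also have "\<dots> \<le> 1 / 2 * norm (?d u)"
        using elim(1) k(1) by (intro mult_right_mono) (simp_all add: field_simps)
      finally show ?thesis by simp
    qed
    moreover have "norm (?d u) \<le> norm (?R u (?d u)) + norm (?R u (?d u) - ?d u)"
      using norm_triangle_ineq4[of "?R u (?d u)" "?R u (?d u) - ?d u"] by simp
    ultimately show ?case by simp
  qed
  have d: "lin_small ?d"
    unfolding lin_small_def
  proof (intro allI impI)
    fix e :: real assume "e > 0"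
    then have "e / 2 > 0" by simp
    then have "\<forall>\<^sub>F u in nhds 0. norm ((?V u y - y - B u y) - (?R u y - y - B y u)
      - (?R u (lie_bracket G c u y) - lie_bracket G c u y)) \<le> e / 2 * norm u"
      using lin_small_diff[OF lin_small_diff[OF \<rho>2 \<rho>1] \<rho>3] unfolding lin_small_def by blast
    with bound show "\<forall>\<^sub>F u in nhds 0. norm (?d u) \<le> e * norm u"
      by eventually_elim linarith
  qed
  have "?d 0 = 0"
  proof -
    from d have "\<forall>\<^sub>F u in nhds 0. norm (?d u) \<le> 1 * norm u" unfolding lin_small_def using zero_less_one by blast
    from eventually_nhds_x_imp_x[OF this] show ?thesis by simp
  qed
  then have "?A 0 y = y" by (simp add: br.zero_left)
  with d show ?thesis
    unfolding has_derivative_iff_lin_small using br.bounded_linear_left by simp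
qed

text \<open>The Jacobi identity is the derivation property of the adjoint action.\<close>

lemma lie_algebra_lie_bracket: "lie_algebra (lie_bracket G c)"
proof
  let ?br = "lie_bracket G c"
  interpret br: bounded_bilinear ?br by (rule bracket_bilinear)
  show "bilinear ?br" unfolding bilinear_def
    using br.bounded_linear_left br.bounded_linear_right bounded_linear.linear by blast
  show "?br x x = 0" for x by (simp add: lie_bracket_eq)
  have Ad0: "fd (conj_map 0) 0 z = z" for z
  proof -
    have "\<forall>\<^sub>F v in nhds 0. v = conj_map 0 v"
      using ev_K by eventually_elim (simp add: conj_map_def K_0 c_carrier)
    from frechet_derivative_at[OF has_derivative_eventually_cong[OF has_derivative_ident this]]
    show ?thesis by metis
  qed
  have jac: "?br x (?br y z) = ?br (?br x y) z + ?br y (?br x z)" for x y z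
    by (rule bracket_derivation[where A="\<lambda>u. fd (conj_map u) 0",
          OF bracket_bilinear Ad_has_derivative Ad0 Ad_preserves_bracket])
  have anti: "?br x y = - ?br y x" for x y by (simp add: lie_bracket_eq)
  show "?br x (?br y z) + ?br y (?br z x) + ?br z (?br x y) = 0" for x y z
  proof -
    have "?br z (?br x y) = - ?br (?br x y) z" by (rule anti)
    moreover have "?br y (?br z x) = - ?br y (?br x z)"
      unfolding anti[of z x] by (rule br.minus_right)
    ultimately show ?thesis using jac[of x y z] by simp
  qed
qed

end

section \<open>One-parameter subgroups and the exponential map\<close>

lemma Ck_on_const: "Ck_on k S (\<lambda>x. a)"
proof (induction k arbitrary: a)
  case (Suc k)
  from Suc.IH[of 0] show ?case by simp
qed simp

lemma Ck_on_scale: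
  fixes f :: "real \<Rightarrow> 'f::real_normed_vector"
  assumes "open S" "Ck_on k S f"
  shows "Ck_on k {t. r * t \<in> S} (\<lambda>t. f (r * t))"
  using assms(2)
proof (induction k arbitrary: f)
  case 0
  then have "continuous_on S f" by simp
  then have "continuous_on {t. r * t \<in> S} (\<lambda>t. f (r * t))"
    by (rule continuous_on_compose2[where t=S]) (auto intro: continuous_on_mult_left)
  then show ?case by simp
next
  case (Suc k)
  let ?T = "{t. r * t \<in> S}"
  have "open ((*) r -` S)" by (rule open_vimage[OF assms(1)]) (intro continuous_intros)
  then have T: "open ?T" by (simp add: vimage_def)
  have d: "((\<lambda>t. f (r * t)) has_derivative (\<lambda>v. fd f (r * t) (r * v))) (at t)" if t: "t \<in> ?T" for t
  proof -
    have "\<forall>x\<in>S. f differentiable (at x)" by (rule Suc.prems(1)[unfolded Ck_on.simps, THEN conjunct1])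
    then have f: "(f has_derivative fd f (r * t)) (at (r * t))"
      using t frechet_derivative_works by blast
    have "((\<lambda>t. r * t) has_derivative (\<lambda>v. r * v)) (at t)" by (auto intro!: derivative_eq_intros)
    from has_derivative_compose[OF this f] show ?thesis .
  qed
  have "Ck_on k ?T (\<lambda>t. fd (\<lambda>t. f (r * t)) t v)" for v
  proof (rule Ck_on_cong_subset[OF _ subset_refl T])
    show "Ck_on k ?T (\<lambda>t. fd f (r * t) (r * v))"
      by (rule Suc.IH) (rule Suc.prems(1)[unfolded Ck_on.simps, THEN conjunct2, rule_format])
    show "fd f (r * t) (r * v) = fd (\<lambda>t. f (r * t)) t v" if "t \<in> ?T" for t
      by (rule fun_cong[OF frechet_derivative_at[OF d[OF that]]])
  qed
  moreover have "\<forall>t\<in>?T. (\<lambda>t. f (r * t)) differentiable (at t)"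
    using differentiableI[OF d] by blast
  ultimately show ?case by simp
qed

lemma smooth_map_real_iff:
  "smooth_map real_manifold M \<gamma> \<longleftrightarrow> continuous_map euclideanreal (mtop M) \<gamma> \<and>
     (\<forall>d\<in>atlas M. smooth_on {t. \<gamma> t \<in> fst d} (\<lambda>t. snd d (\<gamma> t)))"
proof -
  have "{t. \<gamma> t \<in> fst d} = id ` (UNIV \<inter> \<gamma> -` fst d)" for d :: "('a, 'b) chart" by auto
  then show ?thesis unfolding smooth_map_def real_manifold_def by (simp add: comp_def)
qed

lemma eventually_nhds_star:
  fixes P :: "'e::real_normed_vector \<Rightarrow> bool"
  assumes "\<forall>\<^sub>F x in nhds 0. P x"
  shows "\<forall>\<^sub>F x in nhds 0. \<forall>t\<in>{0..1::real}. P (t *\<^sub>R x)"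
proof -
  obtain d where d: "d > 0" "\<And>x. norm x < d \<Longrightarrow> P x"
    using assms unfolding eventually_nhds_metric dist_norm by auto
  have "P (t *\<^sub>R x)" if x: "norm x < d" and t: "t \<in> {0..1}" for x and t :: real
  proof (rule d(2))
    have "norm (t *\<^sub>R x) \<le> 1 * norm x" unfolding norm_scaleR using t by (intro mult_right_mono) auto
    then show "norm (t *\<^sub>R x) < d" using x by simp
  qed
  then show ?thesis unfolding eventually_nhds_metric dist_norm using d(1) by auto
qed

lemma has_vector_derivative_at_shift:
  fixes t :: real
  assumes "((\<lambda>h. f (t + h)) has_vector_derivative v) (at 0)"
  shows "(f has_vector_derivative v) (at t)"
  using assms has_derivative_shift_iff[where f=f and p=t and a=0 and x=0 and D="\<lambda>h. h *\<^sub>R v"]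
  unfolding has_vector_derivative_def by simp

lemma has_vector_derivative_chain:
  assumes "(g has_vector_derivative v) (at t)" "(f has_derivative D) (at (g t))"
  shows "((\<lambda>t. f (g t)) has_vector_derivative D v) (at t)"
proof -
  have "((\<lambda>t. f (g t)) has_derivative (\<lambda>h. D (h *\<^sub>R v))) (at t)"
    by (rule has_derivative_compose[OF assms(1)[unfolded has_vector_derivative_def] assms(2)])
  then show ?thesis
    unfolding has_vector_derivative_def linear_scale[OF has_derivative_linear[OF assms(2)]] .
qed

lemma has_vector_derivative_eventually_cong:
  assumes "(f has_vector_derivative v) (at t)" "\<forall>\<^sub>F s in nhds t. f s = g s"
  shows "(g has_vector_derivative v) (at t)"
  using has_derivative_eventually_cong[OF assms(1)[unfolded has_vector_derivative_def] assms(2)]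
  unfolding has_vector_derivative_def .

context lie_group_chart
begin

abbreviation ops :: "'e \<Rightarrow> (real \<Rightarrow> 'a) \<Rightarrow> bool" where "ops \<equiv> one_parameter_subgroup G M c"

lemma opsD:
  assumes "ops x \<gamma>"
  shows "smooth_map real_manifold M \<gamma>" "\<gamma> t \<in> carrier G" "\<gamma> (s + t) = \<gamma> s \<otimes> \<gamma> t"
    "((\<lambda>t. snd c (\<gamma> t)) has_vector_derivative x) (at 0)"
  using assms unfolding one_parameter_subgroup_def by blast+

lemma ops_0: assumes "ops x \<gamma>" shows "\<gamma> 0 = \<one>"
proof -
  have "\<gamma> 0 \<otimes> \<gamma> 0 = \<gamma> 0" using opsD(3)[OF assms, of 0 0] by simp
  then show ?thesis using opsD(2)[OF assms] by (metis r_cancel_one')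
qed

lemma ops_inverse: assumes "ops x \<gamma>" shows "\<gamma> t \<otimes> \<gamma> (- t) = \<one>" "\<gamma> (- t) \<otimes> \<gamma> t = \<one>"
  using opsD(3)[OF assms, of t "- t"] opsD(3)[OF assms, of "- t" t] ops_0[OF assms] by simp_all

lemma ops_eventually: assumes "ops x \<gamma>" "\<gamma> t \<in> fst c" shows "\<forall>\<^sub>F s in nhds t. \<gamma> s \<in> fst c"
proof -
  have "openin euclideanreal {s \<in> topspace euclideanreal. \<gamma> s \<in> fst c}"
    by (rule openin_continuous_map_preimage[OF _ c_open])
      (use opsD(1)[OF assms(1)] in \<open>simp add: smooth_map_real_iff\<close>)
  then have "open {s. \<gamma> s \<in> fst c}" by simp
  from eventually_nhds_in_open[OF this, of t] assms(2) show ?thesis by simp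
qed

lemma ops_coord_derivative_0: assumes "ops x \<gamma>"
  shows "((\<lambda>t. J (\<gamma> t)) has_vector_derivative x) (at 0)"
proof -
  have "((\<lambda>t. snd c (\<gamma> t) - snd c \<one>) has_vector_derivative x - 0) (at 0)"
    by (intro has_vector_derivative_diff opsD(4)[OF assms] has_vector_derivative_const)
  then show ?thesis unfolding coord_def by simp
qed

text \<open>One-parameter subgroups are integral curves of left-invariant fields, because
\<open>\<gamma> (t + h) = \<gamma> t \<otimes> \<gamma> h\<close>.\<close>

lemma ops_coord_derivative:
  assumes \<gamma>: "ops x \<gamma>" and t: "\<gamma> t \<in> fst c"
    and m: "(mul (J (\<gamma> t)) has_derivative D) (at 0)"
  shows "((\<lambda>s. J (\<gamma> s)) has_vector_derivative D x) (at t)"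
proof (rule has_vector_derivative_at_shift)
  have "\<gamma> 0 \<in> fst c" using ops_0[OF \<gamma>] one_in_c by simp
  from ops_eventually[OF \<gamma> this]
  have ev: "\<forall>\<^sub>F h in nhds 0. mul (J (\<gamma> t)) (J (\<gamma> h)) = J (\<gamma> (t + h))"
    by eventually_elim (simp add: mul_def K_J t opsD(3)[OF \<gamma>])
  have "J (\<gamma> 0) = 0" using ops_0[OF \<gamma>] by simp
  with m have "(mul (J (\<gamma> t)) has_derivative D) (at (J (\<gamma> 0)))" by simp
  from has_vector_derivative_eventually_cong[OF
      has_vector_derivative_chain[OF ops_coord_derivative_0[OF \<gamma>] this] ev]
  show "((\<lambda>h. J (\<gamma> (t + h))) has_vector_derivative D x) (at 0)" .
qed

lemma eventually_good_mul:
  "\<forall>\<^sub>F z in nhds (0, 0). \<forall>\<^sub>F w in nhds z. smooth_near w (\<lambda>p. mul (fst p) (snd p)) \<and>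
     K (fst w) \<otimes> K (snd w) \<in> fst c"
  unfolding eventually_eventually
  using smooth_near_eventually[OF mul_smooth[unfolded smooth2_near_0_def]] ev_mul
  by (rule eventually_conj)

text \<open>The quotient \<open>w\<close> of the two curves is stationary: in
\<open>\<gamma> (t + h) \<delta> (- t - h) = \<gamma> t (\<gamma> h \<delta> (- h)) \<delta> (- t)\<close> the middle factor has velocity \<open>x - x\<close> at \<open>h = 0\<close>. For
small \<open>t\<close> all these products remain in the chart.\<close>

lemma ops_unique_near_0:
  assumes \<gamma>: "ops x \<gamma>" and \<delta>: "ops x \<delta>"
  shows "\<forall>\<^sub>F t in nhds 0. \<gamma> t = \<delta> t"
proof -
  let ?F = "\<lambda>p. mul (fst p) (snd p)"
  let ?good = "\<lambda>w. smooth_near w ?F \<and> K (fst w) \<otimes> K (snd w) \<in> fst c"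
  have c\<gamma>: "\<gamma> 0 \<in> fst c" and c\<delta>: "\<delta> 0 \<in> fst c"
    using ops_0[OF \<gamma>] ops_0[OF \<delta>] one_in_c by simp_all
  have neg: "filterlim (\<lambda>t::real. - t) (nhds 0) (nhds 0)"
  proof -
    have "((\<lambda>t::real. - t) \<longlongrightarrow> - 0) (nhds 0)" by (intro tendsto_minus filterlim_ident)
    then show ?thesis by simp
  qed
  have ev\<gamma>: "\<forall>\<^sub>F t in nhds 0. \<gamma> t \<in> fst c" by (rule ops_eventually[OF \<gamma> c\<gamma>])
  have ev\<delta>: "\<forall>\<^sub>F t in nhds 0. \<delta> (- t) \<in> fst c"
    by (rule eventually_compose_filterlim[OF ops_eventually[OF \<delta> c\<delta>] neg])
  have d\<gamma>: "((\<lambda>t. J (\<gamma> t)) has_vector_derivative x) (at 0)" by (rule ops_coord_derivative_0[OF \<gamma>])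
  have d\<delta>: "((\<lambda>t. J (\<delta> (- t))) has_vector_derivative - x) (at 0)"
  proof -
    have "((\<lambda>t::real. - t) has_vector_derivative - 1) (at 0)"
      by (auto intro!: derivative_eq_intros simp: has_vector_derivative_def)
    moreover have "((\<lambda>t. J (\<delta> t)) has_derivative (\<lambda>h. h *\<^sub>R x)) (at (- 0))"
      using ops_coord_derivative_0[OF \<delta>] unfolding has_vector_derivative_def by simp
    ultimately have "((\<lambda>t. J (\<delta> (- t))) has_vector_derivative (- 1) *\<^sub>R x) (at 0)"
      by (rule has_vector_derivative_chain)
    then show ?thesis by simp
  qed
  have t\<gamma>: "((\<lambda>t. J (\<gamma> t)) \<longlongrightarrow> 0) (nhds 0)" and t\<delta>: "((\<lambda>t. J (\<delta> (- t))) \<longlongrightarrow> 0) (nhds 0)"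
  proof -
    have "isCont (\<lambda>t. J (\<gamma> t)) 0" "isCont (\<lambda>t. J (\<delta> (- t))) 0"
      using d\<gamma> d\<delta> by (auto intro: has_vector_derivative_continuous)
    then have "((\<lambda>t. J (\<gamma> t)) \<longlongrightarrow> J (\<gamma> 0)) (nhds 0)" "((\<lambda>t. J (\<delta> (- t))) \<longlongrightarrow> J (\<delta> (- 0))) (nhds 0)"
      unfolding isCont_def using tendsto_at_iff_tendsto_nhds[of "\<lambda>t. J (\<gamma> t)" 0]
        tendsto_at_iff_tendsto_nhds[of "\<lambda>t. J (\<delta> (- t))" 0] by blast+
    then show "((\<lambda>t. J (\<gamma> t)) \<longlongrightarrow> 0) (nhds 0)" "((\<lambda>t. J (\<delta> (- t))) \<longlongrightarrow> 0) (nhds 0)"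
      using ops_0[OF \<gamma>] ops_0[OF \<delta>] by simp_all
  qed
  \<comment> \<open>the velocities \<open>x\<close> and \<open>- x\<close> of the two factors cancel, since \<open>mul\<close> is addition to first order\<close>
  define w where "w h = J (\<gamma> h \<otimes> \<delta> (- h))" for h
  have dw: "(w has_vector_derivative 0) (at 0)"
  proof -
    have "((\<lambda>p. mul (fst p) (snd p)) has_derivative (\<lambda>p. fst p + snd p)) (at (J (\<gamma> 0), J (\<delta> (- 0))))"
      using jet2_has_derivative[OF jet_mul] ops_0[OF \<gamma>] ops_0[OF \<delta>] by (simp add: zero_prod_def)
    moreover have "((\<lambda>t. (J (\<gamma> t), J (\<delta> (- t)))) has_vector_derivative (x, - x)) (at 0)"
      by (rule has_vector_derivative_Pair[OF d\<gamma> d\<delta>])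
    ultimately have "((\<lambda>t. mul (J (\<gamma> t)) (J (\<delta> (- t)))) has_vector_derivative 0) (at 0)"
      using has_vector_derivative_chain[of "\<lambda>t. (J (\<gamma> t), J (\<delta> (- t)))" "(x, - x)" 0 ?F "\<lambda>p. fst p + snd p"]
      by simp
    moreover have "\<forall>\<^sub>F h in nhds 0. mul (J (\<gamma> h)) (J (\<delta> (- h))) = w h"
      using ev\<gamma> ev\<delta> by eventually_elim (simp add: mul_def w_def K_J)
    ultimately show ?thesis by (rule has_vector_derivative_eventually_cong)
  qed
  have w0: "w 0 = 0" using ops_0[OF \<gamma>] ops_0[OF \<delta>] by (simp add: w_def)
  have tw: "(w \<longlongrightarrow> 0) (nhds 0)"
    using has_vector_derivative_continuous[OF dw] tendsto_at_iff_tendsto_nhds[of w 0]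
    unfolding continuous_within w0 by simp
  have evw: "\<forall>\<^sub>F h in nhds 0. \<gamma> h \<otimes> \<delta> (- h) \<in> fst c"
  proof -
    have "((\<lambda>t. (J (\<gamma> t), J (\<delta> (- t)))) \<longlongrightarrow> (0, 0)) (nhds 0)"
      by (rule tendsto_Pair[OF t\<gamma> t\<delta>])
    from eventually_compose_filterlim[OF ev_mul this] ev\<gamma> ev\<delta> show ?thesis
      by eventually_elim (simp add: K_J)
  qed
  have "\<forall>\<^sub>F t in nhds 0. (w has_vector_derivative 0) (at t)"
  proof -
    have l1: "((\<lambda>t. (J (\<gamma> t), J (\<delta> (- t)))) \<longlongrightarrow> (0, 0)) (nhds 0)"
      by (rule tendsto_Pair[OF t\<gamma> t\<delta>])
    have l2: "((\<lambda>t. (0::'e, J (\<delta> (- t)))) \<longlongrightarrow> (0, 0)) (nhds 0)"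
      by (rule tendsto_Pair[OF tendsto_const t\<delta>])
    note g1 = eventually_compose_filterlim[OF eventually_good_mul l1]
    note g2 = eventually_compose_filterlim[OF eventually_good_mul l2]
    note m0 = eventually_compose_filterlim[OF mul_0_left t\<delta>]
    from g1 g2 m0 ev\<gamma> ev\<delta> show ?thesis
    proof eventually_elim
      case (elim t)
      let ?u = "J (\<gamma> t)" and ?v = "J (\<delta> (- t))"
      have s: "smooth_near (?u, ?v) ?F" "smooth_near (0, ?v) ?F"
        using eventually_nhds_x_imp_x[OF elim(1)] eventually_nhds_x_imp_x[OF elim(2)] by auto
      have F1: "(?F has_derivative fd ?F (?u, ?v)) (at (?u, ?v))" "(?F has_derivative fd ?F (0, ?v)) (at (0, ?v))"
        using s smooth_near_differentiable frechet_derivative_works by blast+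
      have "((\<lambda>a. (a, ?v)) has_derivative (\<lambda>a. (a, 0))) (at 0)"
        by (intro has_derivative_Pair has_derivative_ident has_derivative_const)
      from has_derivative_compose[OF this F1(2)]
      have i: "((\<lambda>a. mul a ?v) has_derivative (\<lambda>a. fd ?F (0, ?v) (a, 0))) (at 0)" by simp
      have "((\<lambda>a. (?u, mul a ?v)) has_derivative (\<lambda>a. (0, fd ?F (0, ?v) (a, 0)))) (at 0)"
        by (intro has_derivative_Pair has_derivative_const i)
      moreover have "(?F has_derivative fd ?F (?u, ?v)) (at (?u, mul 0 ?v))"
        using F1(1) elim(3) by simp
      ultimately have o: "((\<lambda>a. mul ?u (mul a ?v)) has_derivative
          (\<lambda>a. fd ?F (?u, ?v) (0, fd ?F (0, ?v) (a, 0)))) (at 0)"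
        using has_derivative_compose[where f="\<lambda>a. (?u, mul a ?v)" and g="?F"] by fastforce
      have "((\<lambda>h. mul ?u (mul (w h) ?v)) has_vector_derivative
          fd ?F (?u, ?v) (0, fd ?F (0, ?v) (0, 0))) (at 0)"
        by (rule has_vector_derivative_chain[OF dw]) (unfold w0, rule o)
      moreover have "fd ?F (?u, ?v) (0, fd ?F (0, ?v) (0, 0)) = 0"
        using linear_0[OF has_derivative_linear[OF F1(1)]] linear_0[OF has_derivative_linear[OF F1(2)]]
        by (simp add: zero_prod_def)
      ultimately have z: "((\<lambda>h. mul ?u (mul (w h) ?v)) has_vector_derivative 0) (at 0)" by simp
      have "((\<lambda>h. (w h, ?v)) \<longlongrightarrow> (0, ?v)) (nhds 0)" by (rule tendsto_Pair[OF tw tendsto_const])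
      from eventually_compose_filterlim[OF elim(2) this] evw
      have ev: "\<forall>\<^sub>F h in nhds 0. mul ?u (mul (w h) ?v) = w (t + h)"
      proof eventually_elim
        case (elim h)
        have car: "\<gamma> t \<in> carrier G" "\<gamma> h \<in> carrier G" "\<delta> (- h) \<in> carrier G" "\<delta> (- t) \<in> carrier G"
          by (rule opsD(2)[OF \<gamma>] opsD(2)[OF \<delta>])+
        have "\<gamma> h \<otimes> \<delta> (- h) \<otimes> \<delta> (- t) \<in> fst c"
          using elim \<open>\<delta> (- t) \<in> fst c\<close> by (simp add: w_def K_J)
        then have "mul ?u (mul (w h) ?v) = J (\<gamma> t \<otimes> (\<gamma> h \<otimes> \<delta> (- h) \<otimes> \<delta> (- t)))"
          using elim \<open>\<delta> (- t) \<in> fst c\<close> \<open>\<gamma> t \<in> fst c\<close> by (simp add: mul_def w_def K_J)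
        also have "\<gamma> t \<otimes> (\<gamma> h \<otimes> \<delta> (- h) \<otimes> \<delta> (- t)) = (\<gamma> t \<otimes> \<gamma> h) \<otimes> (\<delta> (- h) \<otimes> \<delta> (- t))"
          using car by (simp only: m_assoc m_closed)
        also have "\<dots> = \<gamma> (t + h) \<otimes> \<delta> (- (t + h))"
          using opsD(3)[OF \<gamma>, of t h] opsD(3)[OF \<delta>, of "- h" "- t"] by (simp add: add.commute)
        finally show ?case unfolding w_def .
      qed
      show ?case by (rule has_vector_derivative_at_shift, rule has_vector_derivative_eventually_cong[OF z ev])
    qed
  qed
  then obtain d where d: "d > 0" "\<And>t. \<bar>t\<bar> < d \<Longrightarrow> (w has_vector_derivative 0) (at t)"
    unfolding eventually_nhds_metric dist_norm by auto
  have w: "w t = 0" if t: "\<bar>t\<bar> < d" for t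
  proof -
    have "\<exists>k. \<forall>s\<in>{-d<..<d}. w s = k"
    proof (rule has_derivative_zero_constant)
      show "(w has_derivative (\<lambda>h. 0)) (at s within {-d<..<d})" if "s \<in> {-d<..<d}" for s
      proof -
        have "\<bar>s\<bar> < d" using that by auto
        from d(2)[OF this] have "(w has_derivative (\<lambda>h. 0)) (at s)" unfolding has_vector_derivative_def by simp
        then show ?thesis by (rule has_derivative_at_withinI)
      qed
    qed simp
    then obtain k where k: "\<And>s. s \<in> {-d<..<d} \<Longrightarrow> w s = k" by blast
    have "w t = k" "w 0 = k" by (rule k; use t d(1) in auto)+
    then have "w t = w 0" by simp
    then show ?thesis using w0 by simp
  qed
  have "\<forall>\<^sub>F t in nhds (0::real). \<bar>t\<bar> < d" using d(1) unfolding eventually_nhds_metric by auto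
  then show ?thesis using evw
  proof eventually_elim
    case (elim t)
    have car: "\<gamma> t \<in> carrier G" "\<delta> (- t) \<in> carrier G" "\<delta> t \<in> carrier G"
      by (rule opsD(2)[OF \<gamma>] opsD(2)[OF \<delta>])+
    have "K (w t) = \<gamma> t \<otimes> \<delta> (- t)" unfolding w_def by (rule K_J[OF elim(2)])
    then have "\<gamma> t \<otimes> \<delta> (- t) = \<one>" using w[OF elim(1)] by (simp add: K_0)
    then have "\<gamma> t \<otimes> \<delta> (- t) \<otimes> \<delta> t = \<delta> t" using car by simp
    moreover have "\<gamma> t \<otimes> \<delta> (- t) \<otimes> \<delta> t = \<gamma> t"
      using car ops_inverse(2)[OF \<delta>, of t] by (simp add: m_assoc)
    ultimately show ?case by simp
  qed
qed

lemma ops_multiple: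
  assumes \<gamma>: "ops x \<gamma>" and \<delta>: "ops y \<delta>" and "\<gamma> s = \<delta> s"
  shows "\<gamma> (real n * s) = \<delta> (real n * s)"
proof (induction n)
  case 0
  then show ?case using ops_0[OF \<gamma>] ops_0[OF \<delta>] by simp
next
  case (Suc n)
  have "real (Suc n) * s = real n * s + s" by (simp add: algebra_simps)
  then show ?case using opsD(3)[OF \<gamma>, of "real n * s" s] opsD(3)[OF \<delta>, of "real n * s" s] Suc assms(3) by simp
qed

lemma ops_unique:
  assumes \<gamma>: "ops x \<gamma>" and \<delta>: "ops x \<delta>"
  shows "\<gamma> = \<delta>"
proof
  fix t
  obtain d where d: "d > 0" "\<And>t. \<bar>t\<bar> < d \<Longrightarrow> \<gamma> t = \<delta> t"
    using ops_unique_near_0[OF assms] unfolding eventually_nhds_metric dist_norm by auto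
  obtain n :: nat where n: "\<bar>t\<bar> / d < real n" using reals_Archimedean2 by blast
  have n0: "real n > 0" using n d(1) by (smt (verit) divide_nonneg_pos abs_ge_zero)
  have "\<bar>t / real n\<bar> < d" using n n0 d(1) by (simp add: field_simps)
  from ops_multiple[OF assms d(2)[OF this], of n] show "\<gamma> t = \<delta> t" using n0 by simp
qed

lemma ops_const: "ops 0 (\<lambda>t. \<one>)"
  unfolding one_parameter_subgroup_def smooth_map_real_iff
proof (intro conjI ballI allI)
  have "\<one> \<in> topspace (mtop M)" using carrier_eq one_closed by metis
  then show "continuous_map euclideanreal (mtop M) (\<lambda>t. \<one>)" by simp
  show "smooth_on {t. \<one> \<in> fst d} (\<lambda>t. snd d \<one>)" for d :: "('a, 'e) chart" unfolding smooth_on_def by (simp add: Ck_on_const)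
qed simp_all

lemma ops_scale:
  assumes \<gamma>: "ops x \<gamma>" shows "ops (r *\<^sub>R x) (\<lambda>t. \<gamma> (r * t))"
  unfolding one_parameter_subgroup_def smooth_map_real_iff
proof (intro conjI ballI allI)
  have s: "continuous_map euclideanreal (mtop M) \<gamma>"
    "\<And>d. d \<in> atlas M \<Longrightarrow> smooth_on {t. \<gamma> t \<in> fst d} (\<lambda>t. snd d (\<gamma> t))"
    using opsD(1)[OF \<gamma>] unfolding smooth_map_real_iff by blast+
  have "continuous_map euclideanreal euclideanreal (\<lambda>t. r * t)"
    by (simp add: continuous_on_mult_left)
  from continuous_map_compose[OF this s(1)]
  show "continuous_map euclideanreal (mtop M) (\<lambda>t. \<gamma> (r * t))" by (simp add: comp_def)
  show "smooth_on {t. \<gamma> (r * t) \<in> fst d} (\<lambda>t. snd d (\<gamma> (r * t)))" if d: "d \<in> atlas M" for d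
  proof -
    have "openin (mtop M) (fst d)" using atlas_charts[OF d] by blast
    from openin_continuous_map_preimage[OF s(1) this] have "open {t. \<gamma> t \<in> fst d}" by simp
    from Ck_on_scale[OF this] s(2)[OF d] show ?thesis unfolding smooth_on_def by auto
  qed
  show "\<gamma> (r * t) \<in> carrier G" for t by (rule opsD(2)[OF \<gamma>])
  show "\<gamma> (r * (s + t)) = \<gamma> (r * s) \<otimes> \<gamma> (r * t)" for s t
    using opsD(3)[OF \<gamma>, of "r * s" "r * t"] by (simp add: distrib_left)
  have "((\<lambda>t. r * t) has_vector_derivative r) (at 0)"
    by (auto intro!: derivative_eq_intros simp: has_vector_derivative_def)
  moreover have "((\<lambda>t. snd c (\<gamma> t)) has_derivative (\<lambda>h. h *\<^sub>R x)) (at (r * 0))"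
    using opsD(4)[OF \<gamma>] unfolding has_vector_derivative_def by simp
  ultimately show "((\<lambda>t. snd c (\<gamma> (r * t))) has_vector_derivative r *\<^sub>R x) (at 0)"
    by (rule has_vector_derivative_chain)
qed

lemma lie_exp_eq: assumes "ops x \<gamma>" shows "lie_exp G M c x = \<gamma> 1"
proof -
  have "(THE \<gamma>. ops x \<gamma>) = \<gamma>" by (rule the_equality, rule assms, rule ops_unique[OF _ assms])
  then show ?thesis unfolding lie_exp_def by simp
qed

lemma openin_coord_preimage:
  assumes "open S" shows "openin (mtop M) {g \<in> fst c. J g \<in> S}"
proof -
  have "continuous_map (subtopology (mtop M) (fst c)) (top_of_set (snd c ` fst c)) (snd c)"
    using c_chart homeomorphic_imp_continuous_map unfolding chart_on_def by blast
  then have cont: "continuous_map (subtopology (mtop M) (fst c)) euclidean (snd c)"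
    by (simp add: continuous_map_in_subtopology)
  have "open ((\<lambda>y. y - snd c \<one>) -` S)" by (rule open_vimage[OF assms]) (intro continuous_intros)
  from openin_continuous_map_preimage[OF cont open_openin[THEN iffD1, OF this]]
  have "openin (subtopology (mtop M) (fst c))
      {g \<in> topspace (subtopology (mtop M) (fst c)). snd c g \<in> (\<lambda>y. y - snd c \<one>) -` S}" .
  also have "{g \<in> topspace (subtopology (mtop M) (fst c)). snd c g \<in> (\<lambda>y. y - snd c \<one>) -` S}
      = {g \<in> fst c. J g \<in> S}"
  proof -
    have "topspace (subtopology (mtop M) (fst c)) = fst c"
      using openin_subset[OF c_open] unfolding topspace_subtopology by blast
    then show ?thesis unfolding coord_def by simp
  qed
  finally show ?thesis using openin_trans_full[OF _ c_open] by blast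
qed

end

locale lie_group_exp = lie_group_chart G M c
  for G :: "('a, 'm) monoid_scheme" (structure)
    and M :: "('a, 'e::{real_normed_vector, heine_borel}) manifold" and c :: "('a, 'e) chart" +
  fixes E :: "'e set"
  assumes exp_nbhd_E: "exp_nbhd G M c E"
begin

abbreviation ex :: "'e \<Rightarrow> 'a" where "ex \<equiv> lie_exp G M c"

lemma E_open: "open E" and E_0: "0 \<in> E" and exp_open: "openin (mtop M) (ex ` E)"
  and exp_homeo: "homeomorphic_map (top_of_set E) (subtopology (mtop M) (ex ` E)) ex"
  using exp_nbhd_E unfolding exp_nbhd_def by blast+

lemma exp_inj: "inj_on ex E"
  using homeomorphic_imp_injective_map[OF exp_homeo] by simp

text \<open>A vector without a one-parameter subgroup is non-zero, and none of its non-zero multiples has one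
either. At all of them the definite description in \<open>lie_exp\<close> is the same term, against the injectivity
of the exponential map near 0.\<close>

lemma ops_exists: "\<exists>\<gamma>. ops x \<gamma>"
proof (rule ccontr)
  assume no: "\<not> ?thesis"
  then have x: "x \<noteq> 0" using ops_const by blast
  obtain r where r: "r > 0" "\<And>y. norm y < r \<Longrightarrow> y \<in> E"
    using E_open E_0 unfolding open_dist dist_norm by fastforce
  have none: "ops (s *\<^sub>R x) = (\<lambda>\<gamma>. False)" if "s \<noteq> 0" for s
  proof (rule ext, rule ccontr)
    fix \<gamma> assume "ops (s *\<^sub>R x) \<gamma> \<noteq> False"
    then have "ops ((1 / s) *\<^sub>R s *\<^sub>R x) (\<lambda>t. \<gamma> (1 / s * t))" by (intro ops_scale) simp
    then show False using no that by simp
  qed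
  \<comment> \<open>two distinct multiples of \<open>x\<close> in \<open>E\<close> at which the description is the same meaningless term\<close>
  define s where "s = r / (2 * norm x)"
  have s: "s > 0" using r x by (simp add: s_def)
  have "norm (s *\<^sub>R x) < r" using x r by (simp add: s_def)
  moreover have "norm ((s / 2) *\<^sub>R x) < r" using x r by (simp add: s_def)
  ultimately have E: "s *\<^sub>R x \<in> E" "(s / 2) *\<^sub>R x \<in> E" using r(2) by blast+
  have "ex (s *\<^sub>R x) = ex ((s / 2) *\<^sub>R x)" unfolding lie_exp_def using none[of s] none[of "s / 2"] s by simp
  from inj_onD[OF exp_inj this E] show False using x s by simp
qed

lemma ops_exp: "ops x (\<lambda>t. ex (t *\<^sub>R x))"
proof -
  obtain \<gamma> where \<gamma>: "ops x \<gamma>" using ops_exists by blast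
  have "ex (t *\<^sub>R x) = \<gamma> t" for t using lie_exp_eq[OF ops_scale[OF \<gamma>, of t]] by simp
  then show ?thesis using \<gamma> by simp
qed

lemma exp_0: "ex 0 = \<one>"
  using ops_0[OF ops_exp[of 0]] by simp

lemma exp_eventually:
  assumes "\<forall>\<^sub>F u in nhds 0. P u"
  shows "\<forall>\<^sub>F x in nhds 0. ex x \<in> fst c \<and> P (J (ex x))"
proof -
  obtain S where S: "open S" "0 \<in> S" "\<And>u. u \<in> S \<Longrightarrow> P u" using assms unfolding eventually_nhds by blast
  let ?U = "{g \<in> fst c. J g \<in> S}"
  have "continuous_map (top_of_set E) (mtop M) ex"
    using homeomorphic_imp_continuous_map[OF exp_homeo] by (simp add: continuous_map_in_subtopology)
  from openin_continuous_map_preimage[OF this openin_coord_preimage[OF S(1)]]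
  have "openin (top_of_set E) {x \<in> E. ex x \<in> ?U}" by simp
  then have "open {x \<in> E. ex x \<in> ?U}" using E_open openin_open_trans by blast
  moreover have "0 \<in> {x \<in> E. ex x \<in> ?U}" using E_0 one_in_c S(2) by (simp add: exp_0)
  ultimately have "\<forall>\<^sub>F x in nhds 0. x \<in> {x \<in> E. ex x \<in> ?U}" by (rule eventually_nhds_in_open)
  then show ?thesis
  proof eventually_elim
    case (elim x)
    then show ?case using S(3) by blast
  qed
qed

text \<open>In the chart \<open>g t = exp (t x)\<close> solves \<open>g' = V g x\<close> with \<open>V u x = x + B u x + o(u) x\<close>. Since the exponential
map is continuous at 0, \<open>g\<close> stays near the origin for \<open>t\<close> between 0 and 1, uniformly for small \<open>x\<close>.
The mean value inequality then gives, in turn, \<open>|g| \<le> 2 |x|\<close>, \<open>|g - t x| = O(|x|\<^sup>2)\<close> and the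
expansion.\<close>

lemma exp_jet: "jet2 (\<lambda>x. J (ex x)) (\<lambda>x. x) (\<lambda>x y. (1/2) *\<^sub>R B x y)"
proof -
  interpret B: bounded_bilinear B by (rule B_bilinear)
  let ?X = "\<lambda>x. J (ex x)" and ?V = "\<lambda>u. fd (mul u) 0"
  have X0: "?X 0 = 0" by (simp add: exp_0)
  obtain k where k: "k > 0" "\<And>a b. norm (B a b) \<le> norm a * norm b * k" using B.pos_bounded by blast
  have V: "\<forall>\<^sub>F u in nhds 0. \<forall>y. norm (?V u y - y - B u y) \<le> e * norm u * norm y" if "e > 0" for e
    using mixed_deriv_increment_right[OF fin fin mul_smooth that] unfolding fd_mul_0 B_def .
  have diff: "\<forall>\<^sub>F u in nhds 0. (mul u has_derivative ?V u) (at 0)"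
    by (rule partial_differentiable_right[OF fin fin mul_smooth])
  let ?ok = "\<lambda>e x. \<forall>t\<in>{0..1}. ((\<lambda>t. ?X (t *\<^sub>R x)) has_vector_derivative ?V (?X (t *\<^sub>R x)) x) (at t) \<and>
      norm (?V (?X (t *\<^sub>R x)) x - x - B (?X (t *\<^sub>R x)) x) \<le> e * norm (?X (t *\<^sub>R x)) * norm x
      \<and> norm (?X (t *\<^sub>R x)) \<le> 1 / (k + 1)"
  have ok: "\<forall>\<^sub>F x in nhds 0. ?ok e x" if e: "e > 0" for e
  proof -
    have "\<forall>\<^sub>F u in nhds (0::'e). norm u \<le> 1 / (k + 1)"
      unfolding eventually_nhds_metric using k(1) by (intro exI[of _ "1 / (k + 1)"]) auto
    from eventually_nhds_star[OF exp_eventually[OF eventually_conj[OF eventually_conj[OF diff V[OF e]] this]]]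
    show ?thesis
    proof eventually_elim
      case (elim x)
      show ?case
      proof
        fix t :: real assume t: "t \<in> {0..1}"
        have a: "ex (t *\<^sub>R x) \<in> fst c" "(mul (?X (t *\<^sub>R x)) has_derivative ?V (?X (t *\<^sub>R x))) (at 0)"
          "norm (?V (?X (t *\<^sub>R x)) x - x - B (?X (t *\<^sub>R x)) x) \<le> e * norm (?X (t *\<^sub>R x)) * norm x"
          "norm (?X (t *\<^sub>R x)) \<le> 1 / (k + 1)"
          using elim t by blast+
        from ops_coord_derivative[OF ops_exp a(1,2)] a(3,4)
        show "((\<lambda>t. ?X (t *\<^sub>R x)) has_vector_derivative ?V (?X (t *\<^sub>R x)) x) (at t) \<and>
          norm (?V (?X (t *\<^sub>R x)) x - x - B (?X (t *\<^sub>R x)) x) \<le> e * norm (?X (t *\<^sub>R x)) * norm x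
          \<and> norm (?X (t *\<^sub>R x)) \<le> 1 / (k + 1)" by blast
      qed
    qed
  qed
  have first: "norm (?V u x - x) \<le> (k + 1) * norm u * norm x"
    if "norm (?V u x - x - B u x) \<le> 1 * norm u * norm x" for u x
  proof -
    have "norm (?V u x - x) \<le> norm (?V u x - x - B u x) + norm (B u x)"
      using norm_triangle_ineq[of "?V u x - x - B u x" "B u x"] by simp
    also have "\<dots> \<le> 1 * norm u * norm x + norm u * norm x * k" by (intro add_mono that k(2))
    finally show ?thesis by (simp add: algebra_simps)
  qed
  have bound1: "\<forall>\<^sub>F x in nhds 0. norm (?X x) \<le> 2 * norm x"
    using ok[OF zero_less_one]
  proof eventually_elim
    case (elim x)
    have "norm (?X (1 *\<^sub>R x) - ?X (0 *\<^sub>R x)) \<le> (2 * norm x) * 1"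
    proof (rule vector_derivative_bound[where g="\<lambda>t. ?X (t *\<^sub>R x)" and g'="\<lambda>t. ?V (?X (t *\<^sub>R x)) x"])
      show "((\<lambda>t. ?X (t *\<^sub>R x)) has_vector_derivative ?V (?X (t *\<^sub>R x)) x) (at t)" if "t \<in> {0..1}" for t
        using elim that by blast
      show "norm (?V (?X (t *\<^sub>R x)) x) \<le> 2 * norm x" if t: "t \<in> {0..1}" for t
      proof -
        let ?u = "?X (t *\<^sub>R x)"
        have "norm (?V ?u x - x) \<le> (k + 1) * norm ?u * norm x" using first elim t by blast
        also have "\<dots> \<le> (k + 1) * (1 / (k + 1)) * norm x"
          using elim t k(1) by (intro mult_right_mono mult_left_mono) auto
        also have "\<dots> = norm x" using k(1) by simp
        finally show ?thesis using norm_triangle_ineq[of "?V ?u x - x" x] by simp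
      qed
    qed simp
    then show ?case by (simp add: exp_0)
  qed
  have bound2: "\<forall>\<^sub>F x in nhds 0. norm (?X x - x) \<le> 2 * (k + 1) * (norm x)\<^sup>2"
    using ok[OF zero_less_one] eventually_nhds_star[OF bound1]
  proof eventually_elim
    case (elim x)
    have "norm ((?X (1 *\<^sub>R x) - 1 *\<^sub>R x) - (?X (0 *\<^sub>R x) - 0 *\<^sub>R x)) \<le> (2 * (k + 1) * (norm x)\<^sup>2) * 1"
    proof (rule vector_derivative_bound[where g="\<lambda>t. ?X (t *\<^sub>R x) - t *\<^sub>R x" and g'="\<lambda>t. ?V (?X (t *\<^sub>R x)) x - x"])
      show "((\<lambda>t. ?X (t *\<^sub>R x) - t *\<^sub>R x) has_vector_derivative ?V (?X (t *\<^sub>R x)) x - x) (at t)" if t: "t \<in> {0..1}" for t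
      proof (rule has_vector_derivative_diff)
        show "((\<lambda>t. ?X (t *\<^sub>R x)) has_vector_derivative ?V (?X (t *\<^sub>R x)) x) (at t)" using elim t by blast
        show "((\<lambda>t. t *\<^sub>R x) has_vector_derivative x) (at t)"
          by (auto intro!: derivative_eq_intros simp: has_vector_derivative_def)
      qed
      show "norm (?V (?X (t *\<^sub>R x)) x - x) \<le> 2 * (k + 1) * (norm x)\<^sup>2" if t: "t \<in> {0..1}" for t
      proof -
        let ?u = "?X (t *\<^sub>R x)"
        have "norm ?u \<le> 2 * norm (t *\<^sub>R x)" using elim(2) t by blast
        also have "\<dots> \<le> 2 * (1 * norm x)" unfolding norm_scaleR using t by (intro mult_left_mono mult_right_mono) auto
        finally have u: "norm ?u \<le> 2 * norm x" by simp
        have "norm (?V ?u x - x) \<le> (k + 1) * norm ?u * norm x" using first elim(1) t by blast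
        also have "\<dots> \<le> (k + 1) * (2 * norm x) * norm x"
          using u k(1) by (intro mult_right_mono mult_left_mono) auto
        finally show ?thesis by (simp add: power2_eq_square mult_ac)
      qed
    qed simp
    then show ?case by (simp add: exp_0)
  qed
  have "quad_small (\<lambda>x. ?X x - x - (1/2) *\<^sub>R B x x)"
    unfolding quad_small_def
  proof (intro allI impI)
    fix e :: real assume e: "e > 0"
    \<comment> \<open>the error term \<open>B (?X (t x) - t x) x\<close> is cubic; this radius makes it at most \<open>e / 2\<close> of the square\<close>
    define \<rho> where "\<rho> = e / (4 * ((k + 1) * k))"
    have \<rho>: "\<rho> > 0" using e k(1) by (simp add: \<rho>_def)
    have "e / 4 > 0" using e by simp
    have sm: "\<forall>\<^sub>F x in nhds (0::'e). norm x < \<rho>" unfolding eventually_nhds_metric using \<rho> by auto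
    show "\<forall>\<^sub>F x in nhds 0. norm (?X x - x - (1/2) *\<^sub>R B x x) \<le> e * (norm x)\<^sup>2"
      using ok[OF \<open>e / 4 > 0\<close>] eventually_nhds_star[OF bound1] eventually_nhds_star[OF bound2] sm
    proof eventually_elim
      case (elim x)
      let ?g' = "\<lambda>t. ?V (?X (t *\<^sub>R x)) x - x - t *\<^sub>R B x x"
      have "norm ((?X (1 *\<^sub>R x) - 1 *\<^sub>R x - (1\<^sup>2/2) *\<^sub>R B x x) - (?X (0 *\<^sub>R x) - 0 *\<^sub>R x - (0\<^sup>2/2) *\<^sub>R B x x)) \<le> (e * (norm x)\<^sup>2) * 1"
      proof (rule vector_derivative_bound[where g="\<lambda>t. ?X (t *\<^sub>R x) - t *\<^sub>R x - (t\<^sup>2/2) *\<^sub>R B x x" and g'="?g'"])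
        show "((\<lambda>t. ?X (t *\<^sub>R x) - t *\<^sub>R x - (t\<^sup>2/2) *\<^sub>R B x x) has_vector_derivative ?g' t) (at t)" if t: "t \<in> {0..1}" for t
        proof (intro has_vector_derivative_diff)
          show "((\<lambda>t. ?X (t *\<^sub>R x)) has_vector_derivative ?V (?X (t *\<^sub>R x)) x) (at t)" using elim(1) t by blast
          show "((\<lambda>t. t *\<^sub>R x) has_vector_derivative x) (at t)"
            by (auto intro!: derivative_eq_intros simp: has_vector_derivative_def)
          show "((\<lambda>t. (t\<^sup>2/2) *\<^sub>R B x x) has_vector_derivative t *\<^sub>R B x x) (at t)"
            by (auto intro!: derivative_eq_intros simp: has_vector_derivative_def)
        qed
        show "norm (?g' t) \<le> e * (norm x)\<^sup>2" if t: "t \<in> {0..1}" for t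
        proof -
          let ?u = "?X (t *\<^sub>R x)"
          have tx: "norm (t *\<^sub>R x) \<le> norm x" unfolding norm_scaleR using t mult_right_mono[of "\<bar>t\<bar>" 1 "norm x"] by simp
          have "norm ?u \<le> 2 * norm (t *\<^sub>R x)" using elim(2) t by blast
          then have u: "norm ?u \<le> 2 * norm x" using tx by simp
          have "norm (?u - t *\<^sub>R x) \<le> 2 * (k + 1) * (norm (t *\<^sub>R x))\<^sup>2" using elim(3) t by blast
          also have "\<dots> \<le> 2 * (k + 1) * (norm x)\<^sup>2"
            using k(1) by (intro mult_left_mono power_mono[OF tx]) auto
          finally have u2: "norm (?u - t *\<^sub>R x) \<le> 2 * (k + 1) * (norm x)\<^sup>2" .
          have "norm (?V ?u x - x - B ?u x) \<le> e / 4 * norm ?u * norm x" using elim(1) t by blast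
          also have "\<dots> \<le> e / 4 * (2 * norm x) * norm x"
            using u e by (intro mult_right_mono mult_left_mono) auto
          finally have 1: "norm (?V ?u x - x - B ?u x) \<le> e / 2 * (norm x)\<^sup>2" by (simp add: power2_eq_square)
          have "norm (B (?u - t *\<^sub>R x) x) \<le> norm (?u - t *\<^sub>R x) * norm x * k" by (rule k(2))
          also have "\<dots> \<le> (2 * (k + 1) * (norm x)\<^sup>2) * \<rho> * k"
            using u2 elim(4) k(1) by (intro mult_right_mono mult_mono) auto
          also have "\<dots> = (2 * (k + 1) * k * \<rho>) * (norm x)\<^sup>2" by (simp only: mult_ac)
          also have "2 * (k + 1) * k * \<rho> = e / 2"
          proof -
            have "2 * q * (e / (4 * q)) = e / 2" if "q > 0" for q :: real using that by simp
            moreover have "(k + 1) * k > 0" using k(1) by simp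
            ultimately have "2 * ((k + 1) * k) * \<rho> = e / 2" unfolding \<rho>_def .
            then show ?thesis by (simp only: mult.assoc)
          qed
          finally have 2: "norm (B (?u - t *\<^sub>R x) x) \<le> e / 2 * (norm x)\<^sup>2" .
          have "?g' t = (?V ?u x - x - B ?u x) + B (?u - t *\<^sub>R x) x"
            by (simp add: B.diff_left B.scaleR_left)
          then have "norm (?g' t) \<le> norm (?V ?u x - x - B ?u x) + norm (B (?u - t *\<^sub>R x) x)"
            by (simp only: norm_triangle_ineq)
          also have "\<dots> \<le> e / 2 * (norm x)\<^sup>2 + e / 2 * (norm x)\<^sup>2" by (rule add_mono[OF 1 2])
          finally show ?thesis by simp
        qed
      qed simp
      then show ?case by (simp add: exp_0)
    qed
  qed
  then show ?thesis unfolding jet2_def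
    using bounded_linear_ident bounded_linear_bilinear_compose[OF bounded_linear_scaleR_right B_bilinear] by blast
qed

lemma exp_curve_derivative: "((\<lambda>t. J (ex (t *\<^sub>R x))) has_vector_derivative x) (at 0)"
  by (rule ops_coord_derivative_0[OF ops_exp])

lemma exp_curve_eventually: "\<forall>\<^sub>F t in nhds 0. ex (t *\<^sub>R x) \<in> fst c"
  by (rule ops_eventually[OF ops_exp]) (simp add: exp_0 one_in_c)

lemma derivative_along_exp:
  assumes "((\<lambda>u. f (K u)) has_derivative D) (at 0)"
  shows "((\<lambda>t. f (ex (t *\<^sub>R x))) has_vector_derivative D x) (at 0)"
proof -
  have "((\<lambda>u. f (K u)) has_derivative D) (at (J (ex (0 *\<^sub>R x))))"
    unfolding scaleR_zero_left exp_0 coord_self by (rule assms)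
  note 1 = has_vector_derivative_chain[OF exp_curve_derivative this]
  have "\<forall>\<^sub>F t in nhds 0. f (K (J (ex (t *\<^sub>R x)))) = f (ex (t *\<^sub>R x))"
    using exp_curve_eventually[of x] by eventually_elim (simp add: K_J)
  from has_vector_derivative_eventually_cong[OF 1 this] show ?thesis .
qed

lemma tangent_map_has_derivative:
  assumes "((\<lambda>u. coord d q (F (K u))) has_derivative D) (at 0)"
  shows "((\<lambda>t. snd d (F (ex (t *\<^sub>R x)))) has_vector_derivative D x) (at 0)"
    and "tangent_map G M c d F x = D x"
proof -
  have "((\<lambda>u. coord d q (F (K u)) + snd d q) has_derivative (\<lambda>x. D x + 0)) (at 0)"
    by (rule has_derivative_add[OF assms has_derivative_const])
  then have "((\<lambda>u. snd d (F (K u))) has_derivative D) (at 0)"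
    unfolding coord_def diff_add_cancel add_0_right .
  from derivative_along_exp[OF this]
  show *: "((\<lambda>t. snd d (F (ex (t *\<^sub>R x)))) has_vector_derivative D x) (at 0)" .
  show "tangent_map G M c d F x = D x"
    unfolding tangent_map_def by (rule vector_derivative_at[OF *])
qed

end

section \<open>Twisted post-Lie groups\<close>

context twisted_post_lie_group
begin

lemma rhd_hom: "a \<in> carrier G \<Longrightarrow> rhd a \<in> hom G G"
  using rhd_automorphism unfolding iso_def by blast

lemma rhd_closed: "a \<in> carrier G \<Longrightarrow> b \<in> carrier G \<Longrightarrow> rhd a b \<in> carrier G"
  by (rule hom_in_carrier[OF rhd_hom])

lemma rhd_inj: "a \<in> carrier G \<Longrightarrow> inj_on (rhd a) (carrier G)"
  using rhd_automorphism unfolding iso_def bij_betw_def by blast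

lemma rhd_one_right: "a \<in> carrier G \<Longrightarrow> rhd a \<one> = \<one>"
  using hom_one[OF rhd_hom is_group is_group] .

lemma Phi_carrier: "a \<in> carrier G \<Longrightarrow> \<Phi> a \<in> carrier G"
  using Phi_closed by blast

lemma Phi_one: "\<Phi> \<one> = \<one>"
proof -
  have "\<Phi> (\<Phi> \<one>) = \<Phi> \<one> \<otimes> rhd \<one> (\<Phi> \<one>)"
    using Phi_circ[of \<one> \<one>] Phi_carrier[of \<one>] by (simp add: twisted_circ_def rhd_one_right)
  then have "\<Phi> \<one> = \<Phi> \<one> \<otimes> rhd \<one> (\<Phi> \<one>)" using Phi_idem[of \<one>] by simp
  then have "rhd \<one> (\<Phi> \<one>) = \<one>"
    using l_cancel_one[of "\<Phi> \<one>" "rhd \<one> (\<Phi> \<one>)"] Phi_carrier[of \<one>] rhd_closed[of \<one> "\<Phi> \<one>"] by simp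
  then have "rhd \<one> (\<Phi> \<one>) = rhd \<one> \<one>" by (simp add: rhd_one_right)
  from inj_onD[OF rhd_inj this] show ?thesis using Phi_carrier[of \<one>] by simp
qed

lemma rhd_Phi_rhd_one: "a \<in> carrier G \<Longrightarrow> b \<in> carrier G \<Longrightarrow> rhd (\<Phi> a) b = rhd a (rhd \<one> b)"
  using circ_rhd[of a \<one> b] Phi_carrier[of a] by (simp add: twisted_circ_def rhd_one_right)

lemma rhd_one_left: assumes b: "b \<in> carrier G" shows "rhd \<one> b = b"
proof -
  have "rhd \<one> (rhd \<one> b) = rhd \<one> b" using rhd_Phi_rhd_one[of \<one> b] b by (simp add: Phi_one)
  from inj_onD[OF rhd_inj this] show ?thesis using b rhd_closed[of \<one> b] by simp
qed

text \<open>From \<open>\<Phi>\<^sup>2 = \<Phi>\<close> follows \<open>\<Phi> \<one> = \<one>\<close>, so that \<open>a \<circ> \<one> = \<Phi> a\<close> and \<open>\<one>\<close> acts trivially.\<close>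

lemma rhd_Phi: "a \<in> carrier G \<Longrightarrow> b \<in> carrier G \<Longrightarrow> rhd (\<Phi> a) b = rhd a b"
  using rhd_Phi_rhd_one rhd_one_left by simp

end

lemma eventually_fst_snd_0:
  assumes "\<forall>\<^sub>F a in nhds 0. P a" "\<forall>\<^sub>F b in nhds 0. Q b"
  shows "\<forall>\<^sub>F z in nhds (0::'a::real_normed_vector \<times> 'b::real_normed_vector). P (fst z) \<and> Q (snd z)"
proof -
  have "filterlim fst (nhds 0) (nhds (0::'a \<times> 'b))" "filterlim snd (nhds 0) (nhds (0::'a \<times> 'b))"
    by (intro lin_bound_tendsto lin_bound_linear bounded_linear_fst bounded_linear_snd)+
  from eventually_conj[OF eventually_compose_filterlim[OF assms(1) this(1)]
      eventually_compose_filterlim[OF assms(2) this(2)]] show ?thesis .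
qed

text \<open>\<open>E\<close> and \<open>H\<close> are the data that the condition on the Hessian provides for the chart \<open>c\<close>.\<close>

locale twisted_post_lie_group_chart = twisted_post_lie_group G M rhd \<Phi> + lie_group_exp G M c E
  for G :: "('a, 'm) monoid_scheme" (structure)
    and M :: "('a, 'e::{real_normed_vector, heine_borel}) manifold" and rhd \<Phi>
    and c :: "('a, 'e) chart" and E +
  fixes H :: "'e \<Rightarrow> 'e \<Rightarrow> 'e"
  assumes hessian: "is_exp_hessian G M c E \<Phi> H"
    and hessian_sym: "H (tangent_map G M c c \<Phi> x) y = H x (tangent_map G M c c \<Phi> y)"
begin

definition rhdc :: "'e \<Rightarrow> 'e \<Rightarrow> 'e" where "rhdc u v = J (rhd (K u) (K v))"
definition Phic :: "'e \<Rightarrow> 'e" where "Phic u = J (\<Phi> (K u))"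
definition \<phi> :: "'e \<Rightarrow> 'e" where "\<phi> = fd Phic 0"
definition T :: "'e \<Rightarrow> 'e \<Rightarrow> 'e" where "T = mixed_deriv rhdc"
definition Q :: "'e \<Rightarrow> 'e \<Rightarrow> 'e" where "Q x y = (1/2) *\<^sub>R second_deriv Phic 0 x y"
text \<open>The composition \<open>a \<circ> b = \<Phi> a \<otimes> (a \<rhd> b)\<close> in the chart (\<open>ev_circ\<close>).\<close>

definition circc :: "'e \<Rightarrow> 'e \<Rightarrow> 'e" where "circc a b = mul (Phic a) (rhdc a b)"

lemma K_carrier: "\<forall>\<^sub>F u in nhds 0. K u \<in> carrier G"
  using ev_K by (rule eventually_mono) (blast intro: c_carrier)

lemma rh_smooth: "smooth2_near_0 rhdc"
  and ev_rh: "\<forall>\<^sub>F z in nhds (0, 0). rhd (K (fst z)) (K (snd z)) \<in> fst c"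
proof -
  have "rhd \<one> \<one> = \<one>" by (simp add: rhd_one_right)
  from smooth2_op[OF smooth_rhd this]
  show "smooth2_near_0 rhdc" "\<forall>\<^sub>F z in nhds (0, 0). rhd (K (fst z)) (K (snd z)) \<in> fst c"
    unfolding rhdc_def[abs_def] .
qed

lemma rh_0_right: "\<forall>\<^sub>F u in nhds 0. rhdc u 0 = 0"
  using K_carrier by eventually_elim (simp add: rhdc_def K_0 rhd_one_right)

lemma rh_0_left: "\<forall>\<^sub>F v in nhds 0. rhdc 0 v = v"
  using ev_K by eventually_elim (simp add: rhdc_def K_0 rhd_one_left c_carrier)

lemma jet_rh: "jet2_binary rhdc (\<lambda>u. 0) (\<lambda>v. v) T"
  unfolding T_def
  by (rule jet2_binary_mixed_deriv[OF fin fin rh_smooth bounded_linear_zero rh_0_right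
        bounded_linear_ident rh_0_left])

lemma T_bilinear: "bounded_bilinear T"
  unfolding T_def by (rule bounded_bilinear_mixed_deriv[OF fin fin rh_smooth])

lemma Ph_smooth: "smooth_near 0 Phic"
  and ev_Ph: "\<forall>\<^sub>F u in nhds 0. \<Phi> (K u) \<in> fst c"
proof -
  have "\<Phi> \<one> \<in> fst c" unfolding Phi_one by (rule one_in_c)
  note s = smooth_map_centred[OF smooth_Phi c_atlas c_chart one_in_c c_atlas c_open this]
  show "smooth_near 0 Phic" using s(1) unfolding Phic_def[abs_def] Phi_one .
  show "\<forall>\<^sub>F u in nhds 0. \<Phi> (K u) \<in> fst c" by (rule s(2))
qed

lemma jet_Ph: "jet2 Phic \<phi> Q"
proof -
  have "Phic 0 = 0" by (simp add: Phic_def K_0 Phi_one)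
  then show ?thesis
    using jet2_taylor[OF fin Ph_smooth] unfolding \<phi>_def Q_def[abs_def] by simp
qed

lemma Q_sym: "Q x y = Q y x"
  unfolding Q_def second_deriv_sym[OF fin Ph_smooth, of x y] ..

lemma \<phi>_linear: "bounded_linear \<phi>"
  by (rule jet2D(1)[OF jet_Ph])

lemma tangent_map_Phi: "tangent_map G M c c \<Phi> = \<phi>"
proof
  fix x
  show "tangent_map G M c c \<Phi> x = \<phi> x"
    by (rule tangent_map_has_derivative(2)[where q=\<one>])
      (rule jet2_has_derivative[OF jet_Ph, unfolded Phic_def[abs_def]])
qed

lemma fd_rh_0: "fd (rhdc 0) 0 z = z"
proof -
  have "\<forall>\<^sub>F v in nhds 0. v = rhdc 0 v" using rh_0_left by eventually_elim simp
  from frechet_derivative_at[OF has_derivative_eventually_cong[OF has_derivative_ident this]]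
  show ?thesis by metis
qed

lemma fd_rh: "\<forall>\<^sub>F u in nhds 0. (rhdc u has_derivative fd (rhdc u) 0) (at 0)"
  by (rule partial_differentiable_right[OF fin fin rh_smooth])

text \<open>For small \<open>t\<close> the tangent map of the action of \<open>exp (t x)\<close> is the partial derivative of \<open>rhdc\<close> in its second
variable; its derivative in the first variable is the mixed derivative.\<close>

lemma tangent_map_rhd:
  shows "((\<lambda>t. tangent_map G M c c (rhd (ex (t *\<^sub>R x))) y) has_vector_derivative T x y) (at 0)"
proof -
  have "((\<lambda>u. fd (rhdc u) 0 y) has_derivative (\<lambda>x. T x y)) (at (J (ex (0 *\<^sub>R x))))"
    unfolding scaleR_zero_left exp_0 coord_self T_def
    by (rule mixed_deriv_has_derivative[OF fin fin rh_smooth])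
  from has_vector_derivative_chain[OF exp_curve_derivative this]
  have 1: "((\<lambda>t. fd (rhdc (J (ex (t *\<^sub>R x)))) 0 y) has_vector_derivative T x y) (at 0)" .
  have cont: "((\<lambda>t. J (ex (t *\<^sub>R x))) \<longlongrightarrow> 0) (nhds 0)"
    using has_vector_derivative_continuous[OF exp_curve_derivative[of x]]
      tendsto_at_iff_tendsto_nhds[of "\<lambda>t. J (ex (t *\<^sub>R x))" 0]
    unfolding continuous_within by (simp add: exp_0)
  have "\<forall>\<^sub>F t in nhds 0. fd (rhdc (J (ex (t *\<^sub>R x)))) 0 y = tangent_map G M c c (rhd (ex (t *\<^sub>R x))) y"
    using eventually_compose_filterlim[OF fd_rh cont] exp_curve_eventually[of x]
  proof eventually_elim
    case (elim t)
    have "((\<lambda>v. J (rhd (ex (t *\<^sub>R x)) (K v))) has_derivative fd (rhdc (J (ex (t *\<^sub>R x)))) 0) (at 0)"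
      using elim(1) unfolding rhdc_def[of "J (ex (t *\<^sub>R x))", abs_def] K_J[OF elim(2)] .
    from tangent_map_has_derivative(2)[OF this] show ?case ..
  qed
  from has_vector_derivative_eventually_cong[OF 1 this] show ?thesis .
qed

lemma lie_rhd_eq: "lie_rhd G M c rhd = T"
  unfolding lie_rhd_def by (intro ext vector_derivative_at tangent_map_rhd)

lemma \<phi>_idem: "\<phi> (\<phi> x) = \<phi> x"
proof -
  have "\<forall>\<^sub>F u in nhds 0. Phic (Phic u) = Phic u"
    using ev_Ph K_carrier by eventually_elim (simp add: Phic_def K_J Phi_idem)
  from jet2_unique(1)[OF jet2_cong[OF jet2_compose[OF jet_Ph jet_Ph] this] jet_Ph]
  show ?thesis by metis
qed

lemma T_\<phi>: "T (\<phi> x) y = T x y"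
proof -
  have "\<forall>\<^sub>F u in nhds 0. fd (rhdc (Phic u)) 0 y = fd (rhdc u) 0 y"
    using ev_Ph K_carrier fd_rh
  proof eventually_elim
    case (elim u)
    have "\<forall>\<^sub>F v in nhds 0. rhdc u v = rhdc (Phic u) v"
      using K_carrier
    proof eventually_elim
      case (elim v)
      then show ?case
        using \<open>\<Phi> (K u) \<in> fst c\<close> \<open>K u \<in> carrier G\<close> by (simp add: rhdc_def Phic_def K_J rhd_Phi)
    qed
    from has_derivative_eventually_cong[OF elim(3) this]
    show ?case using frechet_derivative_at by metis
  qed
  note ev = this
  have d: "((\<lambda>u. fd (rhdc u) 0 y) has_derivative (\<lambda>x. T x y)) (at 0)"
    unfolding T_def by (rule mixed_deriv_has_derivative[OF fin fin rh_smooth])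
  then have "((\<lambda>u. fd (rhdc u) 0 y) has_derivative (\<lambda>x. T x y)) (at (Phic 0))"
    unfolding jet2_zero[OF jet_Ph] .
  from has_derivative_compose[OF jet2_has_derivative[OF jet_Ph] this]
  have "((\<lambda>u. fd (rhdc (Phic u)) 0 y) has_derivative (\<lambda>x. T (\<phi> x) y)) (at 0)" .
  from has_derivative_unique[OF has_derivative_eventually_cong[OF this ev] d]
  show ?thesis by metis
qed

lemma jet_circ: "jet2 (\<lambda>z. circc (fst z) (snd z)) (\<lambda>z. \<phi> (fst z) + snd z)
  (\<lambda>z w. Q (fst z) (fst w) + T (fst z) (snd w) + B (\<phi> (fst z)) (snd w))"
proof -
  interpret \<phi>: bounded_linear \<phi> by (rule \<phi>_linear)
  have "jet2 (\<lambda>z. Phic (fst z)) (\<lambda>z. \<phi> (fst z)) (\<lambda>z w. \<phi> 0 + Q (fst z) (fst w))"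
    by (rule jet2_compose[OF jet2_linear[OF bounded_linear_fst] jet_Ph])
  from jet2_binary_compose[OF jet_mul this jet_rh] show ?thesis
    unfolding circc_def \<phi>.zero add_0_left .
qed

lemma ev_circ: "\<forall>\<^sub>F z in nhds 0. K (circc (fst z) (snd z)) = twisted_circ G rhd \<Phi> (K (fst z)) (K (snd z))
   \<and> \<Phi> (K (fst z)) \<otimes> rhd (K (fst z)) (K (snd z)) \<in> fst c"
proof -
  have l: "filterlim (\<lambda>z. (Phic (fst z), rhdc (fst z) (snd z))) (nhds 0) (nhds 0)"
    by (rule lin_bound_tendsto[OF jet2_lin_bound[OF jet2_Pair[OF
            jet2_compose[OF jet2_linear[OF bounded_linear_fst] jet_Ph] jet_rh]]])
  have ev_fst: "\<forall>\<^sub>F z in nhds (0::'e \<times> 'e). \<Phi> (K (fst z)) \<in> fst c \<and> True"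
    by (rule eventually_fst_snd_0[OF ev_Ph]) simp
  from eventually_compose_filterlim[OF ev_mul[folded zero_prod_def] l] ev_fst ev_rh[folded zero_prod_def]
  show ?thesis
    by eventually_elim (simp add: circc_def mul_def twisted_circ_def Phic_def rhdc_def K_J)
qed

text \<open>The part of \<open>\<Phi> (a \<circ> b) = a \<circ> \<Phi> b\<close> that is bilinear in \<open>a\<close> and \<open>b\<close>. It is obtained from equality of the
quadratic forms at \<open>(a, b)\<close> by subtracting those at \<open>(a, 0)\<close> and \<open>(0, b)\<close>.\<close>

lemma phi_circ_relation:
  "\<phi> (T a b + B (\<phi> a) b) + 2 *\<^sub>R Q (\<phi> a) b = T a (\<phi> b) + B (\<phi> a) (\<phi> b)"
proof -
  interpret \<phi>: bounded_linear \<phi> by (rule \<phi>_linear)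
  interpret Q: bounded_bilinear Q by (rule jet2D(2)[OF jet_Ph])
  interpret T: bounded_bilinear T by (rule T_bilinear)
  interpret B: bounded_bilinear B by (rule B_bilinear)
  let ?q = "\<lambda>z w. Q (fst z) (fst w) + T (fst z) (snd w) + B (\<phi> (fst z)) (snd w)"
  have 1: "jet2 (\<lambda>z. Phic (circc (fst z) (snd z))) (\<lambda>z. \<phi> (\<phi> (fst z) + snd z))
    (\<lambda>z w. \<phi> (?q z w) + Q (\<phi> (fst z) + snd z) (\<phi> (fst w) + snd w))"
    by (rule jet2_compose[OF jet_circ jet_Ph])
  have j: "jet2 (\<lambda>z. (fst z, Phic (snd z))) (\<lambda>z. (fst z, \<phi> (snd z))) (\<lambda>z w. (0, \<phi> 0 + Q (snd z) (snd w)))"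
    by (rule jet2_Pair[OF jet2_linear[OF bounded_linear_fst]
          jet2_compose[OF jet2_linear[OF bounded_linear_snd] jet_Ph]])
  note 2 = jet2_compose[OF j jet_circ, unfolded fst_conv snd_conv]
  have "\<forall>\<^sub>F z in nhds 0. Phic (circc (fst z) (snd z)) = circc (fst z) (Phic (snd z))"
  proof -
    have l: "filterlim (\<lambda>z::'e \<times> 'e. (fst z, Phic (snd z))) (nhds 0) (nhds 0)"
      by (rule lin_bound_tendsto[OF jet2_lin_bound[OF j]])
    from eventually_compose_filterlim[OF ev_circ l]
    have "\<forall>\<^sub>F z in nhds 0. K (circc (fst z) (Phic (snd z))) = twisted_circ G rhd \<Phi> (K (fst z)) (K (Phic (snd z)))
      \<and> \<Phi> (K (fst z)) \<otimes> rhd (K (fst z)) (K (Phic (snd z))) \<in> fst c" unfolding fst_conv snd_conv .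
    moreover from eventually_compose_filterlim[OF ev_rh[folded zero_prod_def] l]
    have "\<forall>\<^sub>F z in nhds 0. rhd (K (fst z)) (K (Phic (snd z))) \<in> fst c" unfolding fst_conv snd_conv .
    moreover have "\<forall>\<^sub>F z in nhds (0::'e \<times> 'e). (\<Phi> (K (fst z)) \<in> fst c \<and> K (fst z) \<in> carrier G) \<and>
        (\<Phi> (K (snd z)) \<in> fst c \<and> K (snd z) \<in> carrier G)"
      by (rule eventually_fst_snd_0[OF eventually_conj[OF ev_Ph K_carrier] eventually_conj[OF ev_Ph K_carrier]])
    ultimately show ?thesis using ev_circ
    proof eventually_elim
      case (elim z)
      let ?a = "K (fst z)" and ?b = "K (snd z)"
      have Kb: "K (Phic (snd z)) = \<Phi> ?b" using elim(3) by (simp add: Phic_def K_J)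
      have ab: "?a \<in> carrier G" "?b \<in> carrier G" using elim(3) by auto
      have "Phic (circc (fst z) (snd z)) = J (\<Phi> (twisted_circ G rhd \<Phi> ?a ?b))"
        using elim(4) by (simp add: Phic_def)
      also have "\<dots> = J (twisted_circ G rhd \<Phi> ?a (\<Phi> ?b))" using Phi_circ[OF ab] by simp
      also have "\<dots> = circc (fst z) (Phic (snd z))"
        using elim(2,3) Kb by (simp add: circc_def mul_def twisted_circ_def rhdc_def Phic_def[of "fst z"] K_J)
      finally show ?case .
    qed
  qed
  from jet2_unique(2)[OF jet2_cong[OF 1 this] 2]
  have q: "\<phi> (Q a a + T a b + B (\<phi> a) b) + Q (\<phi> a + b) (\<phi> a + b)
    = Q b b + (Q a a + T a (\<phi> b) + B (\<phi> a) (\<phi> b))" for a b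
    using \<phi>.zero by (metis (no_types, lifting) add_0_left fst_conv snd_conv)
  have q0: "\<phi> (Q a a) + Q (\<phi> a) (\<phi> a) = Q a a"
    using q[of a 0] by (simp add: T.zero_right B.zero_right Q.zero_right \<phi>.zero)
  have "\<phi> (T a b + B (\<phi> a) b) + 2 *\<^sub>R Q (\<phi> a) b
    = (\<phi> (Q a a + T a b + B (\<phi> a) b) + Q (\<phi> a + b) (\<phi> a + b)) - (\<phi> (Q a a) + Q (\<phi> a) (\<phi> a)) - Q b b"
    by (simp add: \<phi>.add Q.add_left Q.add_right Q_sym[of b "\<phi> a"] scaleR_2)
  also have "\<dots> = T a (\<phi> b) + B (\<phi> a) (\<phi> b)" unfolding q q0 by simp
  finally show ?thesis .
qed

text \<open>The bilinear part of \<open>L (a \<circ> b) z = L a (L b z)\<close>, where \<open>L u\<close> is the tangent map of the action of \<open>u\<close> and \<open>S\<close>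
the quadratic part of \<open>u \<mapsto> L u z\<close>. Replacing \<open>b\<close> by \<open>\<phi> b\<close> makes the terms with \<open>S\<close> symmetric.\<close>

lemma action_relation:
  obtains S where "bounded_bilinear S"
    "\<And>a b. T (T a b + B (\<phi> a) b) z + S (\<phi> a) b + S b (\<phi> a) = T a (T b z)"
proof -
  interpret \<phi>: bounded_linear \<phi> by (rule \<phi>_linear)
  interpret Q: bounded_bilinear Q by (rule jet2D(2)[OF jet_Ph])
  interpret T: bounded_bilinear T by (rule T_bilinear)
  interpret B: bounded_bilinear B by (rule B_bilinear)
  let ?A = "\<lambda>u. fd (rhdc u) 0"
  obtain S where "jet2 (\<lambda>u. ?A u z - ?A 0 z) (\<lambda>u. mixed_deriv rhdc u z) S"
    by (rule jet2_partial_deriv[OF fin fin rh_smooth])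
  then have S: "jet2 (\<lambda>u. ?A u z - z) (\<lambda>u. T u z) S" unfolding fd_rh_0 T_def .
  interpret S: bounded_bilinear S by (rule jet2D(2)[OF S])
  let ?y = "\<lambda>b. ?A b z - z"
  \<comment> \<open>how much the first element moves the displacement of \<open>z\<close> caused by the second; by bilinearity its
    leading term \<open>T a (T b z)\<close> is already of second order, so first-order increments suffice\<close>
  define X where "X p = ?A (fst p) (?y (snd p)) - ?y (snd p)" for p
  have X: "jet2 X (\<lambda>p. 0) (\<lambda>p q. T (fst p) (T (snd q) z))"
    unfolding jet2_def
  proof (intro conjI)
    show "bounded_linear (\<lambda>p::'e \<times> 'e. 0::'e)" by (rule bounded_linear_zero)
    show "bounded_bilinear (\<lambda>p q. T (fst p) (T (snd q) z))"
      by (rule bounded_bilinear.comp[OF T_bilinear bounded_linear_fst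
            bounded_linear_compose[OF T.bounded_linear_left bounded_linear_snd]])
    have y: "jet2 (\<lambda>p::'e \<times> 'e. ?y (snd p)) (\<lambda>p. T (snd p) z) (\<lambda>p q. T 0 z + S (snd p) (snd q))"
      by (rule jet2_compose[OF jet2_linear[OF bounded_linear_snd] S])
    have 1: "quad_small (\<lambda>p. T (fst p) (?y (snd p) - T (snd p) z))"
      by (rule quad_small_bilinear[OF T_bilinear lin_bound_linear[OF bounded_linear_fst]
            jet2_remainder_lin_small[OF y]])
    have 2: "quad_small (\<lambda>p. X p - T (fst p) (?y (snd p)))"
      unfolding quad_small_def
    proof (intro allI impI)
      fix e :: real assume e: "e > 0"
      obtain C where C: "C > 0" "\<forall>\<^sub>F p in nhds 0. norm (?y (snd (p::'e \<times> 'e))) \<le> C * norm p"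
        using jet2_lin_bound[OF y] unfolding lin_bound_def by blast
      have eC: "e / C > 0" using e C(1) by simp
      have inc: "\<forall>\<^sub>F u in nhds 0. \<forall>y. norm (?A u y - y - T u y) \<le> e / C * norm u * norm y"
        using mixed_deriv_increment_right[OF fin fin rh_smooth eC] unfolding fd_rh_0 T_def .
      have "\<forall>\<^sub>F p in nhds (0::'e \<times> 'e). (\<forall>y. norm (?A (fst p) y - y - T (fst p) y) \<le> e / C * norm (fst p) * norm y) \<and> True"
        by (rule eventually_fst_snd_0[OF inc]) simp
      then show "\<forall>\<^sub>F p in nhds 0. norm (X p - T (fst p) (?y (snd p))) \<le> e * (norm p)\<^sup>2"
        using C(2)
      proof eventually_elim
        case (elim p)
        have "norm (X p - T (fst p) (?y (snd p))) \<le> e / C * norm (fst p) * norm (?y (snd p))"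
          using elim(1) unfolding X_def by blast
        also have "\<dots> \<le> e / C * norm p * (C * norm p)"
        proof (rule mult_mono)
          show "e / C * norm (fst p) \<le> e / C * norm p"
            using eC norm_fst_le[of "fst p" "snd p"] by (intro mult_left_mono) simp_all
          show "0 \<le> e / C * norm p" by (rule mult_nonneg_nonneg[OF less_imp_le[OF eC] norm_ge_zero])
        qed (use elim(2) in simp_all)
        also have "\<dots> = e * (norm p)\<^sup>2" using C(1) by (simp add: power2_eq_square)
        finally show ?case .
      qed
    qed
    have "X p - T (fst p) (?y (snd p)) + T (fst p) (?y (snd p) - T (snd p) z)
      = X p - 0 - T (fst p) (T (snd p) z)" for p by (simp add: T.diff_right)
    with quad_small_add[OF 2 1] show "quad_small (\<lambda>p. X p - 0 - T (fst p) (T (snd p) z))" by simp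
  qed
  have r: "jet2 (\<lambda>p. ?y (fst p) + ?y (snd p) + X p) (\<lambda>p. T (fst p) z + T (snd p) z + 0)
    (\<lambda>p q. (T 0 z + S (fst p) (fst q)) + (T 0 z + S (snd p) (snd q)) + T (fst p) (T (snd q) z))"
    by (rule jet2_add[OF jet2_add[OF jet2_compose[OF jet2_linear[OF bounded_linear_fst] S]
            jet2_compose[OF jet2_linear[OF bounded_linear_snd] S]] X])
  note l = jet2_compose[OF jet_circ S]
  have dom: "\<forall>\<^sub>F b in nhds 0. \<forall>\<^sub>F v in nhds 0. rhd (K b) (K v) \<in> fst c"
    using eventually_nhds_Pair[OF ev_rh] by simp
  have "\<forall>\<^sub>F p in nhds 0. ?y (circc (fst p) (snd p)) = ?y (fst p) + ?y (snd p) + X p"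
    using ev_circ eventually_fst_snd_0[OF eventually_conj[OF fd_rh K_carrier]
        eventually_conj[OF eventually_conj[OF fd_rh K_carrier] eventually_conj[OF dom rh_0_right]]]
  proof eventually_elim
    case (elim p)
    let ?a = "fst p" and ?b = "snd p"
    have a: "(rhdc ?a has_derivative ?A ?a) (at 0)" "K ?a \<in> carrier G"
      and b: "(rhdc ?b has_derivative ?A ?b) (at 0)" "K ?b \<in> carrier G"
      "\<forall>\<^sub>F v in nhds 0. rhd (K ?b) (K v) \<in> fst c" "rhdc ?b 0 = 0"
      using elim(2) by auto
    have "(rhdc ?a has_derivative ?A ?a) (at (rhdc ?b 0))" unfolding b(4) by (rule a(1))
    from has_derivative_compose[OF b(1) this]
    have d: "((\<lambda>v. rhdc ?a (rhdc ?b v)) has_derivative (\<lambda>y. ?A ?a (?A ?b y))) (at 0)" .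
    have "\<forall>\<^sub>F v in nhds 0. rhdc ?a (rhdc ?b v) = rhdc (circc ?a ?b) v"
      using b(3) K_carrier
    proof eventually_elim
      case (elim v)
      have "rhdc (circc ?a ?b) v = J (rhd (twisted_circ G rhd \<Phi> (K ?a) (K ?b)) (K v))"
        using \<open>K (circc ?a ?b) = _ \<and> _\<close> by (simp add: rhdc_def)
      also have "\<dots> = J (rhd (K ?a) (rhd (K ?b) (K v)))" using circ_rhd[OF a(2) b(2) elim(2)] by simp
      also have "\<dots> = rhdc ?a (rhdc ?b v)" unfolding rhdc_def K_J[OF elim(1)] ..
      finally show ?case ..
    qed
    from frechet_derivative_at[OF has_derivative_eventually_cong[OF d this]]
    have "?A (circc ?a ?b) z = ?A ?a (?A ?b z)" by metis
    moreover have "?A ?a (?A ?b z) = ?A ?a (?y ?b) + ?A ?a z"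
      using linear_diff[OF has_derivative_linear[OF a(1)], of "?A ?b z" z] by simp
    ultimately show ?case unfolding X_def by simp
  qed
  from jet2_unique(2)[OF jet2_cong[OF l this] r]
  have q: "T (Q a a + T a b + B (\<phi> a) b) z + S (\<phi> a + b) (\<phi> a + b) = S a a + S b b + T a (T b z)" for a b
    using T.zero_left by (metis (no_types, lifting) add_0_left fst_conv snd_conv)
  have 0: "T (Q a a) z + S (\<phi> a) (\<phi> a) = S a a" for a
    using q[of a 0] by (simp add: T.zero_right T.zero_left B.zero_right S.zero_right)
  have "T (T a b + B (\<phi> a) b) z + S (\<phi> a) b + S b (\<phi> a) = T a (T b z)" for a b
  proof -
    have "T (T a b + B (\<phi> a) b) z + S (\<phi> a) b + S b (\<phi> a)
      = (T (Q a a + T a b + B (\<phi> a) b) z + S (\<phi> a + b) (\<phi> a + b)) - (T (Q a a) z + S (\<phi> a) (\<phi> a)) - S b b"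
      by (simp add: T.add_left S.add_left S.add_right)
    also have "\<dots> = T a (T b z)" unfolding q 0 by simp
    finally show ?thesis .
  qed
  then show ?thesis using that S.bounded_bilinear_axioms by blast
qed

lemma log_Phi_exp_quad_small:
  "quad_small (\<lambda>x. lie_log G M c E (\<Phi> (ex x)) - \<phi> x - (1/2) *\<^sub>R H x x)"
  unfolding quad_small_def
proof (intro allI impI)
  let ?rem = "\<lambda>x. lie_log G M c E (\<Phi> (ex x)) - \<phi> x - (1/2) *\<^sub>R H x x"
  fix e :: real assume e: "e > 0"
  have H: "bilinear H" and lim: "((\<lambda>x. ?rem x /\<^sub>R (norm x)\<^sup>2) \<longlongrightarrow> 0) (at 0)"
    using hessian unfolding is_exp_hessian_def tangent_map_Phi by blast+
  have "lie_log G M c E \<one> = 0"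
    unfolding lie_log_def using inv_into_f_f[OF exp_inj E_0] by (simp add: exp_0)
  then have 0: "?rem 0 = 0"
    using linear_0[OF bounded_linear.linear[OF \<phi>_linear]] bilinear_lzero[OF H] by (simp add: exp_0 Phi_one)
  have "\<forall>\<^sub>F x in at 0. norm (?rem x /\<^sub>R (norm x)\<^sup>2) < e"
    using tendstoD[OF lim e] by (simp add: dist_norm)
  then show "\<forall>\<^sub>F x in nhds 0. norm (?rem x) \<le> e * (norm x)\<^sup>2"
    unfolding eventually_at_filter
  proof eventually_elim
    case (elim x)
    show ?case
    proof (cases "x = 0")
      case True
      show ?thesis unfolding True 0 by simp
    next
      case False
      then have "norm (?rem x /\<^sub>R (norm x)\<^sup>2) < e" using elim by simp
      moreover have "norm (v /\<^sub>R a) < e \<Longrightarrow> norm v \<le> e * a" if "a > 0" for v :: 'e and a :: real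
        using that by (simp add: field_simps)
      ultimately show ?thesis using False by simp
    qed
  qed
qed

text \<open>Two expansions of \<open>\<Phi> (exp (t x))\<close> in the chart: through \<open>exp (log (\<Phi> (exp (t x))))\<close> it involves \<open>H\<close> and \<open>B (\<phi> x) (\<phi> x)\<close>,
directly it involves \<open>Q\<close> and \<open>\<phi> (B x x)\<close>. Restriction to lines reduces \<open>H\<close>, of which only algebraic
bilinearity is known, to the single value \<open>H x x\<close>.\<close>

lemma hessian_chart: "H x x = \<phi> (B x x) + 2 *\<^sub>R Q x x - B (\<phi> x) (\<phi> x)"
proof -
  interpret \<phi>: bounded_linear \<phi> by (rule \<phi>_linear)
  have H: "bilinear H" using hessian unfolding is_exp_hessian_def by blast
  let ?l = "\<lambda>t. lie_log G M c E (\<Phi> (ex (t *\<^sub>R x)))"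
  have lx: "bounded_linear (\<lambda>t. t *\<^sub>R x)" by (rule bounded_linear_scaleR_left)
  have l: "jet2 ?l (\<lambda>t. t *\<^sub>R \<phi> x) (\<lambda>s t. (s * t) *\<^sub>R ((1/2) *\<^sub>R H x x))"
    unfolding jet2_def
  proof (intro conjI)
    show "bounded_linear (\<lambda>t. t *\<^sub>R \<phi> x)" by (rule bounded_linear_scaleR_left)
    show "bounded_bilinear (\<lambda>s t. (s * t) *\<^sub>R ((1/2) *\<^sub>R H x x))"
      by (rule bounded_linear_bilinear_compose[OF bounded_linear_scaleR_left bounded_bilinear_mult])
    have "H (t *\<^sub>R x) (t *\<^sub>R x) = (t * t) *\<^sub>R H x x" for t
      by (simp add: bilinear_lmul[OF H] bilinear_rmul[OF H])
    then show "quad_small (\<lambda>t. ?l t - t *\<^sub>R \<phi> x - (t * t) *\<^sub>R ((1/2) *\<^sub>R H x x))"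
      using quad_small_compose[OF log_Phi_exp_quad_small lin_bound_linear[OF lx]]
      by (simp add: \<phi>.scaleR mult.commute)
  qed
  note 1 = jet2_compose[OF l exp_jet]
  note 2 = jet2_compose[OF jet2_compose[OF jet2_linear[OF lx] exp_jet] jet_Ph]
  have "\<forall>\<^sub>F t in nhds 0. J (ex (?l t)) = Phic (J (ex (t *\<^sub>R x)))"
  proof -
    have "continuous_map euclideanreal (mtop M) (\<lambda>t. ex (t *\<^sub>R x))"
      using opsD(1)[OF ops_exp] unfolding smooth_map_def real_manifold_def by simp
    moreover have "continuous_map (mtop M) (mtop M) \<Phi>" using smooth_Phi unfolding smooth_map_def by blast
    ultimately have "continuous_map euclideanreal (mtop M) (\<lambda>t. \<Phi> (ex (t *\<^sub>R x)))"
      using continuous_map_compose[of euclideanreal "mtop M" "\<lambda>t. ex (t *\<^sub>R x)" "mtop M" \<Phi>] by (simp add: comp_def)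
    from openin_continuous_map_preimage[OF this exp_open]
    have "open {t. \<Phi> (ex (t *\<^sub>R x)) \<in> ex ` E}" by simp
    moreover have "0 \<in> {t. \<Phi> (ex (t *\<^sub>R x)) \<in> ex ` E}"
      using imageI[OF E_0, of ex] by (simp add: exp_0 Phi_one)
    ultimately have "\<forall>\<^sub>F t in nhds 0. t \<in> {t. \<Phi> (ex (t *\<^sub>R x)) \<in> ex ` E}" by (rule eventually_nhds_in_open)
    then show ?thesis using exp_curve_eventually[of x]
    proof eventually_elim
      case (elim t)
      have "ex (?l t) = \<Phi> (ex (t *\<^sub>R x))"
        unfolding lie_log_def by (rule f_inv_into_f) (use elim(1) in simp)
      then show ?case unfolding Phic_def K_J[OF elim(2)] by simp
    qed
  qed
  from jet2_unique(2)[OF jet2_cong[OF 1 this] 2, of 1]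
  have "(1/2) *\<^sub>R H x x + (1/2) *\<^sub>R B (\<phi> x) (\<phi> x) = \<phi> ((1/2) *\<^sub>R B x x) + Q x x" by simp
  then have "2 *\<^sub>R ((1/2) *\<^sub>R H x x + (1/2) *\<^sub>R B (\<phi> x) (\<phi> x)) = 2 *\<^sub>R (\<phi> ((1/2) *\<^sub>R B x x) + Q x x)" by simp
  then show ?thesis by (simp add: \<phi>.scaleR scaleR_add_right algebra_simps)
qed

lemma hessian_polarized:
  "2 *\<^sub>R H x y = \<phi> (B x y + B y x) + 4 *\<^sub>R Q x y - (B (\<phi> x) (\<phi> y) + B (\<phi> y) (\<phi> x))"
proof -
  interpret \<phi>: bounded_linear \<phi> by (rule \<phi>_linear)
  interpret Q: bounded_bilinear Q by (rule jet2D(2)[OF jet_Ph])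
  interpret B: bounded_bilinear B by (rule B_bilinear)
  have H: "bilinear H" and sym: "H y x = H x y"
    using hessian unfolding is_exp_hessian_def by blast+
  have "2 *\<^sub>R H x y = H (x + y) (x + y) - H x x - H y y"
    by (simp add: bilinear_ladd[OF H] bilinear_radd[OF H] sym scaleR_2)
  also have "\<dots> = \<phi> (B x y + B y x) + 2 *\<^sub>R (Q x y + Q y x) - (B (\<phi> x) (\<phi> y) + B (\<phi> y) (\<phi> x))"
    unfolding hessian_chart
    by (simp add: \<phi>.add Q.add_left Q.add_right B.add_left B.add_right scaleR_add_right)
  also have "2 *\<^sub>R (Q x y + Q y x) = 4 *\<^sub>R Q x y"
    using Q_sym[of y x] scaleR_2[of "Q x y"] by (metis mult_2 numeral_Bit0 scaleR_left_distrib scaleR_scaleR numeral_times_numeral mult.commute scaleR_2)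
  finally show ?thesis .
qed

text \<open>The condition on the Hessian in the chart: the terms \<open>B (\<phi> x) (\<phi> y)\<close> coming from the change of coordinates
agree on both sides, because \<open>\<phi>\<close> is idempotent.\<close>

lemma Q_\<phi>_swap:
  "4 *\<^sub>R Q (\<phi> x) y + \<phi> (B (\<phi> x) y + B y (\<phi> x)) = 4 *\<^sub>R Q (\<phi> y) x + \<phi> (B (\<phi> y) x + B x (\<phi> y))"
proof -
  have "H (\<phi> x) y = H x (\<phi> y)" using hessian_sym unfolding tangent_map_Phi .
  then have "2 *\<^sub>R H (\<phi> x) y = 2 *\<^sub>R H x (\<phi> y)" by simp
  then show ?thesis unfolding hessian_polarized \<phi>_idem Q_sym[of x "\<phi> y"]
    by (simp add: add.commute)
qed

text \<open>The commutator and bracket formulas are \<open>action_relation\<close> and \<open>phi_circ_relation\<close>, antisymmetrised; in the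
latter \<open>Q_\<phi>_swap\<close> converts the remaining terms with \<open>Q\<close> into brackets under \<open>\<phi>\<close>.\<close>

lemma twisted_post_lie_algebra_T: "twisted_post_lie_algebra (lie_bracket G c) T \<phi>"
proof -
  interpret \<phi>: bounded_linear \<phi> by (rule \<phi>_linear)
  interpret T: bounded_bilinear T by (rule T_bilinear)
  interpret B: bounded_bilinear B by (rule B_bilinear)
  let ?br = "lie_bracket G c"
  show ?thesis
  proof (intro twisted_post_lie_algebra.intro twisted_post_lie_algebra_axioms.intro)
    show "lie_algebra ?br" by (rule lie_algebra_lie_bracket)
    show "bilinear T" unfolding bilinear_def
      using T.bounded_linear_left T.bounded_linear_right bounded_linear.linear by blast
    show "linear \<phi>" by (rule bounded_linear.linear[OF \<phi>_linear])
    show "T x (?br y z) = ?br (T x y) z + ?br y (T x z)" for x y z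
      using automorphism_action_derivation[OF smooth_rhd rhd_hom rhd_one_left]
      unfolding T_def rhdc_def[abs_def] .
    show "T (?br (\<phi> x) (\<phi> y) + T x (\<phi> y) - T y (\<phi> x)) z = T x (T y z) - T y (T x z)" for x y z
    proof -
      obtain S where S: "bounded_bilinear S"
        "\<And>a b. T (T a b + B (\<phi> a) b) z + S (\<phi> a) b + S b (\<phi> a) = T a (T b z)"
        by (rule action_relation[where z=z]) (rule that)
      have "T x (T y z) - T y (T x z) = T x (T (\<phi> y) z) - T y (T (\<phi> x) z)" by (simp add: T_\<phi>)
      also have "\<dots> = T (T x (\<phi> y) + B (\<phi> x) (\<phi> y)) z - T (T y (\<phi> x) + B (\<phi> y) (\<phi> x)) z"
        unfolding S(2)[symmetric] by simp
      also have "\<dots> = T (?br (\<phi> x) (\<phi> y) + T x (\<phi> y) - T y (\<phi> x)) z"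
        unfolding lie_bracket_eq T.diff_left[symmetric] by (simp add: algebra_simps)
      finally show ?thesis ..
    qed
    show "\<phi> ((1/2) *\<^sub>R ?br (\<phi> x) y + (1/2) *\<^sub>R ?br x (\<phi> y) + T x y - T y x)
      = ?br (\<phi> x) (\<phi> y) + T x (\<phi> y) - T y (\<phi> x)" for x y
    proof -
      \<comment> \<open>the values of \<open>\<phi>\<close> on mixed terms of \<open>B\<close>, in terms of which the rest is linear algebra\<close>
      define p where "p = \<phi> (B (\<phi> x) y)"
      define p' where "p' = \<phi> (B y (\<phi> x))"
      define q where "q = \<phi> (B (\<phi> y) x)"
      define q' where "q' = \<phi> (B x (\<phi> y))"
      have swap: "4 *\<^sub>R Q (\<phi> x) y + (p + p') = 4 *\<^sub>R Q (\<phi> y) x + (q + q')"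
        using Q_\<phi>_swap[of x y] unfolding \<phi>.add p_def p'_def q_def q'_def .
      have r1: "\<phi> (T x y) + p + 2 *\<^sub>R Q (\<phi> x) y = T x (\<phi> y) + B (\<phi> x) (\<phi> y)"
        using phi_circ_relation[of x y] unfolding \<phi>.add p_def .
      have r2: "\<phi> (T y x) + q + 2 *\<^sub>R Q (\<phi> y) x = T y (\<phi> x) + B (\<phi> y) (\<phi> x)"
        using phi_circ_relation[of y x] unfolding \<phi>.add q_def .
      have "2 *\<^sub>R Q (\<phi> x) y - 2 *\<^sub>R Q (\<phi> y) x = (1/2) *\<^sub>R (4 *\<^sub>R Q (\<phi> x) y - 4 *\<^sub>R Q (\<phi> y) x)"
        by (simp add: scaleR_diff_right)
      also have "4 *\<^sub>R Q (\<phi> x) y - 4 *\<^sub>R Q (\<phi> y) x = (q + q') - (p + p')"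
        using swap by (simp add: algebra_simps)
      finally have d: "2 *\<^sub>R Q (\<phi> x) y - 2 *\<^sub>R Q (\<phi> y) x = (1/2) *\<^sub>R ((q + q') - (p + p'))" .
      have "?br (\<phi> x) (\<phi> y) + T x (\<phi> y) - T y (\<phi> x)
        = (T x (\<phi> y) + B (\<phi> x) (\<phi> y)) - (T y (\<phi> x) + B (\<phi> y) (\<phi> x))"
        unfolding lie_bracket_eq by simp
      also have "\<dots> = \<phi> (T x y) - \<phi> (T y x) + (p - q) + (2 *\<^sub>R Q (\<phi> x) y - 2 *\<^sub>R Q (\<phi> y) x)"
        unfolding r1[symmetric] r2[symmetric] by simp
      also have "\<dots> = \<phi> (T x y) - \<phi> (T y x) + ((1/2) *\<^sub>R (p - p') + (1/2) *\<^sub>R (q' - q))"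
      proof -
        have "p - q + (1/2) *\<^sub>R ((q + q') - (p + p')) = (1/2) *\<^sub>R (p - p') + (1/2) *\<^sub>R (q' - q)"
        proof -
          have half: "v = (1/2) *\<^sub>R v + (1/2) *\<^sub>R v" for v :: 'e
            by (metis scaleR_half_double scaleR_add_right)
          have "p - q = (1/2) *\<^sub>R (p - q) + (1/2) *\<^sub>R (p - q)" by (rule half)
          then show ?thesis by (simp add: scaleR_diff_right scaleR_add_right)
        qed
        then show ?thesis unfolding d by (simp add: add.assoc)
      qed
      also have "\<dots> = \<phi> ((1/2) *\<^sub>R ?br (\<phi> x) y + (1/2) *\<^sub>R ?br x (\<phi> y) + T x y - T y x)"
        unfolding lie_bracket_eq p_def p'_def q_def q'_def \<phi>.diff \<phi>.add \<phi>.scaleR by simp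
      finally show ?thesis ..
    qed
    show "T (\<phi> x) y = T x y" for x y by (rule T_\<phi>)
    show "\<phi> (\<phi> x) = \<phi> x" for x by (rule \<phi>_idem)
  qed
qed

end

lemma twisted_post_lie_group_chartI:
  assumes "twisted_post_lie_group G M rhd \<Phi>" and c: "c \<in> charts_at M \<one>\<^bsub>G\<^esub>"
  obtains E H where "twisted_post_lie_group_chart G M rhd \<Phi> c E H"
proof -
  interpret twisted_post_lie_group G M rhd \<Phi> by fact
  obtain E H where EH: "exp_nbhd G M c E" "is_exp_hessian G M c E \<Phi> H"
    "\<And>x y. H (tangent_map G M c c \<Phi> x) y = H x (tangent_map G M c c \<Phi> y)"
    using hessian_condition[OF c] by blast
  have "twisted_post_lie_group_chart G M rhd \<Phi> c E H"
    by unfold_locales (fact c EH)+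
  then show ?thesis by (rule that)
qed

section \<open>Homomorphisms\<close>

text \<open>Compare second-order expansions on both sides of each identity that \<open>F\<close> satisfies. In
\<open>F (a \<rhd> b) = F a \<rhd> F b\<close> the quadratic part of \<open>F\<close> contributes the same term, in \<open>b\<close> alone, to both sides.\<close>

lemma twisted_post_lie_group_hom_tangent:
  fixes G :: "('a, 'm) monoid_scheme"
    and M :: "('a, 'e::{real_normed_vector, heine_borel}) manifold"
    and H :: "('b, 'n) monoid_scheme"
    and N :: "('b, 'f::{real_normed_vector, heine_borel}) manifold"
  assumes G: "twisted_post_lie_group_chart G M rhdG \<Phi>G c E X"
    and H: "twisted_post_lie_group_chart H N rhdH \<Phi>H d E' Y"
    and F: "twisted_post_lie_group_hom G M rhdG \<Phi>G H N rhdH \<Phi>H F"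
  shows "twisted_post_lie_algebra_hom
    (lie_bracket G c) (lie_rhd G M c rhdG) (tangent_map G M c c \<Phi>G)
    (lie_bracket H d) (lie_rhd H N d rhdH) (tangent_map H N d d \<Phi>H)
    (tangent_map G M c d F)"
proof -
  interpret G: twisted_post_lie_group_chart G M rhdG \<Phi>G c E X by (rule G)
  interpret H: twisted_post_lie_group_chart H N rhdH \<Phi>H d E' Y by (rule H)
  have sF: "smooth_map M N F" and hF: "F \<in> hom G H"
    and rF: "\<And>a b. a \<in> carrier G \<Longrightarrow> b \<in> carrier G \<Longrightarrow> F (rhdG a b) = rhdH (F a) (F b)"
    and pF: "\<And>a. a \<in> carrier G \<Longrightarrow> F (\<Phi>G a) = \<Phi>H (F a)"
    using F unfolding twisted_post_lie_group_hom_def twisted_post_group_hom_def by blast+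
  have F1: "F \<one>\<^bsub>G\<^esub> = \<one>\<^bsub>H\<^esub>" by (rule hom_one[OF hF G.is_group H.is_group])
  then have F1d: "F \<one>\<^bsub>G\<^esub> \<in> fst d" using H.one_in_c by simp
  define h where "h u = H.J (F (G.K u))" for u
  note s = smooth_map_centred[OF sF G.c_atlas G.c_chart G.one_in_c H.c_atlas H.c_open F1d]
  have sm: "smooth_near 0 h" using s(1) unfolding h_def[abs_def] F1 .
  have dom: "\<forall>\<^sub>F u in nhds 0. F (G.K u) \<in> fst d" by (rule s(2))
  have "h 0 = 0" by (simp add: h_def G.K_0 F1)
  then obtain f R where jet: "jet2 h f R" using jet2_taylor[OF G.fin sm] by auto
  interpret f: bounded_linear f by (rule jet2D(1)[OF jet])
  have f_eq: "tangent_map G M c d F = f"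
    by (rule ext, rule G.tangent_map_has_derivative(2)[where q="\<one>\<^bsub>H\<^esub>"])
      (rule jet2_has_derivative[OF jet, unfolded h_def[abs_def]])
  have phi: "f (G.\<phi> x) = H.\<phi> (f x)" for x
  proof -
    have "\<forall>\<^sub>F u in nhds 0. h (G.Phic u) = H.Phic (h u)"
      using dom G.ev_Ph G.K_carrier
      by eventually_elim (simp add: h_def G.Phic_def H.Phic_def G.K_J H.K_J pF)
    from jet2_unique(1)[OF jet2_cong[OF jet2_compose[OF G.jet_Ph jet] this] jet2_compose[OF jet H.jet_Ph]]
    show ?thesis by metis
  qed
  have tr: "f (G.T x y) = H.T (f x) (f y)" for x y
  proof -
    note 1 = jet2_compose[OF G.jet_rh jet]
    note 2 = jet2_binary_compose[OF H.jet_rh jet2_compose[OF jet2_linear[OF bounded_linear_fst] jet]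
        jet2_compose[OF jet2_linear[OF bounded_linear_snd] jet]]
    have ev: "\<forall>\<^sub>F z in nhds 0. h (G.rhdc (fst z) (snd z)) = H.rhdc (h (fst z)) (h (snd z))"
      using eventually_fst_snd_0[OF eventually_conj[OF dom G.K_carrier] eventually_conj[OF dom G.K_carrier]]
        G.ev_rh[folded zero_prod_def]
      by eventually_elim (simp add: h_def G.rhdc_def H.rhdc_def G.K_J H.K_J rF)
    from jet2_unique(2)[OF jet2_cong[OF 1 ev] 2, of "(x, y)"]
    show ?thesis by (simp add: f.zero)
  qed
  have br: "f (lie_bracket G c x y) = lie_bracket H d (f x) (f y)" for x y
    by (rule hom_preserves_bracket[OF G.lie_group_chart_axioms H.lie_group_chart_axioms hF dom])
      (rule jet[unfolded h_def[abs_def]])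
  show ?thesis
    unfolding f_eq G.lie_rhd_eq H.lie_rhd_eq G.tangent_map_Phi H.tangent_map_Phi
    by (intro twisted_post_lie_algebra_hom.intro twisted_post_lie_algebra_hom_axioms.intro
        G.twisted_post_lie_algebra_T H.twisted_post_lie_algebra_T f.linear br tr phi)
qed

theorem theorem5p10:
  fixes G :: "('a, 'm) monoid_scheme"
    and M :: "('a, 'e::{real_normed_vector, heine_borel}) manifold"
    and rhdG :: "'a \<Rightarrow> 'a \<Rightarrow> 'a" and \<Phi>G :: "'a \<Rightarrow> 'a" and c :: "('a, 'e) chart"
  assumes "twisted_post_lie_group G M rhdG \<Phi>G"
    and "c \<in> charts_at M \<one>\<^bsub>G\<^esub>"
  shows "twisted_post_lie_algebra (lie_bracket G c) (lie_rhd G M c rhdG) (tangent_map G M c c \<Phi>G)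
    \<and> (\<forall>x y.
         ((\<lambda>t. tangent_map G M c c (rhdG (lie_exp G M c (t *\<^sub>R x))) y)
            has_vector_derivative lie_rhd G M c rhdG x y) (at 0) \<and>
         ((\<lambda>t. vector_derivative
                 (\<lambda>s. snd c (rhdG (lie_exp G M c (t *\<^sub>R x)) (lie_exp G M c (s *\<^sub>R y)))) (at 0))
            has_vector_derivative lie_rhd G M c rhdG x y) (at 0))
    \<and> (\<forall>(H :: ('b, 'n) monoid_scheme) (N :: ('b, 'f::{real_normed_vector, heine_borel}) manifold)
          rhdH \<Phi>H d F.
         twisted_post_lie_group H N rhdH \<Phi>H \<longrightarrow>
         d \<in> charts_at N \<one>\<^bsub>H\<^esub> \<longrightarrow>
         twisted_post_lie_group_hom G M rhdG \<Phi>G H N rhdH \<Phi>H F \<longrightarrow>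
         twisted_post_lie_algebra_hom
           (lie_bracket G c) (lie_rhd G M c rhdG) (tangent_map G M c c \<Phi>G)
           (lie_bracket H d) (lie_rhd H N d rhdH) (tangent_map H N d d \<Phi>H)
           (tangent_map G M c d F))"
proof -
  obtain E X where G: "twisted_post_lie_group_chart G M rhdG \<Phi>G c E X"
    by (rule twisted_post_lie_group_chartI[OF assms])
  interpret G: twisted_post_lie_group_chart G M rhdG \<Phi>G c E X by (rule G)
  have 1: "twisted_post_lie_algebra (lie_bracket G c) (lie_rhd G M c rhdG) (tangent_map G M c c \<Phi>G)"
    unfolding G.lie_rhd_eq G.tangent_map_Phi by (rule G.twisted_post_lie_algebra_T)
  have 2: "((\<lambda>t. tangent_map G M c c (rhdG (lie_exp G M c (t *\<^sub>R x))) y)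
      has_vector_derivative lie_rhd G M c rhdG x y) (at 0)" for x y
    unfolding G.lie_rhd_eq by (rule G.tangent_map_rhd)
  have 3: "twisted_post_lie_algebra_hom
      (lie_bracket G c) (lie_rhd G M c rhdG) (tangent_map G M c c \<Phi>G)
      (lie_bracket H d) (lie_rhd H N d rhdH) (tangent_map H N d d \<Phi>H)
      (tangent_map G M c d F)"
    if H: "twisted_post_lie_group H N rhdH \<Phi>H" "d \<in> charts_at N \<one>\<^bsub>H\<^esub>"
      and F: "twisted_post_lie_group_hom G M rhdG \<Phi>G H N rhdH \<Phi>H F"
    for H :: "('b, 'n) monoid_scheme" and N :: "('b, 'f::{real_normed_vector, heine_borel}) manifold"
      and rhdH \<Phi>H d F
  proof -
    obtain E' Y where "twisted_post_lie_group_chart H N rhdH \<Phi>H d E' Y"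
      by (rule twisted_post_lie_group_chartI[OF H])
    from twisted_post_lie_group_hom_tangent[OF G this F] show ?thesis .
  qed
  show ?thesis
    by (intro conjI allI impI 1 2 3) (assumption+ | rule 2[unfolded tangent_map_def])+
qed

end
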